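(* One has $$\gamma_h:=\inf_{\mathfrak{w}\in\mathbb{V}_h(\Sigma)\setminus\{0\}}\frac{\|(\mathrm{Id}+\Pi S_h)\mathfrak{w}\|_{t_h}}{\|\mathfrak{w}\|_{t_h}}\ \ge\ \frac{\sqrt2\,\alpha_h}{(\lambda_h^+)^2+(2\|a\|/\lambda_h^-)^2}.$$
   Context: Coefficients. Let $d\in\{1,2,3\}$, $\Omega\subset\mathbb{R}^d$ a bounded polygonal/polyhedral domain, $\kappa:\Omega\to\mathbb{C}$ and $\mu:\Omega\to(0,+\infty)$ measurable with $\mathrm{Re}\,\kappa\ge0$, $\mathrm{Im}\,\kappa\ge0$ in $\Omega$, $\kappa_\infty:=\max(1,\|\kappa\|_{L^\infty(\Omega)})<\infty$, $\|\mu\|_{L^\infty(\Omega)}+\|\mu^{-1}\|_{L^\infty(\Omega)}<\infty$; $\kappa$ has measurable boundary values on $\partial\Omega$ with the same signs and $|\kappa|\le\kappa_\infty$. Norm: $\|v\|_{H^1(\omega)}^2:=\|\nabla v\|_{L^2(\omega)}^2+\kappa_\infty^2\|v\|_{L^2(\omega)}^2$. Mesh and spaces. $\mathcal{T}_h(\Omega)$ is a regular simplicial triangulation of $\Omega$; for fixed $k\ge1$, $V_h(\Omega)$ is the space of continuous complex-valued functions on $\overline\Omega$ that are polynomials of degree $\le k$ on each cell. $\overline\Omega=\cup_{j=1}^J\overline{\Omega}_j^h$ with pairwise disjoint polyhedral $\Omega_j^h$ whose closures are unions of mesh cells; $\Gamma_j^h:=\partial\Omega_j^h$, $\Sigma:=\cup_j\Gamma_j^h$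 (cross-points allowed). $V_h(\Omega_j^h)$, $V_h(\Gamma_j^h)$ are the spaces of restrictions of functions of $V_h(\Omega)$. $\mathbb{H}^1(\Omega):=\{u\in L^2(\Omega):u|_{\Omega_j^h}\in H^1(\Omega_j^h)\ \forall j\}$ with $\|u\|_{\mathbb{H}^1(\Omega)}^2:=\sum_j\|u|_{\Omega_j^h}\|_{H^1(\Omega_j^h)}^2$; $\mathbb{V}_h(\Omega):=\{u\in L^2(\Omega): u|_{\Omega_j^h}\in V_h(\Omega_j^h)\ \forall j\}$; $v|_\Sigma:=(v|_{\Gamma_1^h},\dots,v|_{\Gamma_J^h})$ with traces from the interior of $\Omega_j^h$. $\mathbb{V}_h(\Sigma):=V_h(\Gamma_1^h)\times\cdots\times V_h(\Gamma_J^h)$ and $V_h(\Sigma):=\{v|_\Sigma: v\in V_h(\Omega)\}$. For $\mathfrak{q}=(q_1,\dots,q_J)\in\mathbb{V}_h(\Sigma)$, $\|\mathfrak{q}\|_{\rho_h}^2:=\sum_{j=1}^J\min\{\|v\|_{H^1(\Omega_j^h)}^2: v\in V_h(\Omega_j^h),\ v|_{\Gamma_j^h}=q_j\}$. Form. On $\mathbb{H}^1(\Omega)$, with interior traces on $\partial\Omega_j^h\cap\partial\Omega$, $a(u,v):=\sum_{j=1}^J\big(\int_{\Omega_j^h}\mu\nabla u\cdot\nabla\overline v-\kappa^2u\overline v\,dx-i\int_{\partial\Omega_j^h\cap\partial\Omega}\kappa u\overline v\,d\sigma\big)$, and $\|a\|:=\sup_{u,v\in\mathbb{H}^1(\Omega)\setminus\{0\}}\frac{|a(u,v)|}{\|u\|_{\mathbb{H}^1(\Omega)}\|v\|_{\mathbb{H}^1(\Omega)}}$.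 Assumptions. $\alpha_h:=\inf_{u\in V_h(\Omega)\setminus\{0\}}\sup_{v\in V_h(\Omega)\setminus\{0\}}\frac{|a(u,v)|}{\|u\|_{H^1(\Omega)}\|v\|_{H^1(\Omega)}}>0$; $t_h(\cdot,\cdot)$ is a scalar product on $\mathbb{V}_h(\Sigma)$ (linear in the first, antilinear in the second argument), $\|\mathfrak{w}\|_{t_h}:=\sqrt{t_h(\mathfrak{w},\mathfrak{w})}$, and $\lambda_h^-:=\inf_{\mathfrak{w}\ne0}\|\mathfrak{w}\|_{t_h}/\|\mathfrak{w}\|_{\rho_h}$, $\lambda_h^+:=\sup_{\mathfrak{w}\ne0}\|\mathfrak{w}\|_{t_h}/\|\mathfrak{w}\|_{\rho_h}$ over $\mathfrak{w}\in\mathbb{V}_h(\Sigma)\setminus\{0\}$. Operators. $\Pi:\mathbb{V}_h(\Sigma)\to\mathbb{V}_h(\Sigma)$ is such that $(\mathrm{Id}+\Pi)/2$ is the $t_h$-orthogonal projector onto $V_h(\Sigma)$. $S_h(\mathfrak{p}):=\mathfrak{p}+2i\,w|_\Sigma$, where $w\in\mathbb{V}_h(\Omega)$ is the unique solution of $a(w,v)-i\,t_h(w|_\Sigma,v|_\Sigma)=t_h(\mathfrak{p},v|_\Sigma)$ for all $v\in\mathbb{V}_h(\Omega)$. *)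

theory Defs
  imports
    "HOL-Analysis.Analysis"
    "HOL-Probability.Essential_Supremum"
    "HOL-Library.Function_Algebras"
begin

section \<open>Surface measure\<close>

definition hausdorff_pre :: "nat \<Rightarrow> real \<Rightarrow> 'a::metric_space set \<Rightarrow> ennreal" where
  "hausdorff_pre s \<delta> A =
     (INF C \<in> {C :: nat \<Rightarrow> 'a set. A \<subseteq> (\<Union>n. C n) \<and> (\<forall>n. bounded (C n) \<and> diameter (C n) \<le> \<delta>)}.
        \<Sum>n. if C n = {} then 0 else ennreal (unit_ball_vol (real s) * (diameter (C n) / 2) ^ s))"

definition hausdorff_outer :: "nat \<Rightarrow> 'a::metric_space set \<Rightarrow> ennreal" where
  "hausdorff_outer s A = (SUP \<delta> \<in> {0<..}. hausdorff_pre s \<delta> A)"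

text \<open>The factor \<^term>\<open>unit_ball_vol (real s)\<close> normalises the measure so that, for
  \<open>s = d - 1\<close>, it is the usual surface measure on polyhedral surfaces in \<open>\<real>\<^sup>d\<close>; for \<open>s = 0\<close> it
  is the counting measure.\<close>

definition hausdorff_measure :: "nat \<Rightarrow> 'a::metric_space measure" where
  "hausdorff_measure s =
     measure_of UNIV (lambda_system UNIV UNIV (hausdorff_outer s)) (hausdorff_outer s)"

definition surface_measure :: "(real ^ 'n) measure" where
  "surface_measure = hausdorff_measure (CARD('n) - 1)"


section \<open>Sobolev functions and traces\<close>

definition L2 :: "(real ^ 'n) set \<Rightarrow> (real ^ 'n \<Rightarrow> 'b::real_normed_vector) set" where
  "L2 \<omega> = {f. f \<in> borel_measurable (lebesgue_on \<omega>) \<and>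
              integrable (lebesgue_on \<omega>) (\<lambda>x. (norm (f x))\<^sup>2)}"

definition weak_gradient ::
    "(real ^ 'n) set \<Rightarrow> (real ^ 'n \<Rightarrow> complex) \<Rightarrow> (real ^ 'n \<Rightarrow> complex ^ 'n) \<Rightarrow> bool" where
  "weak_gradient \<omega> u g \<longleftrightarrow>
     (\<forall>(\<phi> :: real ^ 'n \<Rightarrow> real) G.
        (\<forall>x. GDERIV \<phi> x :> G x) \<and> continuous_on UNIV G \<and>
        compact (closure {x. \<phi> x \<noteq> 0}) \<and> closure {x. \<phi> x \<noteq> 0} \<subseteq> \<omega> \<longrightarrow>
        (\<forall>i. (LINT x|lebesgue_on \<omega>. u x * of_real (G x $ i)) =
             - (LINT x|lebesgue_on \<omega>. g x $ i * of_real (\<phi> x))))"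

definition H1 :: "(real ^ 'n) set \<Rightarrow> (real ^ 'n \<Rightarrow> complex) set" where
  "H1 \<omega> = {u \<in> L2 \<omega>. \<exists>g \<in> L2 \<omega>. weak_gradient \<omega> u g}"

definition grad :: "(real ^ 'n) set \<Rightarrow> (real ^ 'n \<Rightarrow> complex) \<Rightarrow> real ^ 'n \<Rightarrow> complex ^ 'n" where
  "grad \<omega> u = (SOME g. g \<in> L2 \<omega> \<and> weak_gradient \<omega> u g)"

text \<open>The trace at a boundary point is the \<open>L\<^sup>1\<close>-approximate limit from inside \<open>\<omega>\<close>. For a Sobolev
  function on a polyhedral set it exists at almost every boundary point and agrees with the
  continuous extension of the restriction operator from smooth functions; for a function that
  extends continuously to the closure it exists everywhere and is the boundary value.\<close>

definition has_trace ::
    "(real ^ 'n) set \<Rightarrow> (real ^ 'n \<Rightarrow> complex) \<Rightarrow> real ^ 'n \<Rightarrow> complex \<Rightarrow> bool" where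
  "has_trace \<omega> u x z \<longleftrightarrow>
     ((\<lambda>r. (LINT y|lebesgue_on (ball x r \<inter> \<omega>). cmod (u y - z)) / measure lebesgue (ball x r \<inter> \<omega>))
        \<longlongrightarrow> 0) (at_right 0)"

definition bdry_trace :: "(real ^ 'n) set \<Rightarrow> (real ^ 'n \<Rightarrow> complex) \<Rightarrow> real ^ 'n \<Rightarrow> complex" where
  "bdry_trace \<omega> u x = (if \<exists>!z. has_trace \<omega> u x z then THE z. has_trace \<omega> u x z else 0)"


section \<open>Geometry, coefficients and mesh\<close>

record ('n::finite) ddm =
  omega :: "(real ^ 'n) set"                \<comment> \<open>\<open>\<Omega>\<close>\<close>
  kappa :: "real ^ 'n \<Rightarrow> complex"  \<comment> \<open>\<open>\<kappa>\<close>, on \<open>\<Omega>\<close> together with its boundary values on \<open>\<partial>\<Omega>\<close>\<close>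
  mu :: "real ^ 'n \<Rightarrow> real"      \<comment> \<open>\<open>\<mu>\<close>\<close>
  cells :: "(real ^ 'n) set set"            \<comment> \<open>closed cells of the triangulation\<close>
  deg :: nat                                \<comment> \<open>polynomial degree \<open>k\<close>\<close>
  nsub :: nat                               \<comment> \<open>number \<open>J\<close> of subdomains\<close>
  subdom :: "nat \<Rightarrow> (real ^ 'n) set"  \<comment> \<open>\<open>\<Omega>\<^sub>j\<^sup>h\<close> for \<open>j \<in> {1..J}\<close>\<close>

text \<open>Equality with the interior of the closure excludes slits.\<close>

definition polyhedral_open :: "(real ^ 'n) set \<Rightarrow> bool" where
  "polyhedral_open U \<longleftrightarrow> U \<noteq> {} \<and> bounded U \<and> U = interior (closure U) \<and>
     (\<exists>\<P>. finite \<P> \<and> (\<forall>P \<in> \<P>. polytope P) \<and> closure U = \<Union>\<P>)"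

definition kappa_inf :: "('n::finite) ddm \<Rightarrow> real" where
  "kappa_inf P =
     max 1 (real_of_ereal (esssup (lebesgue_on (omega P)) (\<lambda>x. ereal (cmod (kappa P x)))))"

definition coefficients :: "('n::finite) ddm \<Rightarrow> bool" where
  "coefficients P \<longleftrightarrow>
     kappa P \<in> borel_measurable (lebesgue_on (omega P)) \<and>
     mu P \<in> borel_measurable (lebesgue_on (omega P)) \<and>
     (\<forall>x \<in> omega P. 0 \<le> Re (kappa P x) \<and> 0 \<le> Im (kappa P x) \<and> 0 < mu P x) \<and>
     esssup (lebesgue_on (omega P)) (\<lambda>x. ereal (cmod (kappa P x))) < \<infinity> \<and>
     esssup (lebesgue_on (omega P)) (\<lambda>x. ereal (mu P x)) < \<infinity> \<and>
     esssup (lebesgue_on (omega P)) (\<lambda>x. ereal (1 / mu P x)) < \<infinity> \<and>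
     kappa P \<in> borel_measurable (restrict_space surface_measure (frontier (omega P))) \<and>
     (\<forall>x \<in> frontier (omega P). 0 \<le> Re (kappa P x) \<and> 0 \<le> Im (kappa P x) \<and>
        cmod (kappa P x) \<le> kappa_inf P)"

definition mesh :: "('n::finite) ddm \<Rightarrow> bool" where
  "mesh P \<longleftrightarrow> triangulation (cells P) \<and> (\<forall>K \<in> cells P. int CARD('n) simplex K) \<and>
     \<Union>(cells P) = closure (omega P)"

definition decomposition :: "('n::finite) ddm \<Rightarrow> bool" where
  "decomposition P \<longleftrightarrow>
     (\<forall>j \<in> {1..nsub P}. polyhedral_open (subdom P j) \<and> (\<exists>\<K> \<subseteq> cells P. closure (subdom P j) = \<Union>\<K>)) \<and>
     disjoint_family_on (subdom P) {1..nsub P} \<and>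
     closure (omega P) = (\<Union>j \<in> {1..nsub P}. closure (subdom P j))"

definition setting :: "('n::finite) ddm \<Rightarrow> bool" where
  "setting P \<longleftrightarrow> CARD('n) \<in> {1, 2, 3} \<and> polyhedral_open (omega P) \<and> connected (omega P) \<and>
     coefficients P \<and> mesh P \<and> 1 \<le> deg P \<and> decomposition P"


section \<open>Spaces\<close>

text \<open>Functions on a set \<open>A\<close> are represented by functions on the whole space that vanish outside
  \<open>A\<close>, so that equality in the finite element spaces is equality of functions.\<close>

definition restr :: "'a set \<Rightarrow> ('a \<Rightarrow> complex) \<Rightarrow> 'a \<Rightarrow> complex" where
  "restr A f = (\<lambda>x. if x \<in> A then f x else 0)"

definition polys :: "nat \<Rightarrow> (real ^ 'n \<Rightarrow> complex) set" where
  "polys k = {p. \<exists>c :: ('n \<Rightarrow> nat) \<Rightarrow> complex.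
     p = (\<lambda>x. \<Sum>\<alpha> | sum \<alpha> UNIV \<le> k. c \<alpha> * of_real (\<Prod>i\<in>UNIV. (x $ i) ^ \<alpha> i))}"

definition Vh :: "('n::finite) ddm \<Rightarrow> (real ^ 'n \<Rightarrow> complex) set" where
  "Vh P = {u. continuous_on (closure (omega P)) u \<and> (\<forall>x. x \<notin> closure (omega P) \<longrightarrow> u x = 0) \<and>
              (\<forall>K \<in> cells P. \<exists>p \<in> polys (deg P). \<forall>x \<in> K. u x = p x)}"

definition Vh_sub :: "('n::finite) ddm \<Rightarrow> nat \<Rightarrow> (real ^ 'n \<Rightarrow> complex) set" where
  "Vh_sub P j = restr (subdom P j) ` Vh P"

definition Vh_bdry :: "('n::finite) ddm \<Rightarrow> nat \<Rightarrow> (real ^ 'n \<Rightarrow> complex) set" where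
  "Vh_bdry P j = restr (frontier (subdom P j)) ` Vh P"

definition broken_H1 :: "('n::finite) ddm \<Rightarrow> (real ^ 'n \<Rightarrow> complex) set" where
  "broken_H1 P = {u \<in> L2 (omega P). \<forall>j \<in> {1..nsub P}. u \<in> H1 (subdom P j)}"

text \<open>Elements are square integrable functions up to null sets; the continuous representative
  inside each subdomain is used, and the value \<open>0\<close> on the skeleton.\<close>

definition broken_Vh :: "('n::finite) ddm \<Rightarrow> (real ^ 'n \<Rightarrow> complex) set" where
  "broken_Vh P = {u \<in> L2 (omega P). (\<forall>j \<in> {1..nsub P}. restr (subdom P j) u \<in> Vh_sub P j) \<and>
                    (\<forall>x. x \<notin> (\<Union>j \<in> {1..nsub P}. subdom P j) \<longrightarrow> u x = 0)}"

type_synonym 'n tuple = "nat \<Rightarrow> real ^ 'n \<Rightarrow> complex"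

definition skel :: "('n::finite) ddm \<Rightarrow> (real ^ 'n \<Rightarrow> complex) \<Rightarrow> 'n tuple" where
  "skel P v = (\<lambda>j. if j \<in> {1..nsub P} then restr (frontier (subdom P j)) (bdry_trace (subdom P j) v) else 0)"

definition Vh_multi :: "('n::finite) ddm \<Rightarrow> 'n tuple set" where
  "Vh_multi P = {q. (\<forall>j \<in> {1..nsub P}. q j \<in> Vh_bdry P j) \<and> (\<forall>j. j \<notin> {1..nsub P} \<longrightarrow> q j = 0)}"

definition Vh_single :: "('n::finite) ddm \<Rightarrow> 'n tuple set" where
  "Vh_single P = skel P ` Vh P"


section \<open>Norms and the sesquilinear form\<close>

definition H1_norm :: "('n::finite) ddm \<Rightarrow> (real ^ 'n) set \<Rightarrow> (real ^ 'n \<Rightarrow> complex) \<Rightarrow> real" where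
  "H1_norm P \<omega> v = sqrt ((LINT x|lebesgue_on \<omega>. (norm (grad \<omega> v x))\<^sup>2) +
                       (kappa_inf P)\<^sup>2 * (LINT x|lebesgue_on \<omega>. (cmod (v x))\<^sup>2))"

definition broken_norm :: "('n::finite) ddm \<Rightarrow> (real ^ 'n \<Rightarrow> complex) \<Rightarrow> real" where
  "broken_norm P u = sqrt (\<Sum>j = 1..nsub P. (H1_norm P (subdom P j) u)\<^sup>2)"

text \<open>Each infimum below is a minimum, since the finite element spaces are finite-dimensional.\<close>

definition rho_norm :: "('n::finite) ddm \<Rightarrow> 'n tuple \<Rightarrow> real" where
  "rho_norm P q = sqrt (\<Sum>j = 1..nsub P.
     INF v \<in> {v \<in> Vh_sub P j. restr (frontier (subdom P j)) (bdry_trace (subdom P j) v) = q j}.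
       (H1_norm P (subdom P j) v)\<^sup>2)"

definition form ::
    "('n::finite) ddm \<Rightarrow> (real ^ 'n \<Rightarrow> complex) \<Rightarrow> (real ^ 'n \<Rightarrow> complex) \<Rightarrow> complex" where
  "form P u v = (\<Sum>j = 1..nsub P.
     (LINT x|lebesgue_on (subdom P j).
        of_real (mu P x) * (\<Sum>i\<in>UNIV. grad (subdom P j) u x $ i * cnj (grad (subdom P j) v x $ i))
        - (kappa P x)\<^sup>2 * u x * cnj (v x))
     - \<i> * (LINT x:frontier (subdom P j) \<inter> frontier (omega P)|surface_measure.
        kappa P x * bdry_trace (subdom P j) u x * cnj (bdry_trace (subdom P j) v x)))"

text \<open>Infima and suprema of quotients of norms are taken in \<open>[0, \<infinity>]\<close>.\<close>

definition form_norm :: "('n::finite) ddm \<Rightarrow> ennreal" where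
  "form_norm P =
     (SUP (u, v) \<in> {u \<in> broken_H1 P. \<not> (AE x in lebesgue_on (omega P). u x = 0)} \<times>
                   {v \<in> broken_H1 P. \<not> (AE x in lebesgue_on (omega P). v x = 0)}.
        ennreal (cmod (form P u v) / (broken_norm P u * broken_norm P v)))"

definition alpha_h :: "('n::finite) ddm \<Rightarrow> ennreal" where
  "alpha_h P = (INF u \<in> Vh P - {0}. SUP v \<in> Vh P - {0}.
     ennreal (cmod (form P u v) / (H1_norm P (omega P) u * H1_norm P (omega P) v)))"


section \<open>Scalar product on the skeleton, exchange and scattering operators\<close>

definition tuple_scale :: "complex \<Rightarrow> 'n::finite tuple \<Rightarrow> 'n tuple" where
  "tuple_scale c q = (\<lambda>j x. c * q j x)"

definition is_scalar_product ::
    "'n::finite tuple set \<Rightarrow> ('n tuple \<Rightarrow> 'n tuple \<Rightarrow> complex) \<Rightarrow> bool" where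
  "is_scalar_product V t \<longleftrightarrow>
     (\<forall>p \<in> V. \<forall>q \<in> V. \<forall>r \<in> V. t (p + q) r = t p r + t q r) \<and>
     (\<forall>c. \<forall>p \<in> V. \<forall>q \<in> V. t (tuple_scale c p) q = c * t p q) \<and>
     (\<forall>p \<in> V. \<forall>q \<in> V. t q p = cnj (t p q)) \<and>
     (\<forall>p \<in> V. p \<noteq> 0 \<longrightarrow> 0 < Re (t p p))"

definition t_norm :: "('n::finite tuple \<Rightarrow> 'n tuple \<Rightarrow> complex) \<Rightarrow> 'n tuple \<Rightarrow> real" where
  "t_norm t w = sqrt (Re (t w w))"

definition orthogonal_projector ::
    "'n::finite tuple set \<Rightarrow> ('n tuple \<Rightarrow> 'n tuple \<Rightarrow> complex) \<Rightarrow> 'n tuple set \<Rightarrow>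
     ('n tuple \<Rightarrow> 'n tuple) \<Rightarrow> bool" where
  "orthogonal_projector V t W Q \<longleftrightarrow> (\<forall>p \<in> V. Q p \<in> W \<and> (\<forall>q \<in> W. t (p - Q p) q = 0))"

definition lambda_minus ::
    "('n::finite) ddm \<Rightarrow> ('n tuple \<Rightarrow> 'n tuple \<Rightarrow> complex) \<Rightarrow> ennreal" where
  "lambda_minus P t = (INF w \<in> Vh_multi P - {0}. ennreal (t_norm t w / rho_norm P w))"

definition lambda_plus ::
    "('n::finite) ddm \<Rightarrow> ('n tuple \<Rightarrow> 'n tuple \<Rightarrow> complex) \<Rightarrow> ennreal" where
  "lambda_plus P t = (SUP w \<in> Vh_multi P - {0}. ennreal (t_norm t w / rho_norm P w))"

definition scattering ::
    "('n::finite) ddm \<Rightarrow> ('n tuple \<Rightarrow> 'n tuple \<Rightarrow> complex) \<Rightarrow> 'n tuple \<Rightarrow> 'n tuple" where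
  "scattering P t p = p + tuple_scale (2 * \<i>) (skel P (THE w. w \<in> broken_Vh P \<and>
     (\<forall>v \<in> broken_Vh P. form P w v - \<i> * t (skel P w) (skel P v) = t p (skel P v))))"

definition gamma_h ::
    "('n::finite) ddm \<Rightarrow> ('n tuple \<Rightarrow> 'n tuple \<Rightarrow> complex) \<Rightarrow> ('n tuple \<Rightarrow> 'n tuple) \<Rightarrow> ennreal" where
  "gamma_h P t X = (INF w \<in> Vh_multi P - {0}.
     ennreal (t_norm t (w + X (scattering P t w)) / t_norm t w))"

end

theory Submission
  imports Defs
begin

text \<open>
  Let \<open>w\<close> solve the local problems with datum \<open>p\<close>, and put \<open>q = p + \<i> w|\<^sub>\<Sigma>\<close>.  The local
  problems then read \<open>a(w, v) = t(q, v|\<^sub>\<Sigma>)\<close> for all broken \<open>v\<close>.  Let \<open>Q\<close> be the orthogonal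
  projector onto the single traces and \<open>g\<close> half of the residual \<open>p + X (S p)\<close>.  Since \<open>X = 2 Q - 1\<close>,
  \<open>g\<close> equals \<open>Q (S p) - \<i> w|\<^sub>\<Sigma>\<close>, and its two components have a direct meaning: \<open>g\<^sub>0 = Q g\<close> acts on
  conforming test functions exactly as \<open>q\<close> does, and \<open>\<i> g\<^sub>1\<close> with \<open>g\<^sub>1 = g - Q g\<close> is the part of
  \<open>w|\<^sub>\<Sigma>\<close> orthogonal to the single traces.  Lift \<open>\<i> g\<^sub>1\<close> to a broken function \<open>u\<^sub>1\<close> of almost
  minimal norm.  The remainder \<open>u\<^sub>0 = w - u\<^sub>1\<close> has single-valued traces, hence is conforming, and
  the inf-sup condition controls it by \<open>g\<^sub>0\<close> and \<open>u\<^sub>1\<close>.  Thus the residual controls \<open>w\<close>, therefore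
  \<open>w|\<^sub>\<Sigma>\<close> and (by testing with a lifting of \<open>q\<close>) also \<open>q\<close>, and finally \<open>p = q - \<i> w|\<^sub>\<Sigma>\<close>.
  The Cauchy inequality collects the constants.  This is \<open>residual_estimate\<close>.

  The estimate rests on facts about concrete function spaces.  The scattering operator is defined
  by a unique solution, so \<open>a - \<i> t\<close> must be nondegenerate: the imaginary part of \<open>a(w, w)\<close> is
  nonpositive (\<open>form_Im_nonpos\<close>), which forces zero traces for a solution of the homogeneous
  problem (\<open>local_problem_injective\<close>), and existence follows because the broken space is
  finite-dimensional (\<open>broken_Vh_finite_span\<close>, \<open>variational_problem_solvable\<close>).

  All of this uses that \<open>a\<close> is sesquilinear, which is not automatic.  The volume terms contain a
  chosen weak gradient, so they need the existence of weak gradients for finite element functions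
  (\<open>piecewise_lipschitz_H1\<close>) and their uniqueness up to null sets (\<open>weak_gradient_unique\<close>).  The
  additivity of the boundary terms requires integrable integrands, so one needs that continuous
  functions are measurable for the Hausdorff measure (\<open>borel_subset_hausdorff_measure\<close>, by
  Caratheodory's criterion) and that the boundary of a polyhedral set has finite measure
  (\<open>emeasure_surface_frontier_finite\<close>).
\<close>

section \<open>Borel sets are measurable for the Hausdorff measure\<close>

text \<open>The empty set contributes nothing even in dimension \<open>0\<close>, so finite covers can be padded to
  sequences.\<close>

definition cover_vol :: "nat \<Rightarrow> 'a::metric_space set \<Rightarrow> ennreal" where
  "cover_vol s S = (if S = {} then 0 else ennreal (unit_ball_vol (real s) * (diameter S / 2) ^ s))"

definition fine_cover :: "real \<Rightarrow> 'a::metric_space set \<Rightarrow> (nat \<Rightarrow> 'a set) \<Rightarrow> bool" where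
  "fine_cover \<delta> A C \<longleftrightarrow> A \<subseteq> (\<Union>n. C n) \<and> (\<forall>n. bounded (C n) \<and> diameter (C n) \<le> \<delta>)"

lemma hausdorff_pre_alt:
  "hausdorff_pre s \<delta> A = (INF C \<in> {C. fine_cover \<delta> A C}. \<Sum>n. cover_vol s (C n))"
  by (simp add: hausdorff_pre_def fine_cover_def cover_vol_def)

lemma hausdorff_pre_le: "fine_cover \<delta> A C \<Longrightarrow> hausdorff_pre s \<delta> A \<le> (\<Sum>n. cover_vol s (C n))"
  unfolding hausdorff_pre_alt by (rule INF_lower) auto

lemma hausdorff_pre_mono: "A \<subseteq> B \<Longrightarrow> hausdorff_pre s \<delta> A \<le> hausdorff_pre s \<delta> B"
  unfolding hausdorff_pre_alt by (intro INF_superset_mono) (force simp: fine_cover_def)+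

lemma hausdorff_pre_antimono: "\<delta> \<le> \<epsilon> \<Longrightarrow> hausdorff_pre s \<epsilon> A \<le> hausdorff_pre s \<delta> A"
proof -
  assume "\<delta> \<le> \<epsilon>"
  then have "fine_cover \<epsilon> A C" if "fine_cover \<delta> A C" for C
    using that order_trans[of "diameter (C _)" \<delta> \<epsilon>] by (simp add: fine_cover_def)
  then show ?thesis
    unfolding hausdorff_pre_alt by (intro INF_superset_mono) auto
qed

lemma hausdorff_pre_le_outer: "0 < \<delta> \<Longrightarrow> hausdorff_pre s \<delta> A \<le> hausdorff_outer s A"
  unfolding hausdorff_outer_def by (intro SUP_upper) auto

lemma hausdorff_outer_mono: "A \<subseteq> B \<Longrightarrow> hausdorff_outer s A \<le> hausdorff_outer s B"
  unfolding hausdorff_outer_def by (intro SUP_mono) (auto intro!: hausdorff_pre_mono)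

lemma hausdorff_outer_empty [simp]: "hausdorff_outer s {} = 0"
proof -
  have "hausdorff_pre s \<delta> {} \<le> 0" if "0 < \<delta>" for \<delta>
    using hausdorff_pre_le[of \<delta> "{}" "\<lambda>_. {}" s] that
    by (simp add: fine_cover_def cover_vol_def)
  then show ?thesis
    unfolding hausdorff_outer_def by (intro antisym SUP_least) auto
qed

lemma hausdorff_pre_countably_subadditive:
  "hausdorff_pre s \<delta> (\<Union>i. A i) \<le> (\<Sum>i. hausdorff_pre s \<delta> (A (i::nat)))"
proof (rule ennreal_le_epsilon)
  fix e :: real assume e: "0 < e" and fin: "(\<Sum>i. hausdorff_pre s \<delta> (A i)) < top"
  have "\<exists>C. fine_cover \<delta> (A n) C \<and>
      (\<Sum>i. cover_vol s (C i)) < hausdorff_pre s \<delta> (A n) + ennreal e * ennreal ((1/2)^Suc n)" for n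
  proof -
    have "hausdorff_pre s \<delta> (A n) < top"
      using fin by (auto simp: less_top dest!: ennreal_suminf_lessD)
    then have "hausdorff_pre s \<delta> (A n) < hausdorff_pre s \<delta> (A n) + ennreal e * ennreal ((1/2)^Suc n)"
      using e by (simp add: ennreal_mult[symmetric])
    then show ?thesis
      by (subst (asm) (1) hausdorff_pre_alt) (auto simp: INF_less_iff)
  qed
  then obtain B where B: "\<And>n. fine_cover \<delta> (A n) (B n)"
    and Bs: "\<And>n. (\<Sum>i. cover_vol s (B n i)) < hausdorff_pre s \<delta> (A n) + ennreal e * ennreal ((1/2)^Suc n)"
    by metis
  define C where "C = case_prod B o prod_decode"
  have "(\<Union>i. A i) \<subseteq> (\<Union>i. C i)"
    using B unfolding fine_cover_def C_def subset_eq
    by (auto simp: C_def subset_eq) (metis prod.case prod_encode_inverse)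
  then have "fine_cover \<delta> (\<Union>i. A i) C"
    using B by (auto simp: fine_cover_def C_def split_beta)
  then have "hausdorff_pre s \<delta> (\<Union>i. A i) \<le> (\<Sum>i. cover_vol s (C i))"
    by (rule hausdorff_pre_le)
  also have "\<dots> = (\<Sum>i. (\<lambda>(n, i). cover_vol s (B n i)) (prod_decode i))"
    by (simp add: C_def split_beta)
  also have "\<dots> = (\<Sum>n. \<Sum>i. cover_vol s (B n i))"
    by (intro suminf_ennreal_2dimen) auto
  also have "\<dots> \<le> (\<Sum>n. hausdorff_pre s \<delta> (A n) + ennreal e * ennreal ((1/2) ^ Suc n))"
    by (intro suminf_le less_imp_le[OF Bs]) auto
  also have "\<dots> = (\<Sum>n. hausdorff_pre s \<delta> (A n)) + (\<Sum>n. ennreal e * ennreal ((1/2) ^ Suc n))"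
    by (subst suminf_add[symmetric]) (auto simp del: ennreal_suminf_cmult)
  also have "\<dots> = (\<Sum>n. hausdorff_pre s \<delta> (A n)) + e"
    unfolding ennreal_suminf_cmult
    by (subst suminf_ennreal_eq[OF zero_le_power power_half_series]) auto
  finally show "hausdorff_pre s \<delta> (\<Union>i. A i) \<le> (\<Sum>n. hausdorff_pre s \<delta> (A n)) + e" .
qed

lemma hausdorff_outer_countably_subadditive:
  "hausdorff_outer s (\<Union>i. A i) \<le> (\<Sum>i. hausdorff_outer s (A (i::nat)))"
proof -
  have "hausdorff_pre s \<delta> (\<Union>i. A i) \<le> (\<Sum>i. hausdorff_outer s (A i))" if "0 < \<delta>" for \<delta>
    by (rule order_trans[OF hausdorff_pre_countably_subadditive])
       (auto intro!: suminf_le hausdorff_pre_le_outer that)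
  then show ?thesis
    by (subst hausdorff_outer_def) (auto intro!: SUP_least)
qed

lemma hausdorff_outer_Un_le: "hausdorff_outer s (A \<union> B) \<le> hausdorff_outer s A + hausdorff_outer s B"
proof -
  have "hausdorff_outer s (A \<union> B) \<le> (\<Sum>i. hausdorff_outer s (binaryset A B i))"
    using hausdorff_outer_countably_subadditive[of s "binaryset A B"] by (simp add: UN_binaryset_eq)
  also have "\<dots> = hausdorff_outer s A + hausdorff_outer s B"
    by (rule suminf_binaryset_eq) simp
  finally show ?thesis .
qed

lemma hausdorff_outer_finite_UN:
  assumes "finite I" "\<And>i. i \<in> I \<Longrightarrow> hausdorff_outer s (A i) < \<infinity>"
  shows "hausdorff_outer s (\<Union>i\<in>I. A i) < \<infinity>"
  using assms
proof (induction I)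
  case (insert i I)
  have "hausdorff_outer s (A i \<union> (\<Union>i\<in>I. A i)) \<le> hausdorff_outer s (A i) + hausdorff_outer s (\<Union>i\<in>I. A i)"
    by (rule hausdorff_outer_Un_le)
  also have "\<dots> < \<infinity>" using insert by (auto simp: less_top)
  finally show ?case by simp
qed simp

text \<open>A covering set smaller than the gap meets only one of the two sets, so a fine cover of the
  union splits into a cover of each part.\<close>

lemma hausdorff_outer_separated:
  assumes e: "0 < e" and sep: "\<And>a b. a \<in> A \<Longrightarrow> b \<in> B \<Longrightarrow> e \<le> dist a b"
  shows "hausdorff_outer s A + hausdorff_outer s B \<le> hausdorff_outer s (A \<union> B)"
proof -
  have split: "hausdorff_pre s \<delta> A + hausdorff_pre s \<delta> B \<le> hausdorff_pre s \<delta> (A \<union> B)"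
    if d: "0 < \<delta>" "\<delta> < e" for \<delta>
    unfolding hausdorff_pre_alt[of s \<delta> "A \<union> B"]
  proof (rule INF_greatest)
    fix C assume "C \<in> {C. fine_cover \<delta> (A \<union> B) C}"
    then have C: "A \<union> B \<subseteq> (\<Union>n. C n)" "\<And>n. bounded (C n)" "\<And>n. diameter (C n) \<le> \<delta>"
      by (auto simp: fine_cover_def)
    define CA where "CA n = (if C n \<inter> A = {} then {} else C n)" for n
    define CB where "CB n = (if C n \<inter> B = {} then {} else C n)" for n
    have disj: "CA n = {} \<or> CB n = {}" for n
    proof (rule ccontr)
      assume "\<not> ?thesis"
      then obtain a b where ab: "a \<in> C n" "a \<in> A" "b \<in> C n" "b \<in> B"
        by (auto simp: CA_def CB_def split: if_splits)
      have "dist a b \<le> \<delta>"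
        using diameter_bounded_bound[OF C(2) ab(1,3)] C(3)[of n] by simp
      with sep[OF ab(2,4)] d show False by simp
    qed
    have "A \<subseteq> (\<Union>n. CA n)" "B \<subseteq> (\<Union>n. CB n)"
      using C(1) by (fastforce simp: CA_def CB_def)+
    moreover have "bounded (CA n) \<and> diameter (CA n) \<le> \<delta>" "bounded (CB n) \<and> diameter (CB n) \<le> \<delta>" for n
      using C(2,3)[of n] d by (simp_all add: CA_def CB_def)
    ultimately have "fine_cover \<delta> A CA" "fine_cover \<delta> B CB"
      by (simp_all add: fine_cover_def)
    then have "hausdorff_pre s \<delta> A + hausdorff_pre s \<delta> B
        \<le> (\<Sum>n. cover_vol s (CA n)) + (\<Sum>n. cover_vol s (CB n))"
      by (intro add_mono hausdorff_pre_le)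
    also have "\<dots> = (\<Sum>n. cover_vol s (CA n) + cover_vol s (CB n))"
      by (intro suminf_add) auto
    also have "\<dots> \<le> (\<Sum>n. cover_vol s (C n))"
    proof (intro suminf_le)
      fix n show "cover_vol s (CA n) + cover_vol s (CB n) \<le> cover_vol s (C n)"
        using disj[of n] by (cases "CA n = {}"; cases "CB n = {}") (simp_all add: CA_def CB_def cover_vol_def split: if_splits)
    qed auto
    finally show "hausdorff_pre s \<delta> A + hausdorff_pre s \<delta> B \<le> (\<Sum>n. cover_vol s (C n))" .
  qed
  have "hausdorff_outer s A + hausdorff_outer s B
      = (SUP \<delta>\<in>{0<..}. hausdorff_pre s \<delta> A + hausdorff_pre s \<delta> B)"
    unfolding hausdorff_outer_def
  proof (rule SUP_add_directed_ennreal[symmetric])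
    fix i j :: real assume "i \<in> {0<..}" "j \<in> {0<..}"
    then show "\<exists>k\<in>{0<..}. hausdorff_pre s i A + hausdorff_pre s j B
        \<le> hausdorff_pre s k A + hausdorff_pre s k B"
      by (intro bexI[of _ "min i j"] add_mono hausdorff_pre_antimono) auto
  qed
  also have "\<dots> \<le> hausdorff_outer s (A \<union> B)"
  proof (rule SUP_least)
    fix \<delta> :: real assume "\<delta> \<in> {0<..}"
    then have pos: "0 < min \<delta> (e/2)" "min \<delta> (e/2) < e" using e by auto
    have "hausdorff_pre s \<delta> A + hausdorff_pre s \<delta> B
        \<le> hausdorff_pre s (min \<delta> (e/2)) A + hausdorff_pre s (min \<delta> (e/2)) B"
      by (intro add_mono hausdorff_pre_antimono) auto
    also have "\<dots> \<le> hausdorff_outer s (A \<union> B)"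
      using split[OF pos] hausdorff_pre_le_outer[OF pos(1)] by (rule order_trans)
    finally show "hausdorff_pre s \<delta> A + hausdorff_pre s \<delta> B \<le> hausdorff_outer s (A \<union> B)" .
  qed
  finally show ?thesis .
qed

text \<open>Caratheodory's criterion.  The points of \<open>X\<close> off the closed set \<open>F\<close> are sorted into
  layers by their distance to \<open>F\<close>.  Layers whose
  indices differ by at least two are separated, so the layers have summable outer measure and the
  ones close to \<open>F\<close> are negligible in the limit.\<close>

lemma hausdorff_outer_closed_split:
  assumes F: "closed F"
  shows "hausdorff_outer s (F \<inter> X) + hausdorff_outer s (X - F) \<le> hausdorff_outer s X"
proof (cases "F = {} \<or> hausdorff_outer s X = \<infinity>")
  case True
  then show ?thesis by auto
next
  case False
  then have ne: "F \<noteq> {}" and fin: "hausdorff_outer s X < \<infinity>" by (auto simp: less_top)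
  let ?H = "hausdorff_outer s"
  define d where "d x = infdist x F" for x
  define A where "A n = {x \<in> X - F. 1 / real (Suc n) \<le> d x}" for n
  define R where "R n = {x \<in> X - F. 1 / real (Suc (Suc n)) \<le> d x \<and> d x < 1 / real (Suc n)}" for n
  have sepA: "?H (F \<inter> X) + ?H (A n) \<le> ?H X" for n
  proof -
    have "?H (F \<inter> X) + ?H (A n) \<le> ?H ((F \<inter> X) \<union> A n)"
    proof (rule hausdorff_outer_separated)
      show "0 < 1 / real (Suc n)" by simp
      fix a b assume "a \<in> F \<inter> X" "b \<in> A n"
      then show "1 / real (Suc n) \<le> dist a b"
        using infdist_le[of a F b] by (auto simp: A_def d_def dist_commute)
    qed
    also have "\<dots> \<le> ?H X" by (rule hausdorff_outer_mono) (auto simp: A_def)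
    finally show ?thesis .
  qed
  have sum2: "(\<Sum>k<N. ?H (R (2 * k + p))) \<le> ?H (\<Union>k<N. R (2 * k + p))" for N p
  proof (induction N)
    case (Suc N)
    have "(\<Sum>k<Suc N. ?H (R (2 * k + p))) \<le> ?H (\<Union>k<N. R (2 * k + p)) + ?H (R (2 * N + p))"
      using Suc by (auto intro: add_mono)
    also have "\<dots> \<le> ?H ((\<Union>k<N. R (2 * k + p)) \<union> R (2 * N + p))"
    proof (cases "N = 0")
      case False
      let ?e = "1 / real (2 * N + p) - 1 / real (Suc (2 * N + p))"
      show ?thesis
      proof (rule hausdorff_outer_separated)
        have "real (2 * N + p) < real (Suc (2 * N + p))" by simp
        then show "0 < ?e" using False by (simp add: frac_less2)
        fix a b assume "a \<in> (\<Union>k<N. R (2 * k + p))" and b: "b \<in> R (2 * N + p)"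
        then obtain k where k: "k < N" "a \<in> R (2 * k + p)" by auto
        have "1 / real (2 * N + p) \<le> 1 / real (Suc (Suc (2 * k + p)))"
          using k(1) by (intro divide_left_mono) auto
        also have "\<dots> \<le> d a" using k by (simp add: R_def)
        finally have "1 / real (2 * N + p) \<le> d a" .
        moreover have "d b < 1 / real (Suc (2 * N + p))" using b by (simp add: R_def)
        moreover have "d a \<le> d b + dist a b" unfolding d_def by (rule infdist_triangle)
        ultimately show "?e \<le> dist a b" by linarith
      qed
    qed auto
    also have "\<dots> = ?H (\<Union>k<Suc N. R (2 * k + p))"
      by (simp add: lessThan_Suc Un_commute)
    finally show ?case .
  qed simp
  have sum2': "(\<Sum>k. ?H (R (2 * k + p))) \<le> ?H X" for p
  proof (rule suminf_le_const)
    fix N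
    have "?H (\<Union>k<N. R (2 * k + p)) \<le> ?H X"
      by (rule hausdorff_outer_mono) (auto simp: R_def)
    with sum2[of p N] show "(\<Sum>k<N. ?H (R (2 * k + p))) \<le> ?H X" by (rule order_trans)
  qed auto
  have sumN: "(\<Sum>k<2 * N. ?H (R k)) = (\<Sum>k<N. ?H (R (2 * k + 0))) + (\<Sum>k<N. ?H (R (2 * k + 1)))" for N
    by (induction N) (auto simp: algebra_simps)
  have "(\<Sum>k. ?H (R k)) \<le> ?H X + ?H X"
  proof (rule suminf_le_const)
    fix N
    \<comment> \<open>Split into even and odd layers.\<close>
    have "(\<Sum>k<N. ?H (R k)) \<le> (\<Sum>k<2 * N. ?H (R k))"
      by (rule sum_mono2) auto
    also have "\<dots> \<le> (\<Sum>k. ?H (R (2 * k + 0))) + (\<Sum>k. ?H (R (2 * k + 1)))"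
      unfolding sumN by (intro add_mono sum_le_suminf) auto
    also have "\<dots> \<le> ?H X + ?H X" by (intro add_mono sum2')
    finally show "(\<Sum>k<N. ?H (R k)) \<le> ?H X + ?H X" .
  qed auto
  then have sfin: "(\<Sum>k. ?H (R k)) < \<infinity>" 
    by (rule order_le_less_trans) (use fin in \<open>simp add: less_top\<close>)
  have XF: "X - F \<subseteq> A n \<union> (\<Union>k. R (k + n))" for n
  proof
    fix x assume x: "x \<in> X - F"
    then have "0 < d x"
      using infdist_pos_not_in_closed[OF F ne, of x] by (simp add: d_def)
    then obtain m where m: "1 / real (Suc m) < d x"
      using reals_Archimedean[of "d x"] by (auto simp: inverse_eq_divide)
    define k where "k = (LEAST k. 1 / real (Suc k) \<le> d x)"
    have k1: "1 / real (Suc k) \<le> d x"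
      unfolding k_def by (rule LeastI[of "\<lambda>k. 1 / real (Suc k) \<le> d x" m]) (use m in simp)
    show "x \<in> A n \<union> (\<Union>k. R (k + n))"
    proof (cases "k \<le> n")
      case True
      have "1 / real (Suc n) \<le> 1 / real (Suc k)" using True by (intro divide_left_mono) auto
      with k1 x show ?thesis by (auto simp: A_def)
    next
      case False
      then have "\<not> 1 / real (Suc (k - 1)) \<le> d x"
        unfolding k_def by (intro not_less_Least) (simp add: k_def)
      then have "x \<in> R (k - 1)" using x k1 False by (auto simp: R_def)
      moreover have "k - 1 = (k - 1 - n) + n" using False by simp
      ultimately show ?thesis by (metis UN_I UNIV_I UnI2)
    qed
  qed
  define r where "r k = enn2real (?H (R k))" for k
  have rk: "?H (R k) = ennreal (r k)" for k
  proof -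
    have "?H (R k) \<le> (\<Sum>k. ?H (R k))"
      using sum_le_suminf[of "\<lambda>k. ?H (R k)" "{k}"] by simp
    then show ?thesis using sfin by (simp add: r_def less_top top_unique)
  qed
  have r0: "0 \<le> r k" for k by (simp add: r_def)
  have rsum: "summable r"
    using sfin r0 by (intro summable_suminf_not_top) (auto simp: rk less_top)
  show ?thesis
  proof (rule ennreal_le_epsilon)
    fix e :: real assume e: "0 < e"
    from suminf_exist_split[OF e rsum] obtain n where n: "norm (\<Sum>i. r (i + n)) < e" by blast
    have "?H (\<Union>k. R (k + n)) \<le> (\<Sum>k. ?H (R (k + n)))"
      by (rule hausdorff_outer_countably_subadditive)
    also have "\<dots> = ennreal (\<Sum>i. r (i + n))"
      unfolding rk using rsum r0 by (intro suminf_ennreal2) (auto simp: summable_iff_shift)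
    also have "\<dots> \<le> ennreal e" using n by (intro ennreal_leI) auto
    finally have tail: "?H (\<Union>k. R (k + n)) \<le> ennreal e" .
    have "?H (F \<inter> X) + ?H (X - F) \<le> ?H (F \<inter> X) + (?H (A n) + ?H (\<Union>k. R (k + n)))"
      by (intro add_left_mono order_trans[OF hausdorff_outer_mono[OF XF] hausdorff_outer_Un_le])
    also have "\<dots> \<le> (?H (F \<inter> X) + ?H (A n)) + ennreal e"
      using tail by (simp add: add.assoc add_left_mono)
    also have "\<dots> \<le> ?H X + ennreal e" by (intro add_right_mono sepA)
    finally show "?H (F \<inter> X) + ?H (X - F) \<le> ?H X + ennreal e" .
  qed
qed

lemma space_hausdorff_measure [simp]: "space (hausdorff_measure s) = UNIV"
  by (simp add: hausdorff_measure_def space_measure_of_conv)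

lemma borel_subset_hausdorff_measure:
  "sets (borel :: 'a::metric_space measure) \<subseteq> sets (hausdorff_measure s :: 'a measure)"
proof -
  let ?L = "lambda_system UNIV UNIV (hausdorff_outer s :: 'a set \<Rightarrow> ennreal)"
  have "F \<in> ?L" if "closed F" for F
    unfolding lambda_system_def
  proof (safe intro!: antisym)
    fix X
    have *: "(UNIV - F) \<inter> X = X - F" by auto
    show "hausdorff_outer s (F \<inter> X) + hausdorff_outer s ((UNIV - F) \<inter> X) \<le> hausdorff_outer s X"
      unfolding * by (rule hausdorff_outer_closed_split[OF that])
    show "hausdorff_outer s X \<le> hausdorff_outer s (F \<inter> X) + hausdorff_outer s ((UNIV - F) \<inter> X)"
      using hausdorff_outer_Un_le[of s "F \<inter> X" "X - F"] unfolding *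
      by (metis Int_commute Un_commute Un_Diff_Int)
  qed auto
  then have "Collect closed \<subseteq> ?L" by auto
  then have "sigma_sets UNIV (Collect closed) \<subseteq> sigma_sets UNIV ?L"
    by (intro sigma_sets_mono') 
  then show ?thesis
    by (simp add: hausdorff_measure_def borel_eq_closed sets_measure_of_conv)
qed

text \<open>\<^const>\<open>measure_of\<close> yields either the outer measure or, should that fail to be countably additive,
  the zero measure.  The inequality covers both.\<close>

lemma emeasure_hausdorff_measure_le: "emeasure (hausdorff_measure s) A \<le> hausdorff_outer s A"
  by (simp add: hausdorff_measure_def emeasure_measure_of_conv)

section \<open>Polyhedral boundaries have finite surface measure\<close>

text \<open>\<open>N\<^sup>s\<close> pieces of diameter \<open>L / N\<close> have a total \<open>s\<close>-volume that does not depend on \<open>N\<close>.\<close>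

lemma hausdorff_outer_bound_by_grids:
  assumes grid: "\<And>N. 1 \<le> N \<Longrightarrow> \<exists>\<T>. finite \<T> \<and> card \<T> \<le> N ^ s \<and> S \<subseteq> \<Union>\<T> \<and>
      (\<forall>T\<in>\<T>. bounded T \<and> diameter T \<le> L / real N)"
    and L: "0 \<le> L"
  shows "hausdorff_outer s S \<le> ennreal (unit_ball_vol (real s) * (L / 2) ^ s)"
  unfolding hausdorff_outer_def
proof (rule SUP_least)
  fix \<delta> :: real assume "\<delta> \<in> {0<..}"
  then have d: "0 < \<delta>" by simp
  obtain N where N: "L / \<delta> < real N" using reals_Archimedean2 by blast
  have "0 \<le> L / \<delta>" using L d by simp
  with N have N0: "0 < real N" by linarith
  then have N1: "1 \<le> N" by simp
  have LN: "L / real N \<le> \<delta>" using N N0 d by (simp add: field_simps)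
  obtain \<T> where T: "finite \<T>" "card \<T> \<le> N ^ s" "S \<subseteq> \<Union>\<T>"
      "\<And>T. T \<in> \<T> \<Longrightarrow> bounded T \<and> diameter T \<le> L / real N"
    using grid[OF N1] by blast
  obtain h where h: "bij_betw h {0..<card \<T>} \<T>"
    using ex_bij_betw_nat_finite[OF T(1)] by blast
  define C where "C n = (if n < card \<T> then h n else {})" for n
  have hT: "h n \<in> \<T>" if "n < card \<T>" for n
    using h that by (auto simp: bij_betw_def)
  have "S \<subseteq> (\<Union>n. C n)"
  proof
    fix x assume "x \<in> S"
    then obtain T where "T \<in> \<T>" "x \<in> T" using T(3) by blast
    then obtain n where "n < card \<T>" "T = h n"
      using h by (metis atLeastLessThan_iff bij_betw_imp_surj_on imageE)
    then have "x \<in> C n" using \<open>x \<in> T\<close> by (simp add: C_def)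
    then show "x \<in> (\<Union>n. C n)" by blast
  qed
  moreover have "bounded (C n) \<and> diameter (C n) \<le> \<delta>" for n
  proof (cases "n < card \<T>")
    case True
    then show ?thesis using T(4)[OF hT[OF True]] LN by (simp add: C_def)
  next
    case False
    then show ?thesis using d by (simp add: C_def)
  qed
  ultimately have "hausdorff_pre s \<delta> S \<le> (\<Sum>n. cover_vol s (C n))"
    by (intro hausdorff_pre_le) (auto simp: fine_cover_def)
  also have "\<dots> = (\<Sum>n<card \<T>. cover_vol s (C n))"
    by (rule suminf_finite) (auto simp: C_def cover_vol_def)
  also have "\<dots> \<le> (\<Sum>n<card \<T>. ennreal (unit_ball_vol (real s) * (L / real N / 2) ^ s))"
  proof (rule sum_mono)
    fix n assume "n \<in> {..<card \<T>}"
    then have b: "bounded (C n)" "diameter (C n) \<le> L / real N"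
      using T(4)[OF hT] by (auto simp: C_def)
    show "cover_vol s (C n) \<le> ennreal (unit_ball_vol (real s) * (L / real N / 2) ^ s)"
      unfolding cover_vol_def using b diameter_ge_0[OF b(1)]
      by (auto intro!: ennreal_leI mult_left_mono power_mono)
  qed
  also have "\<dots> = ennreal (real (card \<T>) * (unit_ball_vol (real s) * (L / real N / 2) ^ s))"
    using L by (simp add: ennreal_mult ennreal_of_nat_eq_real_of_nat)
  also have "\<dots> \<le> ennreal (real N ^ s * (unit_ball_vol (real s) * (L / real N / 2) ^ s))"
  proof (intro ennreal_leI mult_right_mono)
    show "real (card \<T>) \<le> real N ^ s" using T(2) by (metis of_nat_le_iff of_nat_power)
  qed (use L in auto)
  also have "real N ^ s * (unit_ball_vol (real s) * (L / real N / 2) ^ s)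
      = unit_ball_vol (real s) * (L / 2) ^ s"
    using N0 by (simp add: power_divide)
  finally show "hausdorff_pre s \<delta> S \<le> ennreal (unit_ball_vol (real s) * (L / 2) ^ s)" .
qed

text \<open>A hyperplane is a Lipschitz graph over the coordinates other than one in which its normal
  does not vanish, so a grid in these coordinates gives the covers.\<close>

lemma hausdorff_outer_hyperplane_finite:
  fixes a :: "real ^ 'n"
  assumes a: "a \<noteq> 0" and bS: "bounded S" and S: "S \<subseteq> {x. a \<bullet> x = b}"
  shows "hausdorff_outer (CARD('n) - 1) S < \<infinity>"
proof -
  obtain i where i: "a $ i \<noteq> 0" using a by (metis vec_eq_iff zero_index)
  obtain R where R: "0 < R" "\<And>x. x \<in> S \<Longrightarrow> norm x < R"
    using bS by (metis bounded_pos_less)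
  define K where "K = UNIV - {i}"
  have cK: "card K = CARD('n) - 1" "finite K" by (simp_all add: K_def)
  define M where "M = real (card K) + (\<Sum>k\<in>K. \<bar>a $ k\<bar>) / \<bar>a $ i\<bar>"
  have M0: "0 \<le> M" unfolding M_def by (intro add_nonneg_nonneg divide_nonneg_nonneg sum_nonneg) auto
  have "hausdorff_outer (CARD('n) - 1) S
      \<le> ennreal (unit_ball_vol (real (CARD('n) - 1)) * (M * (2 * R) / 2) ^ (CARD('n) - 1))"
  proof (rule hausdorff_outer_bound_by_grids)
    fix N :: nat assume N: "1 \<le> N"
    define q where "q x k = nat \<lfloor>(x $ k + R) * real N / (2 * R)\<rfloor>" for x :: "real ^ 'n" and k
    define T where "T f = {x \<in> S. \<forall>k\<in>K. q x k = f k}" for f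
    let ?\<T> = "T ` (K \<rightarrow>\<^sub>E {..<N})"
    have comp: "\<bar>x $ k\<bar> < R" if "x \<in> S" for x k
      using R(2)[OF that] component_le_norm_cart[of x k] by linarith
    have nn: "0 \<le> (x $ k + R) * real N / (2 * R)" if "x \<in> S" for x k
      using comp[OF that, of k] R(1) by (intro divide_nonneg_pos mult_nonneg_nonneg) auto
    have qN: "q x k < N" if "x \<in> S" for x k
    proof -
      have "(x $ k + R) * real N < (2 * R) * real N"
        using comp[OF that, of k] N by (intro mult_strict_right_mono) auto
      then have "(x $ k + R) * real N / (2 * R) < real N" using R(1) by (simp add: field_simps)
      then have "\<lfloor>(x $ k + R) * real N / (2 * R)\<rfloor> < int N" by (simp add: floor_less_iff)
      then show ?thesis using N by (simp add: q_def nat_less_iff)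
    qed
    have close: "\<bar>x $ k - y $ k\<bar> \<le> 2 * R / real N"
      if x: "x \<in> S" and y: "y \<in> S" and q: "q x k = q y k" for x y k
    proof -
      have "\<lfloor>(x $ k + R) * real N / (2 * R)\<rfloor> = \<lfloor>(y $ k + R) * real N / (2 * R)\<rfloor>"
        using q nn[OF x, of k] nn[OF y, of k] by (simp add: q_def eq_nat_nat_iff)
      then have "\<bar>(x $ k + R) * real N / (2 * R) - (y $ k + R) * real N / (2 * R)\<bar> \<le> 1"
        by linarith
      moreover have "(x $ k + R) * real N / (2 * R) - (y $ k + R) * real N / (2 * R)
          = (x $ k - y $ k) * (real N / (2 * R))"
        using R(1) by (simp add: field_simps)
      ultimately have "\<bar>x $ k - y $ k\<bar> * (real N / (2 * R)) \<le> 1"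
        using R(1) N by (simp add: abs_mult)
      then show ?thesis using R(1) N by (simp add: field_simps)
    qed
    have "S \<subseteq> \<Union>?\<T>"
    proof
      fix x assume x: "x \<in> S"
      have "restrict (q x) K \<in> K \<rightarrow>\<^sub>E {..<N}" using qN[OF x] by auto
      moreover have "x \<in> T (restrict (q x) K)" using x by (simp add: T_def)
      ultimately show "x \<in> \<Union>?\<T>" by blast
    qed
    moreover have "finite ?\<T>" using cK by (intro finite_imageI finite_PiE) auto
    moreover have "card ?\<T> \<le> N ^ (CARD('n) - 1)"
    proof -
      have "card ?\<T> \<le> card (K \<rightarrow>\<^sub>E {..<N})" using cK by (intro card_image_le finite_PiE) auto
      also have "\<dots> = N ^ (CARD('n) - 1)" using cK by (simp add: card_PiE)
      finally show ?thesis .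
    qed
    moreover have "bounded U \<and> diameter U \<le> M * (2 * R) / real N" if "U \<in> ?\<T>" for U
    proof -
      from that obtain f where U: "U = T f" by blast
      have bU: "bounded U" using bS by (rule bounded_subset) (auto simp: U T_def)
      have "norm (x - y) \<le> M * (2 * R) / real N" if xy: "x \<in> U" "y \<in> U" for x y
      proof -
        have xyS: "x \<in> S" "y \<in> S" using xy by (auto simp: U T_def)
        have cl: "\<bar>x $ k - y $ k\<bar> \<le> 2 * R / real N" if "k \<in> K" for k
          using xy that by (intro close xyS) (auto simp: U T_def)
        have UK: "(UNIV :: 'n set) = insert i K" "i \<notin> K" by (auto simp: K_def)
        have "a \<bullet> x = b" "a \<bullet> y = b" using S xyS by auto
        then have "a \<bullet> (x - y) = 0" by (simp add: inner_diff_right)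
        then have "(\<Sum>k\<in>UNIV. a $ k * (x $ k - y $ k)) = 0" by (simp add: inner_vec_def)
        then have "a $ i * (x $ i - y $ i) + (\<Sum>k\<in>K. a $ k * (x $ k - y $ k)) = 0"
          unfolding UK(1) using UK(2) cK(2) by simp
        then have "\<bar>a $ i\<bar> * \<bar>x $ i - y $ i\<bar> = \<bar>\<Sum>k\<in>K. a $ k * (x $ k - y $ k)\<bar>"
          by (simp add: abs_mult[symmetric] add_eq_0_iff)
        also have "\<dots> \<le> (\<Sum>k\<in>K. \<bar>a $ k\<bar> * (2 * R / real N))"
          by (rule order_trans[OF sum_abs]) (unfold abs_mult, intro sum_mono mult_left_mono cl, auto)
        also have "\<dots> = (\<Sum>k\<in>K. \<bar>a $ k\<bar>) * (2 * R / real N)" by (rule sum_distrib_right[symmetric])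
        finally have ii: "\<bar>x $ i - y $ i\<bar> \<le> (\<Sum>k\<in>K. \<bar>a $ k\<bar>) / \<bar>a $ i\<bar> * (2 * R / real N)"
          using i by (metis mult.commute pos_le_divide_eq times_divide_eq_left zero_less_abs_iff)
        have "norm (x - y) \<le> (\<Sum>k\<in>UNIV. \<bar>(x - y) $ k\<bar>)" by (rule norm_le_l1_cart)
        also have "\<dots> = \<bar>x $ i - y $ i\<bar> + (\<Sum>k\<in>K. \<bar>x $ k - y $ k\<bar>)"
          unfolding UK(1) using UK(2) cK(2) by simp
        also have "\<dots> \<le> (\<Sum>k\<in>K. \<bar>a $ k\<bar>) / \<bar>a $ i\<bar> * (2 * R / real N) + (\<Sum>k\<in>K. 2 * R / real N)"
          by (intro add_mono ii sum_mono cl)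
        also have "\<dots> = M * (2 * R / real N)" by (simp only: M_def distrib_right sum_constant add.commute)
        finally show ?thesis by simp
      qed
      then have "diameter U \<le> M * (2 * R) / real N"
        using M0 R(1) by (intro diameter_le) auto
      with bU show ?thesis by simp
    qed
    ultimately show "\<exists>\<T>. finite \<T> \<and> card \<T> \<le> N ^ (CARD('n) - 1) \<and> S \<subseteq> \<Union>\<T> \<and>
        (\<forall>T\<in>\<T>. bounded T \<and> diameter T \<le> M * (2 * R) / real N)"
      by blast
  qed (use M0 R(1) in simp)
  then show ?thesis by (rule order_le_less_trans) simp
qed

lemma frontier_Inter_finite:
  assumes "finite F" "\<And>S. S \<in> F \<Longrightarrow> closed S"
  shows "frontier (\<Inter>F) \<subseteq> (\<Union>S\<in>F. frontier S)"
proof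
  fix x assume x: "x \<in> frontier (\<Inter>F)"
  have "x \<in> \<Inter>F"
    using x assms(2) frontier_subset_closed[of "\<Inter>F"] by (auto intro!: closed_Inter)
  moreover have "x \<notin> (\<Inter>S\<in>F. interior S)"
  proof
    assume "x \<in> (\<Inter>S\<in>F. interior S)"
    moreover have "open (\<Inter>S\<in>F. interior S)" using assms(1) by (intro open_INT) auto
    moreover have "(\<Inter>S\<in>F. interior S) \<subseteq> \<Inter>F" using interior_subset by fastforce
    ultimately have "x \<in> interior (\<Inter>F)" using interior_maximal by blast
    with x show False by (simp add: frontier_def)
  qed
  ultimately show "x \<in> (\<Union>S\<in>F. frontier S)"
    using assms(2) by (auto simp: frontier_def)
qed

text \<open>A polytope is a finite intersection of half-spaces, and their boundaries are hyperplanes.\<close>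

lemma frontier_polytope_hyperplanes:
  fixes P :: "'a::euclidean_space set"
  assumes "polytope P"
  obtains H where "finite H" "frontier P \<subseteq> \<Union>H" "\<And>h. h \<in> H \<Longrightarrow> \<exists>a b. a \<noteq> 0 \<and> h = {x. a \<bullet> x = b}"
proof -
  obtain F where F: "finite F" "P = \<Inter>F" "\<And>h. h \<in> F \<Longrightarrow> \<exists>a b. a \<noteq> 0 \<and> h = {x. a \<bullet> x \<le> b}"
    using polytope_imp_polyhedron[OF assms] unfolding polyhedron_def by metis
  show ?thesis
  proof
    show "finite (frontier ` F)" using F(1) by simp
    show "frontier P \<subseteq> \<Union>(frontier ` F)"
      using frontier_Inter_finite[OF F(1)] F(3) closed_halfspace_le unfolding F(2) by metis
    fix h assume "h \<in> frontier ` F"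
    then obtain a b where "a \<noteq> 0" "h = frontier {x. a \<bullet> x \<le> b}" using F(3) by blast
    then show "\<exists>a b. a \<noteq> 0 \<and> h = {x. a \<bullet> x = b}"
      using frontier_halfspace_le[of a b] by auto
  qed
qed

lemma hausdorff_outer_frontier_polytope_finite:
  fixes P :: "(real ^ 'n) set"
  assumes P: "polytope P"
  shows "hausdorff_outer (CARD('n) - 1) (frontier P) < \<infinity>"
proof -
  obtain H where H: "finite H" "frontier P \<subseteq> \<Union>H"
      "\<And>h. h \<in> H \<Longrightarrow> \<exists>a b. a \<noteq> 0 \<and> h = {x :: real ^ 'n. a \<bullet> x = b}"
    using frontier_polytope_hyperplanes[OF P] by blast
  have bP: "bounded (frontier P)"
    using P compact_frontier_bounded compact_imp_bounded polytope_imp_bounded by blast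
  have "hausdorff_outer (CARD('n) - 1) (\<Union>h\<in>H. h \<inter> frontier P) < \<infinity>"
  proof (rule hausdorff_outer_finite_UN[OF H(1)])
    fix h assume "h \<in> H"
    then obtain a b where ab: "a \<noteq> 0" "h = {x :: real ^ 'n. a \<bullet> x = b}" using H(3) by blast
    show "hausdorff_outer (CARD('n) - 1) (h \<inter> frontier P) < \<infinity>"
      by (rule hausdorff_outer_hyperplane_finite[OF ab(1), of _ b])
         (auto simp: ab(2) intro: bounded_subset[OF bP])
  qed
  moreover have "(\<Union>h\<in>H. h \<inter> frontier P) = frontier P" using H(2) by auto
  ultimately show ?thesis by simp
qed

lemma frontier_polyhedral_open:
  assumes "polyhedral_open U"
  obtains \<P> where "finite \<P>" "\<And>P. P \<in> \<P> \<Longrightarrow> polytope P" "frontier U \<subseteq> (\<Union>P\<in>\<P>. frontier P)"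
proof -
  obtain \<P> where P: "finite \<P>" "\<And>P. P \<in> \<P> \<Longrightarrow> polytope P" "closure U = \<Union>\<P>"
    and U: "U = interior (closure U)"
    using assms unfolding polyhedral_open_def by blast
  have oU: "interior U = U" by (subst (1 2) U) simp
  have "frontier U = frontier (\<Union>\<P>)"
    unfolding P(3)[symmetric] frontier_def using U oU by simp
  then show ?thesis
    using that[OF P(1,2)] frontier_Union_subset[OF P(1)] by auto
qed

lemma emeasure_surface_frontier_finite:
  assumes "polyhedral_open U"
  shows "emeasure surface_measure (frontier U) < \<infinity>"
proof -
  obtain \<P> where P: "finite \<P>" "\<And>P. P \<in> \<P> \<Longrightarrow> polytope P" "frontier U \<subseteq> (\<Union>P\<in>\<P>. frontier P)"
    using frontier_polyhedral_open[OF assms] by blast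
  have "emeasure surface_measure (frontier U) \<le> hausdorff_outer (CARD('a) - 1) (frontier U)"
    unfolding surface_measure_def by (rule emeasure_hausdorff_measure_le)
  also have "\<dots> \<le> hausdorff_outer (CARD('a) - 1) (\<Union>P\<in>\<P>. frontier P)"
    by (rule hausdorff_outer_mono[OF P(3)])
  also have "\<dots> < \<infinity>"
    by (intro hausdorff_outer_finite_UN P(1) hausdorff_outer_frontier_polytope_finite P(2))
  finally show ?thesis .
qed

section \<open>Test functions and the fundamental lemma of the calculus of variations\<close>

definition test_function :: "(real ^ 'n) set \<Rightarrow> (real ^ 'n \<Rightarrow> real) \<Rightarrow> (real ^ 'n \<Rightarrow> real ^ 'n) \<Rightarrow> bool" where
  "test_function \<omega> \<phi> G \<longleftrightarrow> (\<forall>x. GDERIV \<phi> x :> G x) \<and> continuous_on UNIV G \<and>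
     compact (closure {x. \<phi> x \<noteq> 0}) \<and> closure {x. \<phi> x \<noteq> 0} \<subseteq> \<omega>"

lemma weak_gradient_iff:
  "weak_gradient \<omega> u g \<longleftrightarrow> (\<forall>\<phi> G. test_function \<omega> \<phi> G \<longrightarrow>
     (\<forall>i. (LINT x|lebesgue_on \<omega>. u x * of_real (G x $ i)) =
          - (LINT x|lebesgue_on \<omega>. g x $ i * of_real (\<phi> x))))"
  by (simp add: weak_gradient_def test_function_def)

lemma DERIV_max_0_power2:
  "((\<lambda>t::real. (max 0 t)\<^sup>2) has_real_derivative 2 * max 0 t) (at t)"
proof (cases t "0::real" rule: linorder_cases)
  case less
  have "((\<lambda>t::real. 0) has_real_derivative 2 * max 0 t) (at t)" using less by simp
  then show ?thesis
    by (rule DERIV_cong_ev[THEN iffD1, rotated -1, OF _ refl _ refl])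
       (use less in \<open>auto intro!: eventually_mono[OF eventually_nhds_in_open[of "{..<0}"]]\<close>)
next
  case greater
  have "((\<lambda>t::real. t\<^sup>2) has_real_derivative 2 * max 0 t) (at t)"
    using greater by (auto intro!: derivative_eq_intros)
  then show ?thesis
    by (rule DERIV_cong_ev[THEN iffD1, rotated -1, OF _ refl _ refl])
       (use greater in \<open>auto intro!: eventually_mono[OF eventually_nhds_in_open[of "{0<..}"]]\<close>)
next
  case equal
  have "((\<lambda>h::real. ((max 0 (0 + h))\<^sup>2 - (max 0 0)\<^sup>2) / h) \<longlongrightarrow> 0) (at 0)"
  proof (rule Lim_null_comparison)
    show "\<forall>\<^sub>F h::real in at 0. norm (((max 0 (0 + h))\<^sup>2 - (max 0 0)\<^sup>2) / h) \<le> \<bar>h\<bar>"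
      by (intro always_eventually allI) (auto simp: power2_eq_square max_def)
    show "((\<lambda>h::real. \<bar>h\<bar>) \<longlongrightarrow> 0) (at 0)" by (rule tendsto_eq_intros refl)+ simp
  qed
  then show ?thesis using equal by (simp add: DERIV_def)
qed

text \<open>Squaring makes the truncation continuously differentiable.  For \<open>r > 0\<close> the function is positive
  exactly on the open ball.\<close>

definition ball_bump :: "real ^ 'n \<Rightarrow> real \<Rightarrow> real ^ 'n \<Rightarrow> real" where
  "ball_bump c r x = (max 0 (r\<^sup>2 - (x - c) \<bullet> (x - c)))\<^sup>2"

lemma GDERIV_ball_bump:
  "GDERIV (ball_bump c r) x :> (2 * max 0 (r\<^sup>2 - (x - c) \<bullet> (x - c))) *\<^sub>R ((- 2) *\<^sub>R (x - c))"
proof -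
  have "GDERIV (\<lambda>x. r\<^sup>2 - (x - c) \<bullet> (x - c)) x :> (- 2) *\<^sub>R (x - c)"
    unfolding gderiv_def
    by (auto intro!: derivative_eq_intros ext simp: inner_commute)
  from GDERIV_DERIV_compose[OF this DERIV_max_0_power2] show ?thesis
    by (simp add: ball_bump_def[abs_def])
qed

lemma ball_bump_nonneg [simp]: "0 \<le> ball_bump c r x"
  by (simp add: ball_bump_def)

lemma ball_bump_pos_iff: "0 < r \<Longrightarrow> 0 < ball_bump c r x \<longleftrightarrow> x \<in> ball c r"
proof -
  assume r: "0 < r"
  have "0 < ball_bump c r x \<longleftrightarrow> (norm (x - c))\<^sup>2 < r\<^sup>2"
    by (auto simp: ball_bump_def dot_square_norm zero_less_power2 max_def)
  also have "\<dots> \<longleftrightarrow> norm (x - c) < r"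
    using r by (metis norm_ge_zero less_eq_real_def power_less_imp_less_base power_strict_mono pos2)
  finally show ?thesis by (simp add: dist_norm norm_minus_commute)
qed

text \<open>\<open>n s / (1 + n s)\<close> turns a nonnegative function \<open>s\<close> of class \<open>C\<^sup>1\<close> into test functions that
  converge boundedly to the indicator of \<open>{s > 0}\<close>.\<close>

lemma DERIV_saturation:
  assumes "0 \<le> a" "0 \<le> (s::real)"
  shows "((\<lambda>s. a * s / (1 + a * s)) has_real_derivative a / (1 + a * s)\<^sup>2) (at s)"
proof -
  have "0 < 1 + a * s" using assms by (simp add: add_pos_nonneg)
  then show ?thesis
    by (auto intro!: derivative_eq_intros simp: field_simps power2_eq_square)
qed

lemma GDERIV_sum:
  assumes "finite I" "\<And>i. i \<in> I \<Longrightarrow> GDERIV (f i) x :> f' i"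
  shows "GDERIV (\<lambda>x. \<Sum>i\<in>I. f i x) x :> (\<Sum>i\<in>I. f' i)"
  using assms by (induction I) (auto intro: GDERIV_const GDERIV_add)

lemma set_lebesgue_on_subset: "S \<in> sets lebesgue \<Longrightarrow> A \<in> sets lebesgue \<Longrightarrow> A \<inter> S \<in> sets (lebesgue_on S)"
  by (auto simp: sets_restrict_space)

text \<open>By Lindelof's theorem an open set is a countable union of balls whose closures it contains.  The
  partial sums of their bumps, saturated, are supported in finitely many of these closed balls.\<close>

lemma indicator_open_limit_test_functions:
  fixes V :: "(real ^ 'n) set"
  assumes V: "open V" "V \<subseteq> \<omega>"
  obtains \<phi> G where "\<And>n::nat. test_function \<omega> (\<phi> n) (G n)" "\<And>n x. 0 \<le> \<phi> n x \<and> \<phi> n x \<le> 1"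
    "\<And>x. (\<lambda>n. \<phi> n x) \<longlonglongrightarrow> indicator V x"
proof (cases "V = {}")
  case True
  show ?thesis
  proof (rule that[of "\<lambda>_ _. 0" "\<lambda>_ _. 0"])
  qed (auto simp: test_function_def True GDERIV_const)
next
  case False
  define \<F> where "\<F> = {B. \<exists>c r. 0 < r \<and> cball c r \<subseteq> V \<and> B = ball c r}"
  have UF: "\<Union>\<F> = V"
  proof
    show "V \<subseteq> \<Union>\<F>"
    proof
      fix x assume "x \<in> V"
      then obtain r where "0 < r" "cball x r \<subseteq> V" using V(1) open_contains_cball by blast
      then show "x \<in> \<Union>\<F>" by (auto simp: \<F>_def intro!: exI[of _ "ball x r"] exI[of _ x] exI[of _ r])
    qed
  qed (auto simp: \<F>_def subset_eq)
  obtain \<F>' where F': "\<F>' \<subseteq> \<F>" "countable \<F>'" "\<Union>\<F>' = \<Union>\<F>"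
    by (rule Lindelof[of \<F>]) (auto simp: \<F>_def)
  have F'ne: "\<F>' \<noteq> {}" using False F'(3) UF by auto
  have "\<exists>c r. 0 < r \<and> cball c r \<subseteq> V \<and> from_nat_into \<F>' k = ball c r" for k
    using from_nat_into[OF F'ne, of k] F'(1) by (auto simp: \<F>_def)
  then obtain c r where cr: "\<And>k. 0 < r k" "\<And>k. cball (c k) (r k) \<subseteq> V"
      "\<And>k. from_nat_into \<F>' k = ball (c k) (r k)" by metis
  have Vx: "x \<in> V \<longleftrightarrow> (\<exists>k. x \<in> ball (c k) (r k))" for x
  proof
    assume "x \<in> V"
    then obtain B where "B \<in> \<F>'" "x \<in> B" using UF F'(3) by blast
    then show "\<exists>k. x \<in> ball (c k) (r k)"
      using from_nat_into_surj[OF F'(2)] cr(3) by metis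
  next
    assume "\<exists>k. x \<in> ball (c k) (r k)"
    then obtain k where "x \<in> ball (c k) (r k)" ..
    then have "x \<in> cball (c k) (r k)" by simp
    then show "x \<in> V" using cr(2) by (rule subsetD[rotated])
  qed
  define s where "s n x = (\<Sum>k<n. ball_bump (c k) (r k) x)" for n :: nat and x
  define s' where "s' n x = (\<Sum>k<n. (2 * max 0 ((r k)\<^sup>2 - (x - c k) \<bullet> (x - c k))) *\<^sub>R ((- 2) *\<^sub>R (x - c k)))"
    for n :: nat and x
  define \<phi> where "\<phi> n x = real n * s n x / (1 + real n * s n x)" for n x
  define G where "G n x = (real n / (1 + real n * s n x)\<^sup>2) *\<^sub>R s' n x" for n x
  have s0: "0 \<le> s n x" for n x by (simp add: s_def sum_nonneg)
  have ds: "GDERIV (s n) x :> s' n x" for n x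
    unfolding s_def[abs_def] s'_def by (intro GDERIV_sum GDERIV_ball_bump) simp
  have d\<phi>: "GDERIV (\<phi> n) x :> G n x" for n x
    unfolding \<phi>_def[abs_def] G_def
    by (rule GDERIV_DERIV_compose[OF ds DERIV_saturation]) (auto simp: s0)
  have cs: "continuous_on UNIV (s n)" for n
    unfolding s_def[abs_def] ball_bump_def by (intro continuous_intros)
  have cs': "continuous_on UNIV (s' n)" for n
    unfolding s'_def[abs_def] by (intro continuous_intros)
  have pos: "0 < 1 + real n * s n x" for n x using s0[of n x] by (simp add: add_pos_nonneg)
  have supp: "{x. \<phi> n x \<noteq> 0} \<subseteq> (\<Union>k<n. cball (c k) (r k))" for n
  proof
    fix x assume "x \<in> {x. \<phi> n x \<noteq> 0}"
    then have "s n x \<noteq> 0" by (auto simp: \<phi>_def)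
    then obtain k where k: "k \<in> {..<n}" "ball_bump (c k) (r k) x \<noteq> 0"
      unfolding s_def by (rule sum.not_neutral_contains_not_neutral)
    then have "0 < ball_bump (c k) (r k) x" using ball_bump_nonneg[of "c k" "r k" x] by linarith
    then have "x \<in> ball (c k) (r k)" using ball_bump_pos_iff[OF cr(1)] by blast
    then show "x \<in> (\<Union>k<n. cball (c k) (r k))" using k(1) by (auto intro: less_imp_le)
  qed
  have cl: "closure {x. \<phi> n x \<noteq> 0} \<subseteq> (\<Union>k<n. cball (c k) (r k))" for n
    by (rule closure_minimal[OF supp]) (intro closed_UN, auto)
  have bd: "bounded (\<Union>k<n. cball (c k) (r k))" for n
    by (intro bounded_UN) auto
  show ?thesis
  proof (rule that[of \<phi> G])
    fix n
    show "test_function \<omega> (\<phi> n) (G n)"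
      unfolding test_function_def
    proof (intro conjI allI d\<phi>)
      show "continuous_on UNIV (G n)"
        unfolding G_def[abs_def] using pos
        by (intro continuous_intros cs cs') (auto simp: less_imp_neq[symmetric])
      show "compact (closure {x. \<phi> n x \<noteq> 0})"
        using bounded_subset[OF bd supp] by simp
      show "closure {x. \<phi> n x \<noteq> 0} \<subseteq> \<omega>"
        using cl[of n] cr(2) V(2) by blast
    qed
    fix x
    show "0 \<le> \<phi> n x \<and> \<phi> n x \<le> 1"
      using pos[of n x] s0[of n x] by (simp add: \<phi>_def)
  next
    fix x
    show "(\<lambda>n. \<phi> n x) \<longlonglongrightarrow> indicator V x"
    proof (cases "x \<in> V")
      case True
      then obtain k where "x \<in> ball (c k) (r k)" using Vx by blast
      then have b: "0 < ball_bump (c k) (r k) x" (is "0 < ?b") using ball_bump_pos_iff[OF cr(1)] by blast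
      have "(\<lambda>n. 1 - \<phi> n x) \<longlonglongrightarrow> 0"
      proof (rule Lim_null_comparison)
        show "\<forall>\<^sub>F n in sequentially. norm (1 - \<phi> n x) \<le> inverse (real n) / ?b"
          using eventually_gt_at_top[of "k + 1"]
        proof eventually_elim
          case (elim n)
          have "?b \<le> s n x"
            unfolding s_def using elim by (intro member_le_sum) auto
          then have "real n * ?b \<le> 1 + real n * s n x"
            by (simp add: add_increasing mult_left_mono)
          moreover have "0 < real n * ?b" using b elim by simp
          moreover have "1 - \<phi> n x = 1 / (1 + real n * s n x)"
            using pos[of n x] by (simp add: \<phi>_def field_simps)
          ultimately have "norm (1 - \<phi> n x) \<le> 1 / (real n * ?b)"
            using pos[of n x] by (simp add: frac_le)
          then show ?case by (simp add: inverse_eq_divide)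
        qed
        show "(\<lambda>n. inverse (real n) / ?b) \<longlonglongrightarrow> 0"
          using lim_inverse_n[where 'a=real] by (intro tendsto_divide_zero)
      qed
      then have "(\<lambda>n. 1 - (1 - \<phi> n x)) \<longlonglongrightarrow> 1 - 0" by (intro tendsto_intros)
      then show ?thesis using True by simp
    next
      case False
      have "ball_bump (c k) (r k) x = 0" for k
      proof -
        have "\<not> 0 < ball_bump (c k) (r k) x" using False Vx ball_bump_pos_iff[OF cr(1)] by blast
        then show ?thesis using ball_bump_nonneg[of "c k" "r k" x] by linarith
      qed
      then have "\<phi> n x = 0" for n by (simp add: \<phi>_def s_def)
      then show ?thesis using False by simp
    qed
  qed
qed

lemma test_function_continuous:
  assumes "test_function \<omega> \<phi> G" shows "continuous_on S \<phi>"
  using assms unfolding test_function_def gderiv_def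
  by (intro continuous_at_imp_continuous_on ballI) (blast intro: has_derivative_continuous)

lemma test_function_measurable :
  assumes "test_function \<omega> \<phi> G" shows "\<phi> \<in> borel_measurable borel"
  using test_function_continuous[OF assms] by (rule borel_measurable_continuous_onI)

lemma of_real_measurable:
  "f \<in> borel_measurable M \<Longrightarrow> (\<lambda>x. complex_of_real (f x)) \<in> borel_measurable M"
  by simp

lemma borel_imp_lebesgue_on_measurable:
  "f \<in> borel_measurable borel \<Longrightarrow> f \<in> borel_measurable (lebesgue_on S)"
  by (intro measurable_restrict_space1 measurable_completion) simp

text \<open>The sets over which \<open>h\<close> integrates to zero form a Dynkin system that contains the open
  sets, hence all Borel sets; Lebesgue sets differ from Borel sets by null sets only.\<close>

lemma fundamental_lemma_of_variations:
  fixes h :: "real ^ 'n \<Rightarrow> complex"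
  assumes op: "open \<omega>" and h: "integrable (lebesgue_on \<omega>) h"
    and zero: "\<And>\<phi> G. test_function \<omega> \<phi> G \<Longrightarrow> (LINT x|lebesgue_on \<omega>. h x * of_real (\<phi> x)) = 0"
  shows "AE x in lebesgue_on \<omega>. h x = 0"
proof -
  let ?M = "lebesgue_on \<omega>"
  have oS: "\<omega> \<in> sets lebesgue" using op by auto
  define I where "I A = (LINT x|?M. indicat_real A x *\<^sub>R h x)" for A
  have int: "integrable ?M (\<lambda>x. indicat_real A x *\<^sub>R h x)" if "A \<in> sets borel" for A
  proof (rule Bochner_Integration.integrable_bound[OF h])
    have "indicat_real A \<in> borel_measurable ?M"
      using that by (intro borel_imp_lebesgue_on_measurable) simp
    then show "(\<lambda>x. indicat_real A x *\<^sub>R h x) \<in> borel_measurable ?M"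
      using h by (intro borel_measurable_scaleR) auto
  qed (auto simp: indicator_def)
  have I_open: "I V = 0" if V: "open V" for V
  proof -
    have VW: "open (V \<inter> \<omega>)" "V \<inter> \<omega> \<subseteq> \<omega>" using V op by auto
    obtain \<phi> G where \<phi>: "\<And>n::nat. test_function \<omega> (\<phi> n) (G n)" "\<And>n x. 0 \<le> \<phi> n x \<and> \<phi> n x \<le> 1"
        "\<And>x. (\<lambda>n. \<phi> n x) \<longlonglongrightarrow> indicator (V \<inter> \<omega>) x"
      using indicator_open_limit_test_functions[OF VW] by metis
    have "(\<lambda>n. LINT x|?M. h x * of_real (\<phi> n x)) \<longlonglongrightarrow> (LINT x|?M. h x * of_real (indicator (V \<inter> \<omega>) x))"
    proof (rule integral_dominated_convergence[where w = "\<lambda>x. norm (h x)"])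
      show "(\<lambda>x. h x * complex_of_real (indicat_real (V \<inter> \<omega>) x)) \<in> borel_measurable ?M"
      proof -
        have "indicat_real (V \<inter> \<omega>) \<in> borel_measurable ?M"
          using VW by (intro borel_imp_lebesgue_on_measurable borel_measurable_indicator) auto
        from borel_measurable_times[OF borel_measurable_integrable[OF h] of_real_measurable[OF this]]
        show ?thesis .
      qed
      show "(\<lambda>x. h x * complex_of_real (\<phi> n x)) \<in> borel_measurable ?M" for n
        using borel_measurable_times[OF borel_measurable_integrable[OF h] of_real_measurable[OF
            borel_imp_lebesgue_on_measurable[OF test_function_measurable[OF \<phi>(1)]]]] .
      show "integrable ?M (\<lambda>x. norm (h x))" using h by (rule integrable_norm)
      show "AE x in ?M. (\<lambda>n. h x * complex_of_real (\<phi> n x)) \<longlonglongrightarrow> h x * complex_of_real (indicat_real (V \<inter> \<omega>) x)"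
        by (intro AE_I2 tendsto_intros \<phi>(3))
      show "AE x in ?M. norm (h x * complex_of_real (\<phi> n x)) \<le> norm (h x)" for n
        using \<phi>(2)[of n] by (intro AE_I2) (auto simp: norm_mult intro: mult_left_le)
    qed
    then have "(LINT x|?M. h x * of_real (indicator (V \<inter> \<omega>) x)) = 0"
      using zero[OF \<phi>(1)] by (simp add: LIMSEQ_const_iff)
    moreover have "(LINT x|?M. h x * of_real (indicator (V \<inter> \<omega>) x)) = I V"
      unfolding I_def by (intro Bochner_Integration.integral_cong) (auto simp: indicator_def)
    ultimately show ?thesis by simp
  qed
  have I_borel: "I A = 0" if "A \<in> sets borel" for A
  proof -
    have sig: "sigma_sets UNIV {S::(real ^ 'n) set. open S} = sets borel" by (simp add: borel_def)
    have "Int_stable {S::(real ^ 'n) set. open S}" by (auto simp: Int_stable_def)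
    moreover have "{S::(real ^ 'n) set. open S} \<subseteq> Pow UNIV" by simp
    moreover have "A \<in> sigma_sets UNIV {S. open S}" using that sig by simp
    ultimately show ?thesis
    proof (induction rule: sigma_sets_induct_disjoint)
      case (basic A) then show ?case using I_open by simp
    next
      case empty then show ?case by (simp add: I_def)
    next
      case (compl A)
      then have A: "A \<in> sets borel" using sig by simp
      have "I (UNIV - A) = (LINT x|?M. indicat_real UNIV x *\<^sub>R h x - indicat_real A x *\<^sub>R h x)"
        unfolding I_def by (intro Bochner_Integration.integral_cong) (auto simp: indicator_def)
      also have "\<dots> = I UNIV - I A"
        unfolding I_def using A by (intro Bochner_Integration.integral_diff int) auto
      also have "\<dots> = 0" using compl I_open[of UNIV] by simp
      finally show ?case .
    next
      case (union A)
      then have A: "A i \<in> sets borel" for i using sig by blast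
      have UA: "(\<Union>i. A i) \<in> sets borel" using A by auto
      have "(\<lambda>n. LINT x|?M. indicat_real (\<Union>i<n. A i) x *\<^sub>R h x) \<longlonglongrightarrow> I (\<Union>i. A i)"
        unfolding I_def
      proof (rule integral_dominated_convergence[where w = "\<lambda>x. norm (h x)"])
        show "(\<lambda>x. indicat_real (\<Union>i. A i) x *\<^sub>R h x) \<in> borel_measurable ?M"
          using int[OF UA] by auto
        show "(\<lambda>x. indicat_real (\<Union>i<n. A i) x *\<^sub>R h x) \<in> borel_measurable ?M" for n
        proof -
          have "(\<Union>i<n. A i) \<in> sets borel" using A by auto
          from int[OF this] show ?thesis by auto
        qed
        show "integrable ?M (\<lambda>x. norm (h x))" using h by (rule integrable_norm)
        show "AE x in ?M. (\<lambda>n. indicat_real (\<Union>i<n. A i) x *\<^sub>R h x) \<longlonglongrightarrow> indicat_real (\<Union>i. A i) x *\<^sub>R h x"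
          by (intro AE_I2 tendsto_intros LIMSEQ_indicator_UN)
        show "AE x in ?M. norm (indicat_real (\<Union>i<n. A i) x *\<^sub>R h x) \<le> norm (h x)" for n
          by (intro AE_I2) (auto simp: indicator_def)
      qed
      moreover have "(LINT x|?M. indicat_real (\<Union>i<n. A i) x *\<^sub>R h x) = 0" for n
      proof (induction n)
        case (Suc n)
        have "A i \<inter> A n = {}" if "i < n" for i
          using disjoint_family_onD[OF union(1), of i n] that by simp
        then have disj: "(\<Union>i<n. A i) \<inter> A n = {}" by blast
        have Un: "(\<Union>i<n. A i) \<in> sets borel" using A by auto
        have "(LINT x|?M. indicat_real (\<Union>i<Suc n. A i) x *\<^sub>R h x)
            = (LINT x|?M. indicat_real (\<Union>i<n. A i) x *\<^sub>R h x + indicat_real (A n) x *\<^sub>R h x)"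
          using disj by (intro Bochner_Integration.integral_cong)
            (auto simp: indicator_def lessThan_Suc)
        also have "\<dots> = (LINT x|?M. indicat_real (\<Union>i<n. A i) x *\<^sub>R h x) + I (A n)"
          unfolding I_def using A Un by (intro Bochner_Integration.integral_add int) auto
        finally show ?case using Suc union(3)[of n] by simp
      qed simp
      ultimately show ?case by (simp add: LIMSEQ_const_iff)
    qed
  qed
  have I_leb: "(LINT x:A|?M. h x) = 0" if A: "A \<in> sets ?M" for A
  proof -
    have "A \<in> sets lebesgue" using A oS by (simp add: sets_restrict_space_iff)
    then obtain C T where CT: "fsigma C" "T \<in> null_sets lebesgue" "C \<union> T = A" "disjnt C T"
      using lebesgue_set_almost_fsigma by metis
    have Cb: "C \<in> sets borel"
      using CT(1) by (cases rule: fsigma.cases) (auto intro!: sets.countable_UN)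
    have "AE x in lebesgue. x \<notin> T" using CT(2) by (rule AE_not_in)
    then have "AE x in ?M. x \<notin> T" using oS by (auto simp: AE_restrict_space_iff)
    then have "AE x in ?M. indicat_real A x *\<^sub>R h x = indicat_real C x *\<^sub>R h x"
      using CT(3) by (auto simp: indicator_def elim!: eventually_mono)
    moreover have "(\<lambda>x. indicat_real A x *\<^sub>R h x) \<in> borel_measurable ?M"
      using A h by (intro borel_measurable_scaleR borel_measurable_indicator) auto
    ultimately have "(LINT x:A|?M. h x) = I C"
      unfolding set_lebesgue_integral_def I_def using int[OF Cb]
      by (intro integral_cong_AE) auto
    then show ?thesis using I_borel[OF Cb] by simp
  qed
  have part: "AE x in ?M. T (h x) = 0" if T: "bounded_linear T" for T :: "complex \<Rightarrow> real"
  proof (rule density_unique_real)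
    show "integrable ?M (\<lambda>x. T (h x))" using T h by (rule integrable_bounded_linear)
    fix A assume A: "A \<in> sets ?M"
    have iA: "integrable ?M (\<lambda>x. indicat_real A x *\<^sub>R h x)"
      using A h by (intro integrable_mult_indicator) auto
    have "(LINT x:A|?M. T (h x)) = (LINT x|?M. T (indicat_real A x *\<^sub>R h x))"
      unfolding set_lebesgue_integral_def using T
      by (intro Bochner_Integration.integral_cong) (auto simp: linear_simps)
    also have "\<dots> = T (LINT x:A|?M. h x)"
      unfolding set_lebesgue_integral_def by (rule integral_bounded_linear[OF T iA])
    finally show "(LINT x:A|?M. T (h x)) = (LINT x:A|?M. 0)"
      using I_leb[OF A] T by (simp add: linear_simps set_lebesgue_integral_def)
  qed simp
  from part[OF bounded_linear_Re] part[OF bounded_linear_Im] show ?thesis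
    by eventually_elim (simp add: complex_eq_iff)
qed

section \<open>Uniqueness and linearity of weak gradients\<close>

lemma L2_measurable: "f \<in> L2 \<omega> \<Longrightarrow> f \<in> borel_measurable (lebesgue_on \<omega>)"
  by (simp add: L2_def)

lemma finite_measure_lebesgue_on: "bounded S \<Longrightarrow> S \<in> sets lebesgue \<Longrightarrow> finite_measure (lebesgue_on S)"
proof (rule finite_measureI)
  assume "bounded S" "S \<in> sets lebesgue"
  then have "S \<in> lmeasurable" by (rule bounded_set_imp_lmeasurable)
  then show "emeasure (lebesgue_on S) (space (lebesgue_on S)) \<noteq> \<infinity>"
    by (auto simp: emeasure_restrict_space fmeasurable_def)
qed

lemma L2_component:
  fixes g :: "real ^ 'n \<Rightarrow> complex ^ 'm"
  assumes "g \<in> L2 \<omega>" shows "(\<lambda>x. g x $ i) \<in> L2 \<omega>"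
proof -
  have meas: "(\<lambda>x. g x $ i) \<in> borel_measurable (lebesgue_on \<omega>)"
  proof (rule borel_measurable_continuous_on[where f = "\<lambda>v. v $ i"])
    show "continuous_on UNIV (\<lambda>v::complex ^ 'm. v $ i)" by (intro continuous_intros)
  qed (use assms in \<open>auto simp: L2_def\<close>)
  have "integrable (lebesgue_on \<omega>) (\<lambda>x. (norm (g x $ i))\<^sup>2)"
  proof (rule Bochner_Integration.integrable_bound)
    show "integrable (lebesgue_on \<omega>) (\<lambda>x. (norm (g x))\<^sup>2)" using assms by (simp add: L2_def)
    show "(\<lambda>x. (norm (g x $ i))\<^sup>2) \<in> borel_measurable (lebesgue_on \<omega>)" using meas by simp
    show "AE x in lebesgue_on \<omega>. norm ((norm (g x $ i))\<^sup>2) \<le> norm ((norm (g x))\<^sup>2)"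
      by (intro AE_I2) (auto intro!: power_mono Finite_Cartesian_Product.norm_nth_le)
  qed
  with meas show ?thesis by (simp add: L2_def)
qed

lemma L2_mult_integrable:
  fixes f g :: "real ^ 'n \<Rightarrow> complex"
  assumes f: "f \<in> L2 \<omega>" and g: "g \<in> L2 \<omega>"
  shows "integrable (lebesgue_on \<omega>) (\<lambda>x. f x * g x)"
proof (rule Bochner_Integration.integrable_bound)
  show "integrable (lebesgue_on \<omega>) (\<lambda>x. (norm (f x))\<^sup>2 + (norm (g x))\<^sup>2)"
    using f g by (simp add: L2_def)
  show "(\<lambda>x. f x * g x) \<in> borel_measurable (lebesgue_on \<omega>)"
    using f g by (auto simp: L2_def)
  show "AE x in lebesgue_on \<omega>. norm (f x * g x) \<le> norm ((norm (f x))\<^sup>2 + (norm (g x))\<^sup>2)"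
  proof (intro AE_I2)
    fix x
    have "2 * (norm (f x) * norm (g x)) \<le> (norm (f x))\<^sup>2 + (norm (g x))\<^sup>2"
      using sum_squares_bound[of "norm (f x)" "norm (g x)"] by (simp add: power2_eq_square)
    then have "norm (f x) * norm (g x) \<le> (norm (f x))\<^sup>2 + (norm (g x))\<^sup>2"
      using mult_nonneg_nonneg[OF norm_ge_zero norm_ge_zero, of "f x" "g x"] by linarith
    then show "norm (f x * g x) \<le> norm ((norm (f x))\<^sup>2 + (norm (g x))\<^sup>2)"
      by (simp add: norm_mult)
  qed
qed

lemma L2_cnj: "f \<in> L2 \<omega> \<Longrightarrow> (\<lambda>x. cnj (f x)) \<in> L2 \<omega>"
  by (auto simp: L2_def intro: borel_measurable_continuous_on[where f = cnj, OF continuous_on_cnj[OF continuous_on_id]])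

lemma bounded_measurable_L2:
  assumes "f \<in> borel_measurable (lebesgue_on \<omega>)" "AE x in lebesgue_on \<omega>. norm (f x) \<le> B"
    and "bounded \<omega>" "\<omega> \<in> sets lebesgue"
  shows "f \<in> L2 \<omega>"
proof -
  interpret finite_measure "lebesgue_on \<omega>" using assms(3,4) by (rule finite_measure_lebesgue_on)
  have "AE x in lebesgue_on \<omega>. norm ((norm (f x))\<^sup>2) \<le> B\<^sup>2"
    using assms(2) by eventually_elim (simp add: power_mono)
  then have "integrable (lebesgue_on \<omega>) (\<lambda>x. (norm (f x))\<^sup>2)"
    using assms(1) by (intro integrable_const_bound[where B = "B\<^sup>2"]) auto
  then show ?thesis using assms(1) by (simp add: L2_def)
qed

lemma L2_integrable:
  fixes f :: "real ^ 'n \<Rightarrow> complex"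
  assumes "f \<in> L2 \<omega>" "bounded \<omega>" "\<omega> \<in> sets lebesgue"
  shows "integrable (lebesgue_on \<omega>) f"
proof -
  interpret finite_measure "lebesgue_on \<omega>" using assms(2,3) by (rule finite_measure_lebesgue_on)
  have "(\<lambda>_. 1 :: complex) \<in> L2 \<omega>"
    by (rule bounded_measurable_L2[where B = 1]) (use assms in auto)
  from L2_mult_integrable[OF assms(1) this] show ?thesis by simp
qed

lemma L2_add:
  fixes f g :: "real ^ 'n \<Rightarrow> 'b :: euclidean_space"
  assumes "f \<in> L2 \<omega>" "g \<in> L2 \<omega>"
  shows "(\<lambda>x. f x + g x) \<in> L2 \<omega>"
proof -
  have m: "(\<lambda>x. f x + g x) \<in> borel_measurable (lebesgue_on \<omega>)"
    using assms by (auto simp: L2_def)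
  have "integrable (lebesgue_on \<omega>) (\<lambda>x. (norm (f x + g x))\<^sup>2)"
  proof (rule Bochner_Integration.integrable_bound)
    show "integrable (lebesgue_on \<omega>) (\<lambda>x. 2 * (norm (f x))\<^sup>2 + 2 * (norm (g x))\<^sup>2)"
      using assms by (simp add: L2_def)
    show "AE x in lebesgue_on \<omega>. norm ((norm (f x + g x))\<^sup>2)
        \<le> norm (2 * (norm (f x))\<^sup>2 + 2 * (norm (g x))\<^sup>2)"
    proof (intro AE_I2)
      fix x
      have "(norm (f x + g x))\<^sup>2 \<le> (norm (f x) + norm (g x))\<^sup>2"
        by (intro power_mono norm_triangle_ineq) auto
      also have "\<dots> \<le> 2 * (norm (f x))\<^sup>2 + 2 * (norm (g x))\<^sup>2"
        using sum_squares_bound[of "norm (f x)" "norm (g x)"] by (simp add: power2_sum)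
      finally show "norm ((norm (f x + g x))\<^sup>2) \<le> norm (2 * (norm (f x))\<^sup>2 + 2 * (norm (g x))\<^sup>2)"
        by simp
    qed
  qed (use m in simp)
  with m show ?thesis by (simp add: L2_def)
qed

lemma L2_vector_scale:
  fixes g :: "real ^ 'n \<Rightarrow> complex ^ 'm"
  assumes "g \<in> L2 \<omega>" shows "(\<lambda>x. c *s g x) \<in> L2 \<omega>"
proof -
  have n: "norm (c *s v) = norm c * norm v" for v :: "complex ^ 'm"
    by (simp add: norm_vec_def L2_set_def norm_mult power_mult_distrib sum_distrib_left[symmetric]
        real_sqrt_mult)
  have "continuous_on UNIV (\<lambda>v::complex ^ 'm. c *s v)"
    unfolding vector_scalar_mult_def by (intro continuous_intros)
  then have "(\<lambda>x. c *s g x) \<in> borel_measurable (lebesgue_on \<omega>)"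
    using assms by (intro borel_measurable_continuous_on[where f = "\<lambda>v. c *s v"]) (auto simp: L2_def)
  then show ?thesis using assms by (simp add: L2_def n power_mult_distrib)
qed

lemma L2_scale:
  fixes f :: "real ^ 'n \<Rightarrow> complex"
  assumes "f \<in> L2 \<omega>" shows "(\<lambda>x. c * f x) \<in> L2 \<omega>"
  using assms by (auto simp: L2_def norm_mult power_mult_distrib intro: borel_measurable_times)

lemma L2_of_real_bounded:
  fixes \<phi> :: "real ^ 'n \<Rightarrow> real"
  assumes "continuous_on UNIV \<phi>" "compact (closure {x. \<phi> x \<noteq> 0})" "bounded \<omega>" "\<omega> \<in> sets lebesgue"
  shows "(\<lambda>x. complex_of_real (\<phi> x)) \<in> L2 \<omega>"
proof -
  have "bounded (\<phi> ` closure {x. \<phi> x \<noteq> 0})"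
    using assms(1,2) by (intro compact_imp_bounded compact_continuous_image) (auto intro: continuous_on_subset)
  then obtain B where B: "0 < B" "\<And>x. x \<in> closure {x. \<phi> x \<noteq> 0} \<Longrightarrow> \<bar>\<phi> x\<bar> \<le> B"
    by (auto simp: bounded_pos)
  have "\<bar>\<phi> x\<bar> \<le> B" for x
    using B closure_subset[of "{x. \<phi> x \<noteq> 0}"] by (cases "\<phi> x = 0") auto
  moreover have "(\<lambda>x. complex_of_real (\<phi> x)) \<in> borel_measurable (lebesgue_on \<omega>)"
    using assms(1) by (intro borel_imp_lebesgue_on_measurable borel_measurable_continuous_onI continuous_on_of_real)
  ultimately show ?thesis
    using assms(3,4) by (intro bounded_measurable_L2[where B = B]) auto
qed

lemma test_function_L2:
  assumes "test_function \<omega> \<phi> G" "bounded \<omega>" "\<omega> \<in> sets lebesgue"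
  shows "(\<lambda>x. complex_of_real (\<phi> x)) \<in> L2 \<omega>"
  using assms test_function_continuous[OF assms(1)] unfolding test_function_def
  by (intro L2_of_real_bounded) auto

lemma test_function_gradient_zero_outside:
  assumes "test_function \<omega> \<phi> G" "x \<notin> closure {x. \<phi> x \<noteq> 0}"
  shows "G x = 0"
proof -
  let ?S = "closure {x. \<phi> x \<noteq> 0}"
  have "GDERIV \<phi> x :> G x" using assms(1) by (simp add: test_function_def)
  then have "(\<phi> has_derivative (\<lambda>h. h \<bullet> G x)) (at x)" by (simp add: gderiv_def)
  moreover have "(\<phi> has_derivative (\<lambda>h. 0)) (at x)"
  proof (rule has_derivative_transform_within_open[where f = "\<lambda>_. 0" and s = "- ?S"])
    show "((\<lambda>_. 0) has_derivative (\<lambda>h. 0)) (at x)" by simp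
    show "open (- ?S)" by (rule open_Compl) (rule closed_closure)
    show "x \<in> - ?S" using assms(2) by simp
    show "0 = \<phi> y" if "y \<in> - ?S" for y
      using that closure_subset[of "{x. \<phi> x \<noteq> 0}"] by auto
  qed
  ultimately have "(\<lambda>h. h \<bullet> G x) = (\<lambda>h. 0)" by (rule has_derivative_unique)
  then have "G x \<bullet> G x = 0" by (rule fun_cong)
  then show ?thesis by simp
qed

lemma test_function_gradient_L2:
  assumes "test_function \<omega> \<phi> G" "bounded \<omega>" "\<omega> \<in> sets lebesgue"
  shows "(\<lambda>x. complex_of_real (G x $ i)) \<in> L2 \<omega>"
proof (rule L2_of_real_bounded[OF _ _ assms(2,3)])
  show "continuous_on UNIV (\<lambda>x. G x $ i)"
    using assms(1) by (intro continuous_intros) (simp add: test_function_def)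
  have "{x. G x $ i \<noteq> 0} \<subseteq> closure {x. \<phi> x \<noteq> 0}"
    using test_function_gradient_zero_outside[OF assms(1)] by force
  moreover have "compact (closure {x. \<phi> x \<noteq> 0})" using assms(1) by (simp add: test_function_def)
  ultimately show "compact (closure {x. G x $ i \<noteq> 0})"
    by (meson bounded_subset compact_closure compact_imp_bounded)
qed

text \<open>\<^const>\<open>grad\<close> chooses some weak gradient.  Uniqueness up to null sets makes integrals
  independent of the choice, and linear in the function.\<close>

lemma weak_gradient_unique:
  assumes w: "weak_gradient \<omega> u g" "weak_gradient \<omega> u g'" and L: "g \<in> L2 \<omega>" "g' \<in> L2 \<omega>"
    and op: "open \<omega>" and bd: "bounded \<omega>"
  shows "AE x in lebesgue_on \<omega>. g x = g' x"
proof -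
  have oS: "\<omega> \<in> sets lebesgue" using op by auto
  have "AE x in lebesgue_on \<omega>. g x $ i - g' x $ i = 0" for i
  proof (rule fundamental_lemma_of_variations[OF op])
    show "integrable (lebesgue_on \<omega>) (\<lambda>x. g x $ i - g' x $ i)"
      by (intro Bochner_Integration.integrable_diff L2_integrable[OF L2_component] L bd oS)
    fix \<phi> G assume t: "test_function \<omega> \<phi> G"
    have "integrable (lebesgue_on \<omega>) (\<lambda>x. g x $ i * of_real (\<phi> x))"
      by (intro L2_mult_integrable L2_component L test_function_L2[OF t bd oS])
    moreover have "integrable (lebesgue_on \<omega>) (\<lambda>x. g' x $ i * of_real (\<phi> x))"
      by (intro L2_mult_integrable L2_component L test_function_L2[OF t bd oS])
    ultimately have "(LINT x|lebesgue_on \<omega>. (g x $ i - g' x $ i) * of_real (\<phi> x))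
        = (LINT x|lebesgue_on \<omega>. g x $ i * of_real (\<phi> x)) - (LINT x|lebesgue_on \<omega>. g' x $ i * of_real (\<phi> x))"
      by (simp add: left_diff_distrib Bochner_Integration.integral_diff)
    also have "\<dots> = 0"
    proof -
      have "(LINT x|lebesgue_on \<omega>. u x * of_real (G x $ i)) = - (LINT x|lebesgue_on \<omega>. g x $ i * of_real (\<phi> x))"
        using w(1) t by (simp add: weak_gradient_iff)
      moreover have "(LINT x|lebesgue_on \<omega>. u x * of_real (G x $ i)) = - (LINT x|lebesgue_on \<omega>. g' x $ i * of_real (\<phi> x))"
        using w(2) t by (simp add: weak_gradient_iff)
      ultimately show ?thesis by simp
    qed
    finally show "(LINT x|lebesgue_on \<omega>. (g x $ i - g' x $ i) * of_real (\<phi> x)) = 0" .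
  qed
  then have "AE x in lebesgue_on \<omega>. \<forall>i\<in>UNIV. g x $ i - g' x $ i = 0"
    by (intro AE_finite_allI) auto
  then show ?thesis by eventually_elim (simp add: vec_eq_iff)
qed

lemma weak_gradient_add:
  assumes w: "weak_gradient \<omega> u g" "weak_gradient \<omega> u' g'"
    and L: "g \<in> L2 \<omega>" "g' \<in> L2 \<omega>" "u \<in> L2 \<omega>" "u' \<in> L2 \<omega>"
    and bd: "bounded \<omega>" "\<omega> \<in> sets lebesgue"
  shows "weak_gradient \<omega> (\<lambda>x. u x + u' x) (\<lambda>x. g x + g' x)"
  unfolding weak_gradient_iff
proof (intro allI impI)
  fix \<phi> G i assume t: "test_function \<omega> \<phi> G"
  note tL = test_function_L2[OF t bd] test_function_gradient_L2[OF t bd]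
  have "(LINT x|lebesgue_on \<omega>. (u x + u' x) * of_real (G x $ i))
      = (LINT x|lebesgue_on \<omega>. u x * of_real (G x $ i)) + (LINT x|lebesgue_on \<omega>. u' x * of_real (G x $ i))"
    unfolding distrib_right using L tL
    by (intro Bochner_Integration.integral_add L2_mult_integrable)
  also have "\<dots> = - ((LINT x|lebesgue_on \<omega>. g x $ i * of_real (\<phi> x)) + (LINT x|lebesgue_on \<omega>. g' x $ i * of_real (\<phi> x)))"
    using w t by (simp add: weak_gradient_iff)
  also have "(LINT x|lebesgue_on \<omega>. g x $ i * of_real (\<phi> x)) + (LINT x|lebesgue_on \<omega>. g' x $ i * of_real (\<phi> x))
      = (LINT x|lebesgue_on \<omega>. (g x + g' x) $ i * of_real (\<phi> x))"
    unfolding vector_add_component distrib_right using L tL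
    by (intro Bochner_Integration.integral_add[symmetric] L2_mult_integrable L2_component)
  finally show "(LINT x|lebesgue_on \<omega>. (u x + u' x) * of_real (G x $ i))
      = - (LINT x|lebesgue_on \<omega>. (g x + g' x) $ i * of_real (\<phi> x))" .
qed

lemma weak_gradient_scale:
  assumes "weak_gradient \<omega> u g"
  shows "weak_gradient \<omega> (\<lambda>x. c * u x) (\<lambda>x. c *s g x)"
  using assms unfolding weak_gradient_iff by (simp add: mult.assoc)

lemma weak_gradient_cong:
  assumes "\<And>x. x \<in> \<omega> \<Longrightarrow> u x = v x"
  shows "weak_gradient \<omega> u = weak_gradient \<omega> v"
proof -
  have "(LINT x|lebesgue_on \<omega>. u x * of_real (G x $ i)) = (LINT x|lebesgue_on \<omega>. v x * of_real (G x $ i))"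
    for G :: "real ^ 'a \<Rightarrow> real ^ 'a" and i
    using assms by (intro Bochner_Integration.integral_cong) auto
  then show ?thesis by (intro ext) (simp add: weak_gradient_iff)
qed

lemma grad_cong: "(\<And>x. x \<in> \<omega> \<Longrightarrow> u x = v x) \<Longrightarrow> grad \<omega> u = grad \<omega> v"
  unfolding grad_def by (simp add: weak_gradient_cong[of \<omega> u v])

lemma grad_props:
  assumes "u \<in> H1 \<omega>"
  shows "grad \<omega> u \<in> L2 \<omega>" "weak_gradient \<omega> u (grad \<omega> u)"
proof -
  have "\<exists>g. g \<in> L2 \<omega> \<and> weak_gradient \<omega> u g" using assms by (auto simp: H1_def)
  then have "grad \<omega> u \<in> L2 \<omega> \<and> weak_gradient \<omega> u (grad \<omega> u)"
    unfolding grad_def by (rule someI_ex)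
  then show "grad \<omega> u \<in> L2 \<omega>" "weak_gradient \<omega> u (grad \<omega> u)" by auto
qed

lemma grad_AE_eq:
  assumes "u \<in> H1 \<omega>" "weak_gradient \<omega> u g" "g \<in> L2 \<omega>" "open \<omega>" "bounded \<omega>"
  shows "AE x in lebesgue_on \<omega>. grad \<omega> u x = g x"
  using weak_gradient_unique[OF grad_props(2)[OF assms(1)] assms(2) grad_props(1)[OF assms(1)] assms(3-5)] .

lemma H1_lincomb:
  assumes uv: "u \<in> H1 \<omega>" "v \<in> H1 \<omega>" and op: "open \<omega>" "bounded \<omega>"
  shows "(\<lambda>x. c * u x + v x) \<in> H1 \<omega>"
    and "AE x in lebesgue_on \<omega>. grad \<omega> (\<lambda>x. c * u x + v x) x = c *s grad \<omega> u x + grad \<omega> v x"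
proof -
  have oS: "\<omega> \<in> sets lebesgue" using op by auto
  have L: "u \<in> L2 \<omega>" "v \<in> L2 \<omega>" using uv by (auto simp: H1_def)
  have gL: "(\<lambda>x. c *s grad \<omega> u x + grad \<omega> v x) \<in> L2 \<omega>"
    by (intro L2_add L2_vector_scale grad_props uv)
  have w: "weak_gradient \<omega> (\<lambda>x. c * u x + v x) (\<lambda>x. c *s grad \<omega> u x + grad \<omega> v x)"
    by (intro weak_gradient_add weak_gradient_scale grad_props uv L2_vector_scale L2_scale L op oS)
  show "(\<lambda>x. c * u x + v x) \<in> H1 \<omega>"
    using w gL L2_add[OF L2_scale[OF L(1)] L(2)] by (auto simp: H1_def)
  then show "AE x in lebesgue_on \<omega>. grad \<omega> (\<lambda>x. c * u x + v x) x = c *s grad \<omega> u x + grad \<omega> v x"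
    by (rule grad_AE_eq[OF _ w gL op])
qed

section \<open>Piecewise Lipschitz functions are Sobolev functions\<close>

lemma difference_quotient_tendsto:
  fixes f :: "'a::real_normed_vector \<Rightarrow> 'b::real_normed_vector"
  assumes D: "(f has_derivative D) (at x)" and s: "s \<longlonglongrightarrow> 0" "\<And>n. 0 < s n" and w: "norm w = 1"
  shows "(\<lambda>n. (f (x + s n *\<^sub>R w) - f x) /\<^sub>R s n) \<longlonglongrightarrow> D w"
proof -
  interpret D: bounded_linear D using D by (rule has_derivative_bounded_linear)
  have "((\<lambda>h. norm (f (x + h) - f x - D h) / norm h) \<longlongrightarrow> 0) (at 0)"
    using D by (simp add: has_derivative_at)
  moreover have "filterlim (\<lambda>n. s n *\<^sub>R w) (at 0) sequentially"
  proof (rule filterlim_atI)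
    show "(\<lambda>n. s n *\<^sub>R w) \<longlonglongrightarrow> 0" using tendsto_scaleR[OF s(1) tendsto_const[of w]] by simp
    have "s n *\<^sub>R w \<noteq> 0" for n using s(2)[of n] w by auto
    then show "\<forall>\<^sub>F n in sequentially. s n *\<^sub>R w \<noteq> 0" by simp
  qed
  ultimately have "(\<lambda>n. norm (f (x + s n *\<^sub>R w) - f x - D (s n *\<^sub>R w)) / norm (s n *\<^sub>R w)) \<longlonglongrightarrow> 0"
    by (rule filterlim_compose)
  moreover have "norm (f (x + s n *\<^sub>R w) - f x - D (s n *\<^sub>R w)) / norm (s n *\<^sub>R w)
      = norm ((f (x + s n *\<^sub>R w) - f x) /\<^sub>R s n - D w)" for n
  proof -
    have "(f (x + s n *\<^sub>R w) - f x) /\<^sub>R s n - D w = (f (x + s n *\<^sub>R w) - f x - D (s n *\<^sub>R w)) /\<^sub>R s n"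
      using s(2)[of n] by (simp add: D.scaleR scaleR_diff_right)
    then show ?thesis using s(2)[of n] w by (simp add: divide_inverse mult.commute)
  qed
  ultimately have "(\<lambda>n. norm ((f (x + s n *\<^sub>R w) - f x) /\<^sub>R s n - D w)) \<longlonglongrightarrow> 0" by simp
  then show ?thesis by (metis LIM_zero_cancel tendsto_norm_zero_iff)
qed

lemma borel_measurable_vec_lambda:
  assumes "\<And>i. (\<lambda>x. f x i) \<in> borel_measurable M"
  shows "(\<lambda>x. (\<chi> i. f x i) :: complex ^ 'n) \<in> borel_measurable M"
proof (subst borel_measurable_euclidean_space, intro ballI)
  fix b :: "complex ^ 'n" assume "b \<in> Basis"
  then obtain i u where b: "b = axis i u" by (auto simp: Basis_vec_def)
  have "(\<lambda>x. f x i \<bullet> u) \<in> borel_measurable M" using assms[of i] by simp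
  then show "(\<lambda>x. (\<chi> i. f x i) \<bullet> b) \<in> borel_measurable M" by (simp add: b inner_axis)
qed

lemma norm_vec_le_sum:
  fixes v :: "complex ^ 'n" shows "norm v \<le> (\<Sum>i\<in>UNIV. norm (v $ i))"
  unfolding norm_vec_def by (rule L2_set_le_sum) simp

lemma bounded_pos_norm: "bounded S \<Longrightarrow> \<exists>B>0. \<forall>x\<in>S. norm x \<le> B"
  by (auto simp: bounded_pos)

lemma lborel_translate:
  fixes F :: "'a::euclidean_space \<Rightarrow> complex"
  assumes "F \<in> borel_measurable borel"
  shows "(LINT x|lborel. F (c + x)) = (LINT x|lborel. F x)"
proof -
  have "(LINT x|lborel. F x) = (LINT x|distr lborel borel ((+) c). F x)"
    by (simp add: lborel_distr_plus)
  also have "\<dots> = (LINT x|lborel. F (c + x))"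
    using assms by (intro integral_distr) auto
  finally show ?thesis ..
qed

text \<open>Boundaries of convex sets are null sets.\<close>

lemma AE_in_interior_of_cover:
  fixes \<omega> :: "'a::euclidean_space set"
  assumes "finite \<K>" "\<And>K. K \<in> \<K> \<Longrightarrow> closed K \<and> convex K" "\<omega> \<subseteq> \<Union>\<K>"
  shows "AE x in lebesgue. x \<in> \<omega> \<longrightarrow> (\<exists>K\<in>\<K>. x \<in> interior K)"
proof -
  have "negligible (\<Union>K\<in>\<K>. frontier K)"
    using assms(1,2) by (intro negligible_Union) (auto intro: negligible_convex_frontier)
  moreover have "{x. \<not> (x \<in> \<omega> \<longrightarrow> (\<exists>K\<in>\<K>. x \<in> interior K))} \<subseteq> (\<Union>K\<in>\<K>. frontier K)"
  proof
    fix x assume "x \<in> {x. \<not> (x \<in> \<omega> \<longrightarrow> (\<exists>K\<in>\<K>. x \<in> interior K))}"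
    then have x: "x \<in> \<omega>" "\<And>K. K \<in> \<K> \<Longrightarrow> x \<notin> interior K" by auto
    then obtain K where "K \<in> \<K>" "x \<in> K" using assms(3) by blast
    then have "x \<in> frontier K" using x(2) assms(2) by (simp add: frontier_def)
    then show "x \<in> (\<Union>K\<in>\<K>. frontier K)" using \<open>K \<in> \<K>\<close> by blast
  qed
  ultimately show ?thesis unfolding eventually_ae_filter_negligible by blast
qed

lemma test_function_quotient_bound:
  assumes t: "test_function \<omega> \<phi> G"
  obtains C where "0 < C" "\<And>x y. \<bar>\<phi> x - \<phi> y\<bar> \<le> C * norm (x - y)" "\<And>x. norm (G x) \<le> C"
proof -
  let ?S = "closure {x. \<phi> x \<noteq> 0}"
  have "bounded (G ` ?S)"
    using t unfolding test_function_def
    by (intro compact_imp_bounded compact_continuous_image) (auto intro: continuous_on_subset)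
  then obtain C where C: "0 < C" "\<forall>x\<in>G ` ?S. norm x \<le> C" using bounded_pos_norm by blast
  have GC: "norm (G x) \<le> C" for x
    using C test_function_gradient_zero_outside[OF t, of x] by (cases "x \<in> ?S") auto
  have "norm (\<phi> x - \<phi> y) \<le> C * norm (x - y)" for x y
  proof (rule differentiable_bound[where S = UNIV])
    show "(\<phi> has_derivative (\<lambda>h. h \<bullet> G x)) (at x within UNIV)" for x
      using t by (simp add: test_function_def gderiv_def)
    show "onorm (\<lambda>h. h \<bullet> G x) \<le> C" for x
    proof (rule onorm_le)
      fix h
      have "norm (h \<bullet> G x) \<le> norm h * norm (G x)" by (simp add: Cauchy_Schwarz_ineq2)
      also have "\<dots> \<le> norm h * C" by (intro mult_left_mono GC) simp
      finally show "norm (h \<bullet> G x) \<le> C * norm h" by (simp add: mult.commute)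
    qed
  qed auto
  then show ?thesis using that[OF C(1) _ GC] by simp
qed

text \<open>Along a segment the function is continuous and piecewise Lipschitz, hence Lipschitz.
  Its difference quotients are therefore bounded near the support of a test function, and shifting
  the difference from the test function to the function itself produces the weak derivative as a
  dominated limit.\<close>

lemma piecewise_lipschitz_H1:
  fixes u :: "real ^ 'n \<Rightarrow> complex"
  assumes op: "open \<omega>" and bd: "bounded \<omega>"
    and fin: "finite \<K>" and K: "\<And>K. K \<in> \<K> \<Longrightarrow> closed K \<and> convex K" and cov: "\<omega> \<subseteq> \<Union>\<K>"
    and cont: "continuous_on \<omega> u" and ubd: "bounded (u ` \<omega>)"
    and lip: "\<And>K. K \<in> \<K> \<Longrightarrow> L-lipschitz_on (K \<inter> \<omega>) u" and L0: "0 \<le> L"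
    and diff: "\<And>K x. K \<in> \<K> \<Longrightarrow> x \<in> interior K \<Longrightarrow> x \<in> \<omega> \<Longrightarrow> u differentiable (at x)"
  shows "u \<in> H1 \<omega>"
proof -
  have oS: "\<omega> \<in> sets lebesgue" using op by auto
  \<comment> \<open>Extension by zero makes translation possible.\<close>
  define v where "v x = indicat_real \<omega> x *\<^sub>R u x" for x
  have vm: "v \<in> borel_measurable borel"
    unfolding v_def[abs_def] using op cont by (intro borel_measurable_continuous_on_indicator) auto
  obtain B where B: "0 < B" "\<forall>x\<in>u ` \<omega>. norm x \<le> B" using bounded_pos_norm[OF ubd] by blast
  have vB: "norm (v x) \<le> B" for x using B by (auto simp: v_def indicator_def)
  define s where "s n = inverse (real (Suc n))" for n
  have s: "s \<longlonglongrightarrow> 0" "0 < s n" for n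
    unfolding s_def[abs_def] using LIMSEQ_inverse_real_of_nat by simp_all
  define e where "e i = (axis i 1 :: real ^ 'n)" for i
  have ne: "norm (e i) = 1" "norm (- e i) = 1" for i by (simp_all add: e_def norm_axis_1)
  define Q where "Q i n x = (v (x + s n *\<^sub>R (- e i)) - v x) /\<^sub>R s n" for i n x
  have Qle: "norm (Q i n x) \<le> L" if "norm (v (x + s n *\<^sub>R (- e i)) - v x) \<le> L * s n" for i n x
  proof -
    have "norm (Q i n x) = norm (v (x + s n *\<^sub>R (- e i)) - v x) / s n"
      using s(2)[of n] unfolding Q_def norm_scaleR by (simp only: abs_inverse abs_of_pos divide_inverse mult.commute)
    then show ?thesis using that s(2)[of n] by (simp only: pos_divide_le_eq)
  qed
  \<comment> \<open>As a limit of difference quotients the gradient is measurable.\<close>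
  define g where "g x = (\<chi> i. - lim (\<lambda>n. Q i n x))" for x
  have Qm: "Q i n \<in> borel_measurable borel" for i n
  proof -
    have "(\<lambda>x. v (x + s n *\<^sub>R (- e i))) \<in> borel_measurable borel"
      by (rule measurable_compose[OF _ vm]) simp
    then show ?thesis unfolding Q_def[abs_def] using vm by (intro borel_measurable_scaleR borel_measurable_diff) auto
  qed
  have gm: "g \<in> borel_measurable borel"
    unfolding g_def[abs_def]
    by (intro borel_measurable_vec_lambda borel_measurable_uminus borel_measurable_lim_metric Qm)
  have good: "(\<lambda>n. Q i n x) \<longlonglongrightarrow> - (g x $ i) \<and> norm (g x $ i) \<le> L"
    if x: "x \<in> \<omega>" and Kx: "\<exists>K\<in>\<K>. x \<in> interior K" for x i
  proof -
    obtain K where K1: "K \<in> \<K>" "x \<in> interior K" using Kx by blast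
    obtain D where D: "(u has_derivative D) (at x)" using diff[OF K1 x] by (auto simp: differentiable_def)
    have "(v has_derivative D) (at x)"
      by (rule has_derivative_transform_within_open[OF D op x]) (simp add: v_def)
    from difference_quotient_tendsto[OF this s ne(2)[of i]]
    have lim: "(\<lambda>n. Q i n x) \<longlonglongrightarrow> D (- e i)" by (simp add: Q_def)
    then have "lim (\<lambda>n. Q i n x) = D (- e i)" by (rule limI)
    then have gD: "g x $ i = - D (- e i)" by (simp add: g_def)
    have ox: "open (interior K \<inter> \<omega>)" "x \<in> interior K \<inter> \<omega>" using op x K1 by auto
    have "(\<lambda>n. x + s n *\<^sub>R (- e i)) \<longlonglongrightarrow> x + 0 *\<^sub>R (- e i)" by (intro tendsto_intros s)
    then have "\<forall>\<^sub>F n in sequentially. x + s n *\<^sub>R (- e i) \<in> interior K \<inter> \<omega>"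
      using topological_tendstoD[OF _ ox(1), of "\<lambda>n. x + s n *\<^sub>R (- e i)" x] ox(2) by simp
    then have "\<forall>\<^sub>F n in sequentially. norm (Q i n x) \<le> L"
    proof eventually_elim
      case (elim n)
      have "dist (u (x + s n *\<^sub>R (- e i))) (u x) \<le> L * dist (x + s n *\<^sub>R (- e i)) x"
        using elim ox(2) interior_subset[of K] by (intro lipschitz_onD[OF lip[OF K1(1)]]) auto
      also have "dist (x + s n *\<^sub>R (- e i)) x = s n"
        using s(2)[of n] ne(1)[of i] by (simp add: dist_norm)
      finally have "norm (u (x + s n *\<^sub>R (- e i)) - u x) \<le> L * s n" by (simp add: dist_norm)
      moreover have "v (x + s n *\<^sub>R (- e i)) = u (x + s n *\<^sub>R (- e i))" "v x = u x"
        using elim x by (auto simp: v_def)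
      ultimately have "norm (v (x + s n *\<^sub>R (- e i)) - v x) \<le> L * s n" by metis
      then show ?case by (rule Qle)
    qed
    then have "norm (D (- e i)) \<le> L"
      by (rule tendsto_upperbound[OF tendsto_norm[OF lim]]) simp
    then show ?thesis using lim gD by simp
  qed
  have AEin: "AE x in lebesgue. x \<in> \<omega> \<longrightarrow> (\<exists>K\<in>\<K>. x \<in> interior K)"
    by (rule AE_in_interior_of_cover[OF fin K cov])
  have gL2: "g \<in> L2 \<omega>"
  proof (rule bounded_measurable_L2[where B = "real CARD('n) * L"])
    show "g \<in> borel_measurable (lebesgue_on \<omega>)" using gm by (rule borel_imp_lebesgue_on_measurable)
    have "AE x in lebesgue_on \<omega>. x \<in> \<omega> \<longrightarrow> (\<exists>K\<in>\<K>. x \<in> interior K)"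
      using AEin oS by (auto simp: AE_restrict_space_iff elim!: eventually_mono)
    moreover have "AE x in lebesgue_on \<omega>. x \<in> \<omega>" by (rule AE_I2) simp
    ultimately show "AE x in lebesgue_on \<omega>. norm (g x) \<le> real CARD('n) * L"
    proof eventually_elim
      case (elim x)
      have "norm (g x) \<le> (\<Sum>i\<in>UNIV. norm (g x $ i))" by (rule norm_vec_le_sum)
      also have "\<dots> \<le> (\<Sum>i\<in>(UNIV::'n set). L)" using good elim by (intro sum_mono) blast
      finally show ?case by simp
    qed
  qed (use bd oS in auto)
  have uL2: "u \<in> L2 \<omega>"
  proof (rule bounded_measurable_L2[where B = B])
    show "u \<in> borel_measurable (lebesgue_on \<omega>)"
      using cont oS by (rule continuous_imp_measurable_on_sets_lebesgue)
    show "AE x in lebesgue_on \<omega>. norm (u x) \<le> B" using B by (intro AE_I2) auto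
  qed (use bd oS in auto)
  have to_lborel: "(LINT x|lebesgue_on \<omega>. u x * of_real (\<psi> x)) = (LINT x|lborel. v x * of_real (\<psi> x))"
    if "\<psi> \<in> borel_measurable borel" for \<psi>
  proof -
    have "(LINT x|lebesgue_on \<omega>. u x * of_real (\<psi> x)) = (LINT x|lebesgue. v x * of_real (\<psi> x))"
      using oS by (subst integral_restrict_space) (auto simp: v_def)
    also have "\<dots> = (LINT x|lborel. v x * of_real (\<psi> x))"
      using vm that by (intro integral_completion) auto
    finally show ?thesis .
  qed
  have "weak_gradient \<omega> u g"
    unfolding weak_gradient_iff
  proof (intro allI impI)
    fix \<phi> G i assume t: "test_function \<omega> \<phi> G"
    let ?S = "closure {x. \<phi> x \<noteq> 0}"
    have cS: "compact ?S" "?S \<subseteq> \<omega>" and GD: "\<And>x. GDERIV \<phi> x :> G x" and cG: "continuous_on UNIV G"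
      using t by (auto simp: test_function_def)
    note \<phi>m = test_function_measurable[OF t]
    obtain C where C: "0 < C" "\<And>x y. \<bar>\<phi> x - \<phi> y\<bar> \<le> C * norm (x - y)" "\<And>x. norm (G x) \<le> C"
      using test_function_quotient_bound[OF t] by blast
    have "bounded (\<phi> ` ?S)"
      by (intro compact_imp_bounded compact_continuous_image test_function_continuous[OF t] cS)
    then obtain M where M: "0 < M" "\<forall>x\<in>\<phi> ` ?S. norm x \<le> M" using bounded_pos_norm by blast
    have \<phi>0: "\<phi> x = 0" if "x \<notin> ?S" for x using that closure_subset[of "{x. \<phi> x \<noteq> 0}"] by auto
    have \<phi>M: "\<bar>\<phi> x\<bar> \<le> M" for x using M \<phi>0[of x] by (cases "x \<in> ?S") auto
    \<comment> \<open>Steps shorter than \<open>\<epsilon>\<close> do not lead out of \<open>\<omega>\<close> from the support.\<close>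
    obtain \<epsilon> where \<epsilon>: "0 < \<epsilon>" "\<And>x y. x \<in> ?S \<Longrightarrow> dist x y < \<epsilon> \<Longrightarrow> y \<in> \<omega>"
    proof (cases "?S = {}")
      case True
      then show ?thesis using that[of 1] by simp
    next
      case False
      obtain \<epsilon> where "0 < \<epsilon>" "{x. infdist x ?S \<le> \<epsilon>} \<subseteq> \<omega>"
        using compact_in_open_separated[OF False cS(1) op cS(2)] by blast
      moreover have "infdist y ?S \<le> \<epsilon>" if "x \<in> ?S" "dist x y < \<epsilon>" for x y \<epsilon>
        using infdist_le2[OF that(1), of y \<epsilon>] that(2) by (simp add: dist_commute)
      ultimately show ?thesis using that[of \<epsilon>] by blast
    qed
    have Qbound: "norm (Q i n x) \<le> L" if x: "x \<in> ?S" and n: "s n < \<epsilon>" for x n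
    proof -
      have seg: "x + t *\<^sub>R (- e i) \<in> \<omega>" if "t \<in> {0..s n}" for t
        using that n ne(1)[of i] by (intro \<epsilon>(2)[OF x]) (auto simp: dist_norm)
      define U where "U K = {t \<in> {0..s n}. x + t *\<^sub>R (- e i) \<in> K}" for K
      have "L-lipschitz_on {0..s n} (\<lambda>t. u (x + t *\<^sub>R (- e i)))"
      proof (rule lipschitz_on_closed_Union[where I = \<K> and U = U])
        fix K assume KK: "K \<in> \<K>"
        show "L-lipschitz_on (U K) (\<lambda>t. u (x + t *\<^sub>R (- e i)))"
        proof (rule lipschitz_onI[OF _ L0])
          fix a b assume ab: "a \<in> U K" "b \<in> U K"
          have "dist (u (x + a *\<^sub>R (- e i))) (u (x + b *\<^sub>R (- e i)))
              \<le> L * dist (x + a *\<^sub>R (- e i)) (x + b *\<^sub>R (- e i))"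
            using ab seg by (intro lipschitz_onD[OF lip[OF KK]]) (auto simp: U_def)
          also have "dist (x + a *\<^sub>R (- e i)) (x + b *\<^sub>R (- e i)) = dist a b"
          proof -
            have "x + a *\<^sub>R (- e i) - (x + b *\<^sub>R (- e i)) = (a - b) *\<^sub>R (- e i)"
              by (simp add: scaleR_left_diff_distrib)
            then show ?thesis using ne(2)[of i] by (simp only: dist_norm norm_scaleR) simp
          qed
          finally show "dist (u (x + a *\<^sub>R (- e i))) (u (x + b *\<^sub>R (- e i))) \<le> L * dist a b" .
        qed
        have "closed ({0..s n} \<inter> (\<lambda>t. x + t *\<^sub>R (- e i)) -` K)"
          using K[OF KK] by (intro continuous_closed_preimage continuous_intros) auto
        then show "closed (U K)" by (simp add: U_def vimage_def Int_def)
      next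
        show "{0..s n} \<subseteq> (\<Union>K\<in>\<K>. U K)"
          using seg cov by (fastforce simp: U_def)
      qed (use fin L0 in auto)
      from lipschitz_onD[OF this, of "s n" 0] s(2)[of n]
      have "norm (u (x + s n *\<^sub>R (- e i)) - u x) \<le> L * s n" by (simp add: dist_norm)
      moreover have "v (x + s n *\<^sub>R (- e i)) = u (x + s n *\<^sub>R (- e i))" "v x = u x"
        using seg[of "s n"] seg[of 0] s(2)[of n] by (auto simp: v_def)
      ultimately have "norm (v (x + s n *\<^sub>R (- e i)) - v x) \<le> L * s n" by metis
      then show ?thesis by (rule Qle)
    qed
    have int_bd: "integrable lborel F"
      if "F \<in> borel_measurable borel" "\<And>x. norm (F x) \<le> c" "\<And>x. x \<notin> T \<Longrightarrow> F x = 0" "bounded T"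
      for F :: "real ^ 'n \<Rightarrow> complex" and c T
    proof (rule Bochner_Integration.integrable_bound)
      have "emeasure lborel (closure T) < \<infinity>"
        using that(4) by (intro emeasure_bounded_finite bounded_closure)
      then show "integrable lborel (\<lambda>x. indicat_real (closure T) x *\<^sub>R c)"
        by (intro integrable_scaleR_left integrable_real_indicator) auto
      show "AE x in lborel. norm (F x) \<le> norm (indicat_real (closure T) x *\<^sub>R c)"
      proof (rule AE_I2)
        fix x
        show "norm (F x) \<le> norm (indicat_real (closure T) x *\<^sub>R c)"
          using that(2)[of x] that(3)[of x] closure_subset[of T] by (cases "x \<in> T") (auto simp: indicator_def)
      qed
    qed (use that in simp)
    \<comment> \<open>Discrete integration by parts, from the translation invariance of Lebesgue measure.\<close>
    have shift: "(LINT x|lborel. v x * of_real ((\<phi> (x + s n *\<^sub>R e i) - \<phi> x) / s n))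
        = (LINT x|lborel. Q i n x * of_real (\<phi> x))" for n
    proof -
      define F where "F x = v (x + s n *\<^sub>R (- e i)) * of_real (\<phi> x)" for x
      have vs: "(\<lambda>x. v (x + s n *\<^sub>R (- e i))) \<in> borel_measurable borel"
        by (rule measurable_compose[OF _ vm]) simp
      have \<phi>s: "(\<lambda>x. \<phi> (x + s n *\<^sub>R e i)) \<in> borel_measurable borel"
        by (rule measurable_compose[OF _ \<phi>m]) simp
      have Fm: "F \<in> borel_measurable borel"
        unfolding F_def[abs_def] using vs of_real_measurable[OF \<phi>m] by (rule borel_measurable_times)
      have bnd: "norm (v y * of_real (\<phi> z)) \<le> B * M" for y z
        using vB[of y] \<phi>M[of z] B(1) M(1) by (simp add: norm_mult mult_mono)
      have iF: "integrable lborel F"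
      proof (rule int_bd[OF Fm])
        show "norm (F x) \<le> B * M" for x unfolding F_def by (rule bnd)
        show "F x = 0" if "x \<notin> ?S" for x unfolding F_def using \<phi>0[OF that] by simp
      qed (rule compact_imp_bounded[OF cS(1)])
      have i1: "integrable lborel (\<lambda>x. v x * of_real (\<phi> (x + s n *\<^sub>R e i)))"
        by (rule int_bd[OF borel_measurable_times[OF vm of_real_measurable[OF \<phi>s]] bnd _ bd])
           (simp add: v_def)
      have i2: "integrable lborel (\<lambda>x. v x * of_real (\<phi> x))"
        by (rule int_bd[OF borel_measurable_times[OF vm of_real_measurable[OF \<phi>m]] bnd _ bd])
           (simp add: v_def)
      have "(LINT x|lborel. v x * of_real (\<phi> (x + s n *\<^sub>R e i))) = (LINT x|lborel. F (s n *\<^sub>R e i + x))"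
        by (intro Bochner_Integration.integral_cong) (auto simp: F_def add.commute)
      also have "\<dots> = (LINT x|lborel. F x)" by (rule lborel_translate[OF Fm])
      finally have "(LINT x|lborel. v x * of_real (\<phi> (x + s n *\<^sub>R e i))) = (LINT x|lborel. F x)" .
      then have *: "(LINT x|lborel. v x * of_real (\<phi> (x + s n *\<^sub>R e i)) - v x * of_real (\<phi> x))
          = (LINT x|lborel. F x - v x * of_real (\<phi> x))"
        using Bochner_Integration.integral_diff[OF i1 i2] Bochner_Integration.integral_diff[OF iF i2] by simp
      have "(LINT x|lborel. v x * of_real ((\<phi> (x + s n *\<^sub>R e i) - \<phi> x) / s n))
          = (LINT x|lborel. (v x * of_real (\<phi> (x + s n *\<^sub>R e i)) - v x * of_real (\<phi> x)) /\<^sub>R s n)"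
        by (intro Bochner_Integration.integral_cong)
           (auto simp: scaleR_conv_of_real of_real_inverse field_simps)
      also have "\<dots> = (LINT x|lborel. (F x - v x * of_real (\<phi> x)) /\<^sub>R s n)"
        using * by simp
      also have "\<dots> = (LINT x|lborel. Q i n x * of_real (\<phi> x))"
        by (intro Bochner_Integration.integral_cong)
           (auto simp: Q_def F_def left_diff_distrib scaleR_diff_right)
      finally show ?thesis .
    qed
    have lim1: "(\<lambda>n. LINT x|lebesgue_on \<omega>. u x * of_real ((\<phi> (x + s n *\<^sub>R e i) - \<phi> x) / s n))
        \<longlonglongrightarrow> (LINT x|lebesgue_on \<omega>. u x * of_real (G x $ i))"
    proof (rule integral_dominated_convergence[where w = "\<lambda>x. norm (u x) * C"])
      have um: "u \<in> borel_measurable (lebesgue_on \<omega>)" using uL2 by (rule L2_measurable)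
      have "(\<lambda>x. G x $ i) \<in> borel_measurable borel"
        by (intro borel_measurable_continuous_onI continuous_intros cG)
      then show "(\<lambda>x. u x * complex_of_real (G x $ i)) \<in> borel_measurable (lebesgue_on \<omega>)"
        by (intro borel_measurable_times um of_real_measurable borel_imp_lebesgue_on_measurable)
      have "(\<lambda>x. (\<phi> (x + s n *\<^sub>R e i) - \<phi> x) / s n) \<in> borel_measurable borel" for n
      proof -
        have "(\<lambda>x. \<phi> (x + s n *\<^sub>R e i)) \<in> borel_measurable borel"
          by (rule measurable_compose[OF _ \<phi>m]) simp
        then show ?thesis using \<phi>m by simp
      qed
      then show "(\<lambda>x. u x * of_real ((\<phi> (x + s n *\<^sub>R e i) - \<phi> x) / s n)) \<in> borel_measurable (lebesgue_on \<omega>)" for n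
        by (rule borel_measurable_times[OF um of_real_measurable[OF borel_imp_lebesgue_on_measurable]])
      show "integrable (lebesgue_on \<omega>) (\<lambda>x. norm (u x) * C)"
        using L2_integrable[OF uL2 bd oS] by simp
      show "AE x in lebesgue_on \<omega>. (\<lambda>n. u x * of_real ((\<phi> (x + s n *\<^sub>R e i) - \<phi> x) / s n)) \<longlonglongrightarrow> u x * of_real (G x $ i)"
      proof (intro AE_I2 tendsto_mult tendsto_const tendsto_of_real)
        fix x
        have "(\<phi> has_derivative (\<lambda>h. h \<bullet> G x)) (at x)" using GD by (simp add: gderiv_def)
        from difference_quotient_tendsto[OF this s ne(1)[of i]]
        show "(\<lambda>n. (\<phi> (x + s n *\<^sub>R e i) - \<phi> x) / s n) \<longlonglongrightarrow> G x $ i"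
          by (simp add: e_def cart_eq_inner_axis inner_commute divide_inverse mult.commute)
      qed
      show "AE x in lebesgue_on \<omega>. norm (u x * of_real ((\<phi> (x + s n *\<^sub>R e i) - \<phi> x) / s n)) \<le> norm (u x) * C" for n
      proof (intro AE_I2)
        fix x
        have "\<bar>\<phi> (x + s n *\<^sub>R e i) - \<phi> x\<bar> \<le> C * s n"
          using C(2)[of "x + s n *\<^sub>R e i" x] s(2)[of n] ne(1)[of i] by simp
        then have "\<bar>(\<phi> (x + s n *\<^sub>R e i) - \<phi> x) / s n\<bar> \<le> C"
          using s(2)[of n] by (simp add: abs_divide pos_divide_le_eq)
        then show "norm (u x * of_real ((\<phi> (x + s n *\<^sub>R e i) - \<phi> x) / s n)) \<le> norm (u x) * C"
          unfolding norm_mult norm_of_real by (rule mult_left_mono) simp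
      qed
    qed
    \<comment> \<open>The bound on the difference quotients holds for small steps only, hence the index shift.\<close>
    obtain N where N: "s N < \<epsilon>" unfolding s_def using reals_Archimedean[OF \<epsilon>(1)] by blast
    have sN: "s (n + N) < \<epsilon>" for n
    proof -
      have "s (n + N) \<le> s N" unfolding s_def by (intro le_imp_inverse_le) auto
      then show ?thesis using N by simp
    qed
    have \<phi>lb: "(\<lambda>x. complex_of_real (\<phi> x)) \<in> borel_measurable lborel" using of_real_measurable[OF \<phi>m] by simp
    have "(\<lambda>n. LINT x|lborel. Q i (n + N) x * of_real (\<phi> x)) \<longlonglongrightarrow> (LINT x|lborel. - (g x $ i) * of_real (\<phi> x))"
    proof (rule integral_dominated_convergence[where w = "\<lambda>x. norm (L * \<phi> x)"])
      have gi: "(\<lambda>x. g x $ i) \<in> borel_measurable borel"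
        unfolding g_def using borel_measurable_uminus[OF borel_measurable_lim_metric[OF Qm]] by simp
      show "(\<lambda>x. - (g x $ i) * complex_of_real (\<phi> x)) \<in> borel_measurable lborel"
        using gi \<phi>lb by (intro borel_measurable_times borel_measurable_uminus) auto
      show "(\<lambda>x. Q i (n + N) x * complex_of_real (\<phi> x)) \<in> borel_measurable lborel" for n
        using Qm \<phi>lb by (intro borel_measurable_times) auto
      have "integrable lborel (\<lambda>x. complex_of_real (\<phi> x))"
      proof (rule int_bd[OF of_real_measurable[OF \<phi>m]])
        show "norm (complex_of_real (\<phi> x)) \<le> M" for x using \<phi>M[of x] by simp
        show "complex_of_real (\<phi> x) = 0" if "x \<notin> ?S" for x using \<phi>0[OF that] by simp
      qed (rule compact_imp_bounded[OF cS(1)])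
      from integrable_norm[OF this] have "integrable lborel (\<lambda>x. \<bar>L\<bar> * \<bar>\<phi> x\<bar>)" by simp
      then show "integrable lborel (\<lambda>x. norm (L * \<phi> x))" by (simp add: abs_mult)
      show "AE x in lborel. (\<lambda>n. Q i (n + N) x * of_real (\<phi> x)) \<longlonglongrightarrow> - (g x $ i) * of_real (\<phi> x)"
        using AEin[unfolded AE_completion_iff]
      proof eventually_elim
        case (elim x)
        show ?case
        proof (cases "x \<in> ?S")
          case True
          then have "(\<lambda>n. Q i n x) \<longlonglongrightarrow> - (g x $ i)" using good elim cS(2) by blast
          from LIMSEQ_ignore_initial_segment[OF this, of N] show ?thesis by (intro tendsto_intros)
        next
          case False
          from \<phi>0[OF this] show ?thesis by simp
        qed
      qed
      show "AE x in lborel. norm (Q i (n + N) x * of_real (\<phi> x)) \<le> norm (L * \<phi> x)" for n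
      proof (intro AE_I2)
        fix x
        show "norm (Q i (n + N) x * of_real (\<phi> x)) \<le> norm (L * \<phi> x)"
          using Qbound[OF _ sN[of n], of x] L0 \<phi>0[of x]
          by (cases "x \<in> ?S") (auto simp: norm_mult abs_mult intro: mult_right_mono)
      qed
    qed
    moreover have "(\<lambda>n. LINT x|lborel. Q i (n + N) x * of_real (\<phi> x)) \<longlonglongrightarrow> (LINT x|lebesgue_on \<omega>. u x * of_real (G x $ i))"
    proof -
      have "(LINT x|lebesgue_on \<omega>. u x * of_real ((\<phi> (x + s n *\<^sub>R e i) - \<phi> x) / s n))
          = (LINT x|lborel. Q i n x * of_real (\<phi> x))" for n
      proof -
        have "(\<lambda>x. \<phi> (x + s n *\<^sub>R e i)) \<in> borel_measurable borel"
          by (rule measurable_compose[OF _ \<phi>m]) simp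
        then have "(\<lambda>x. (\<phi> (x + s n *\<^sub>R e i) - \<phi> x) / s n) \<in> borel_measurable borel"
          using \<phi>m by simp
        from to_lborel[OF this] show ?thesis by (simp only: shift)
      qed
      with LIMSEQ_ignore_initial_segment[OF lim1, of N] show ?thesis by simp
    qed
    ultimately have "(LINT x|lebesgue_on \<omega>. u x * of_real (G x $ i)) = (LINT x|lborel. - (g x $ i) * of_real (\<phi> x))"
      using LIMSEQ_unique by blast
    also have "\<dots> = - (LINT x|lborel. g x $ i * of_real (\<phi> x))" by simp
    also have "(LINT x|lborel. g x $ i * of_real (\<phi> x)) = (LINT x|lebesgue_on \<omega>. g x $ i * of_real (\<phi> x))"
    proof -
      have gi: "(\<lambda>x. g x $ i) \<in> borel_measurable borel"
        unfolding g_def using borel_measurable_uminus[OF borel_measurable_lim_metric[OF Qm]] by simp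
      have "(LINT x|lebesgue_on \<omega>. g x $ i * of_real (\<phi> x)) = (LINT x|lebesgue. indicat_real \<omega> x *\<^sub>R (g x $ i * of_real (\<phi> x)))"
        using oS by (subst integral_restrict_space) auto
      also have "\<dots> = (LINT x|lebesgue. g x $ i * of_real (\<phi> x))"
      proof (intro Bochner_Integration.integral_cong refl)
        fix x
        have "\<phi> x = 0" if "x \<notin> \<omega>" using that cS(2) by (intro \<phi>0) blast
        then show "indicat_real \<omega> x *\<^sub>R (g x $ i * of_real (\<phi> x)) = g x $ i * of_real (\<phi> x)"
          by (cases "x \<in> \<omega>") simp_all
      qed
      also have "\<dots> = (LINT x|lborel. g x $ i * of_real (\<phi> x))"
        using gi \<phi>lb by (intro integral_completion borel_measurable_times) auto
      finally show ?thesis ..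
    qed
    finally show "(LINT x|lebesgue_on \<omega>. u x * of_real (G x $ i)) = - (LINT x|lebesgue_on \<omega>. g x $ i * of_real (\<phi> x))" .
  qed
  then show ?thesis using uL2 gL2 by (auto simp: H1_def)
qed

section \<open>Polynomials and traces of continuous functions\<close>

text \<open>The two properties of polynomials that piecewise polynomial functions inherit cell by cell.\<close>

definition diff_lip :: "(real ^ 'n \<Rightarrow> complex) \<Rightarrow> bool" where
  "diff_lip p \<longleftrightarrow> (\<forall>x. p differentiable (at x)) \<and> (\<forall>S. bounded S \<longrightarrow> (\<exists>L. L-lipschitz_on S p))"

lemma diff_lip_continuous: "diff_lip p \<Longrightarrow> continuous_on S p"
  by (rule continuous_at_imp_continuous_on) (simp add: diff_lip_def differentiable_imp_continuous_within)

lemma diff_lip_const: "diff_lip (\<lambda>_. c)"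
  by (auto simp: diff_lip_def intro: lipschitz_on_constant)

lemma diff_lip_coordinate: "diff_lip (\<lambda>x :: real ^ 'n. complex_of_real (x $ i))"
proof -
  have bl: "bounded_linear (\<lambda>x::real ^ 'n. complex_of_real (x $ i))"
    by (intro bounded_linear_compose[OF bounded_linear_of_real] bounded_linear_vec_nth)
  have "1-lipschitz_on S (\<lambda>x::real ^ 'n. complex_of_real (x $ i))" for S
  proof (rule lipschitz_onI)
    fix x y :: "real ^ 'n"
    have "dist (complex_of_real (x $ i)) (complex_of_real (y $ i)) = \<bar>(x - y) $ i\<bar>"
      by (simp add: dist_norm flip: of_real_diff)
    also have "\<dots> \<le> norm (x - y)" by (rule component_le_norm_cart)
    finally show "dist (complex_of_real (x $ i)) (complex_of_real (y $ i)) \<le> 1 * dist x y"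
      by (simp add: dist_norm)
  qed simp
  then show ?thesis
    using bounded_linear_imp_differentiable[OF bl] by (auto simp: diff_lip_def)
qed

lemma diff_lip_add: "diff_lip p \<Longrightarrow> diff_lip q \<Longrightarrow> diff_lip (\<lambda>x. p x + q x)"
proof -
  assume "diff_lip p" "diff_lip q"
  then have p: "p differentiable (at x)" "bounded S \<Longrightarrow> \<exists>L. L-lipschitz_on S p"
    and q: "q differentiable (at x)" "bounded S \<Longrightarrow> \<exists>L. L-lipschitz_on S q" for x S
    by (auto simp: diff_lip_def)
  have "\<exists>L. L-lipschitz_on S (\<lambda>x. p x + q x)" if S: "bounded S" for S
    using p(2)[OF S] q(2)[OF S] lipschitz_on_add by metis
  then show ?thesis using differentiable_add[OF p(1) q(1)] by (simp add: diff_lip_def)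
qed

lemma diff_lip_mult:
  assumes p: "diff_lip p" and q: "diff_lip q" shows "diff_lip (\<lambda>x. p x * q x)"
proof -
  have "\<exists>L. L-lipschitz_on S (\<lambda>x. p x * q x)" if S: "bounded S" for S
  proof -
    obtain Lp where Lp: "Lp-lipschitz_on S p" using p S unfolding diff_lip_def by blast
    obtain Lq where Lq: "Lq-lipschitz_on S q" using q S unfolding diff_lip_def by blast
    note L = Lp Lq
    have Sc: "compact (closure S)" using S by simp
    have bp: "bounded (p ` S)"
      by (rule bounded_subset[OF compact_imp_bounded[OF compact_continuous_image[OF diff_lip_continuous[OF p] Sc]]])
         (rule image_mono[OF closure_subset])
    have bq: "bounded (q ` S)"
      by (rule bounded_subset[OF compact_imp_bounded[OF compact_continuous_image[OF diff_lip_continuous[OF q] Sc]]])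
         (rule image_mono[OF closure_subset])
    obtain Bp where Bp: "0 < Bp" "\<And>x. x \<in> S \<Longrightarrow> norm (p x) \<le> Bp"
      using bp unfolding bounded_pos by blast
    obtain Bq where Bq: "0 < Bq" "\<And>x. x \<in> S \<Longrightarrow> norm (q x) \<le> Bq"
      using bq unfolding bounded_pos by blast
    note B = Bp Bq
    have L0: "0 \<le> Lp" "0 \<le> Lq" using L lipschitz_on_nonneg by blast+
    have "(Bp * Lq + Bq * Lp)-lipschitz_on S (\<lambda>x. p x * q x)"
    proof (rule lipschitz_onI)
      fix x y assume xy: "x \<in> S" "y \<in> S"
      have "p x * q x - p y * q y = p x * (q x - q y) + q y * (p x - p y)" by (simp add: algebra_simps)
      then have "dist (p x * q x) (p y * q y) \<le> norm (p x) * dist (q x) (q y) + norm (q y) * dist (p x) (p y)"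
        unfolding dist_norm by (metis norm_mult norm_triangle_ineq)
      also have "\<dots> \<le> Bp * (Lq * dist x y) + Bq * (Lp * dist x y)"
        using B L0 xy lipschitz_onD[OF L(1) xy] lipschitz_onD[OF L(2) xy]
        by (intro add_mono mult_mono) (auto intro: less_imp_le)
      finally show "dist (p x * q x) (p y * q y) \<le> (Bp * Lq + Bq * Lp) * dist x y"
        by (simp add: algebra_simps)
    qed (use B L0 in auto)
    then show ?thesis by blast
  qed
  then show ?thesis using p q by (auto simp: diff_lip_def intro: differentiable_mult)
qed

lemma diff_lip_power: "diff_lip p \<Longrightarrow> diff_lip (\<lambda>x. p x ^ (n::nat))"
  by (induction n) (auto intro: diff_lip_const diff_lip_mult)

lemma diff_lip_prod: "finite I \<Longrightarrow> (\<And>i. i \<in> I \<Longrightarrow> diff_lip (f i)) \<Longrightarrow> diff_lip (\<lambda>x. \<Prod>i\<in>I. f i x)"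
  by (induction I rule: finite_induct) (auto intro: diff_lip_const diff_lip_mult)

lemma diff_lip_sum: "(\<And>i. i \<in> I \<Longrightarrow> diff_lip (f i)) \<Longrightarrow> diff_lip (\<lambda>x. \<Sum>i\<in>I. f i x)"
  by (induction I rule: infinite_finite_induct) (auto intro: diff_lip_const diff_lip_add)

lemma diff_lip_polys: "p \<in> polys k \<Longrightarrow> diff_lip p"
proof -
  assume "p \<in> polys k"
  then obtain c where p: "p = (\<lambda>x. \<Sum>\<alpha> | sum \<alpha> UNIV \<le> k. c \<alpha> * of_real (\<Prod>i\<in>UNIV. (x $ i) ^ \<alpha> i))"
    by (auto simp: polys_def)
  show ?thesis
    unfolding p of_real_prod of_real_power
    by (intro diff_lip_sum diff_lip_mult diff_lip_const diff_lip_prod diff_lip_power diff_lip_coordinate) simp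
qed

lemma polys_lincomb:
  assumes "p \<in> polys k" "q \<in> polys k" shows "(\<lambda>x. c * p x + q x) \<in> polys k"
proof -
  obtain a b where p: "p = (\<lambda>x. \<Sum>\<alpha> | sum \<alpha> UNIV \<le> k. a \<alpha> * of_real (\<Prod>i\<in>UNIV. (x $ i) ^ \<alpha> i))"
    and q: "q = (\<lambda>x. \<Sum>\<alpha> | sum \<alpha> UNIV \<le> k. b \<alpha> * of_real (\<Prod>i\<in>UNIV. (x $ i) ^ \<alpha> i))"
    using assms by (auto simp: polys_def)
  have "(\<lambda>x. c * p x + q x) = (\<lambda>x. \<Sum>\<alpha> | sum \<alpha> UNIV \<le> k. (c * a \<alpha> + b \<alpha>) * of_real (\<Prod>i\<in>UNIV. (x $ i) ^ \<alpha> i))"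
    by (simp add: p q sum_distrib_left sum.distrib distrib_right mult.assoc)
  then show ?thesis unfolding polys_def mem_Collect_eq by (rule exI[where x = "\<lambda>\<alpha>. c * a \<alpha> + b \<alpha>"])
qed

lemma finite_multi_indices: "finite {\<alpha> :: 'n::finite \<Rightarrow> nat. sum \<alpha> UNIV \<le> k}"
proof (rule finite_subset)
  show "{\<alpha> :: 'n \<Rightarrow> nat. sum \<alpha> UNIV \<le> k} \<subseteq> PiE UNIV (\<lambda>_. {..k})"
  proof
    fix \<alpha> :: "'n \<Rightarrow> nat" assume a: "\<alpha> \<in> {\<alpha>. sum \<alpha> UNIV \<le> k}"
    have "\<alpha> i \<le> sum \<alpha> UNIV" for i by (rule member_le_sum) auto
    then have "\<alpha> i \<le> k" for i using a order_trans[of "\<alpha> i" "sum \<alpha> UNIV" k] by simp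
    then show "\<alpha> \<in> PiE UNIV (\<lambda>_. {..k})" by auto
  qed
  show "finite (PiE (UNIV :: 'n set) (\<lambda>_. {..k}))" by (rule finite_PiE) auto
qed

text \<open>At a boundary point where the function is continuous up to the boundary, the mean
  deviation from \<open>z\<close> tends to the distance of \<open>z\<close> from the boundary value.\<close>

lemma has_trace_continuous_iff:
  fixes u :: "real ^ 'n \<Rightarrow> complex"
  assumes op: "open \<omega>" "bounded \<omega>" and cont: "continuous_on (closure \<omega>) u" and x: "x \<in> closure \<omega>"
  shows "has_trace \<omega> u x z \<longleftrightarrow> z = u x"
proof -
  let ?B = "\<lambda>r. ball x r \<inter> \<omega>"
  let ?A = "\<lambda>r. (LINT y|lebesgue_on (?B r). cmod (u y - z)) / measure lebesgue (?B r)"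
  have "bounded (u ` closure \<omega>)"
    using op(2) by (intro compact_imp_bounded compact_continuous_image cont) simp
  then obtain M where M: "\<And>y. y \<in> closure \<omega> \<Longrightarrow> norm (u y) \<le> M" by (auto simp: bounded_iff)
  have lim: "(?A \<longlongrightarrow> cmod (u x - z)) (at_right 0)"
  proof (rule tendstoI)
    fix e :: real assume e: "0 < e"
    obtain d where d: "0 < d" "\<And>y. y \<in> closure \<omega> \<Longrightarrow> dist y x < d \<Longrightarrow> dist (u y) (u x) < e / 2"
      using cont x e unfolding continuous_on_iff by (metis half_gt_zero)
    have "\<forall>\<^sub>F r in at_right 0. r \<in> {0<..<d}" using d(1) by (rule eventually_at_right_real)
    then show "\<forall>\<^sub>F r in at_right 0. dist (?A r) (cmod (u x - z)) < e"
    proof eventually_elim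
      case (elim r)
      have oB: "open (?B r)" using op by auto
      have SB: "?B r \<in> sets lebesgue" using oB by auto
      have bB: "bounded (?B r)" using op by auto
      interpret B: finite_measure "lebesgue_on (?B r)" using bB SB by (rule finite_measure_lebesgue_on)
      have "?B r \<noteq> {}"
      proof -
        obtain y where "y \<in> \<omega>" "dist y x < r" using x elim unfolding closure_approachable by auto
        then have "y \<in> ?B r" by (simp add: dist_commute)
        then show ?thesis by blast
      qed
      then have "\<not> negligible (?B r)" using open_not_negligible[OF oB] by blast
      moreover have Bl: "?B r \<in> lmeasurable" using bounded_set_imp_lmeasurable[OF bB SB] .
      ultimately have mpos: "0 < measure lebesgue (?B r)"
        by (simp add: negligible_iff_measure0 zero_less_measure_iff)
      have mB: "measure (lebesgue_on (?B r)) (space (lebesgue_on (?B r))) = measure lebesgue (?B r)"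
        using SB by (simp add: measure_restrict_space)
      have int: "integrable (lebesgue_on (?B r)) (\<lambda>y. cmod (u y - z))"
      proof (rule B.integrable_const_bound[where B = "M + cmod z"])
        show "AE y in lebesgue_on (?B r). norm (cmod (u y - z)) \<le> M + cmod z"
        proof (rule AE_I2)
          fix y assume "y \<in> space (lebesgue_on (?B r))"
          then have "y \<in> closure \<omega>" using closure_subset by auto
          from M[OF this] show "norm (cmod (u y - z)) \<le> M + cmod z"
            using norm_triangle_ineq4[of "u y" z] by simp
        qed
        have "continuous_on (?B r) (\<lambda>y. cmod (u y - z))"
          using closure_subset by (intro continuous_intros continuous_on_subset[OF cont]) auto
        then show "(\<lambda>y. cmod (u y - z)) \<in> borel_measurable (lebesgue_on (?B r))"
          using SB by (rule continuous_imp_measurable_on_sets_lebesgue)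
      qed
      have near: "\<bar>cmod (u y - z) - cmod (u x - z)\<bar> \<le> e / 2" if "y \<in> ?B r" for y
      proof -
        have "y \<in> closure \<omega>" "dist y x < d" using that elim closure_subset by (auto simp: dist_commute)
        then have "norm (u y - u x) < e / 2" using d(2) by (simp add: dist_norm)
        moreover have "\<bar>cmod (u y - z) - cmod (u x - z)\<bar> \<le> cmod ((u y - z) - (u x - z))"
          by (rule norm_triangle_ineq3)
        ultimately show ?thesis by simp
      qed
      have "\<bar>(LINT y|lebesgue_on (?B r). cmod (u y - z) - cmod (u x - z))\<bar>
          \<le> (LINT y|lebesgue_on (?B r). e / 2)"
        using int near by (intro integral_abs_bound_integral) auto
      moreover have "(LINT y|lebesgue_on (?B r). cmod (u y - z) - cmod (u x - z))
          = (LINT y|lebesgue_on (?B r). cmod (u y - z)) - cmod (u x - z) * measure lebesgue (?B r)"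
        using int mB by simp
      ultimately have "\<bar>(LINT y|lebesgue_on (?B r). cmod (u y - z)) - cmod (u x - z) * measure lebesgue (?B r)\<bar>
          \<le> e / 2 * measure lebesgue (?B r)" using mB by (simp add: mult.commute)
      then have "\<bar>?A r - cmod (u x - z)\<bar> \<le> e / 2"
        using mpos by (simp add: abs_le_iff field_simps)
      then show ?case using e by (simp add: dist_real_def)
    qed
  qed
  show ?thesis
  proof
    assume "has_trace \<omega> u x z"
    then have "cmod (u x - z) = 0"
      unfolding has_trace_def using lim by (intro tendsto_unique[OF _ lim]) auto
    then show "z = u x" by simp
  next
    assume "z = u x" then show "has_trace \<omega> u x z" unfolding has_trace_def using lim by simp
  qed
qed

lemma bdry_trace_continuous:
  assumes "open \<omega>" "bounded \<omega>" "continuous_on (closure \<omega>) u" "x \<in> closure \<omega>"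
  shows "bdry_trace \<omega> u x = u x"
proof -
  have "has_trace \<omega> u x = (\<lambda>z. z = u x)"
    using has_trace_continuous_iff[OF assms] by (intro ext)
  then show ?thesis by (simp add: bdry_trace_def)
qed

lemma has_trace_cong:
  assumes "\<And>y. y \<in> \<omega> \<Longrightarrow> u y = v y" shows "has_trace \<omega> u = has_trace \<omega> v"
proof -
  have "(LINT y|lebesgue_on (ball x r \<inter> \<omega>). cmod (u y - z)) = (LINT y|lebesgue_on (ball x r \<inter> \<omega>). cmod (v y - z))"
    for x r z using assms by (intro Bochner_Integration.integral_cong) auto
  then show ?thesis by (intro ext) (simp add: has_trace_def)
qed

lemma bdry_trace_cong:
  assumes "\<And>y. y \<in> \<omega> \<Longrightarrow> u y = v y" shows "bdry_trace \<omega> u = bdry_trace \<omega> v"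
  by (intro ext) (simp add: bdry_trace_def has_trace_cong[OF assms])

lemma H1_cong:
  assumes "\<And>x. x \<in> \<omega> \<Longrightarrow> u x = v x" shows "u \<in> H1 \<omega> \<longleftrightarrow> v \<in> H1 \<omega>"
proof -
  have "u \<in> borel_measurable (lebesgue_on \<omega>) \<longleftrightarrow> v \<in> borel_measurable (lebesgue_on \<omega>)"
    using assms by (intro measurable_cong) auto
  moreover have "integrable (lebesgue_on \<omega>) (\<lambda>x. (norm (u x))\<^sup>2) \<longleftrightarrow> integrable (lebesgue_on \<omega>) (\<lambda>x. (norm (v x))\<^sup>2)"
    using assms by (intro Bochner_Integration.integrable_cong) auto
  ultimately show ?thesis by (simp add: H1_def L2_def weak_gradient_cong[of \<omega> u v, OF assms])
qed

lemma H1_norm_cong: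
  assumes "\<And>x. x \<in> \<omega> \<Longrightarrow> u x = v x" shows "H1_norm P \<omega> u = H1_norm P \<omega> v"
proof -
  have "(LINT x|lebesgue_on \<omega>. (cmod (u x))\<^sup>2) = (LINT x|lebesgue_on \<omega>. (cmod (v x))\<^sup>2)"
    using assms by (intro Bochner_Integration.integral_cong) auto
  then show ?thesis by (simp add: H1_norm_def grad_cong[of \<omega> u v, OF assms])
qed

lemma continuous_AE_zero_imp_zero:
  assumes op: "open \<omega>" and cont: "continuous_on \<omega> u"
    and AE: "AE x in lebesgue_on \<omega>. u x = (0::complex)" and x: "x \<in> \<omega>"
  shows "u x = 0"
proof (rule ccontr)
  let ?S = "\<omega> \<inter> u -` (- {0})"
  assume nz: "u x \<noteq> 0"
  have S: "open ?S" using op cont by (intro continuous_open_preimage) auto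
  have "\<omega> \<in> sets lebesgue" using op by auto
  then have "AE y\<in>\<omega> in lebesgue. u y = 0" using AE by (simp add: AE_restrict_space_iff)
  then have ae: "AE y\<in>?S in lebesgue. y \<in> {}" by (rule AE_mp) (rule AE_I2, simp)
  have "x \<in> ?S" using nz x by simp
  from mem_closed_if_AE_lebesgue_open[OF S closed_empty ae this] show False by simp
qed

section \<open>Conforming and broken finite element spaces\<close>

lemma sum_eq_single_term:
  assumes "finite A" "j \<in> A" "\<And>i. i \<in> A \<Longrightarrow> i \<noteq> j \<Longrightarrow> f i = 0"
  shows "sum f A = f j"
proof -
  have "sum f (A - {j}) = 0" using assms(3) by (intro sum.neutral) auto
  then show ?thesis using sum.remove[OF assms(1,2), of f] by simp
qed

lemma polyhedral_openD:
  assumes "polyhedral_open (U :: (real ^ 'm) set)"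
  shows "open U" "bounded U" "U \<noteq> {}" "U = interior (closure U)"
proof -
  show "U = interior (closure U)" "bounded U" "U \<noteq> {}"
    using assms by (simp_all add: polyhedral_open_def)
  then show "open U" by (metis open_interior)
qed

locale decomposed_domain =
  fixes P :: "'n::finite ddm"
  assumes setting: "setting P"
begin

abbreviation "\<Omega> \<equiv> omega P"
abbreviation "D \<equiv> subdom P"
abbreviation "J \<equiv> {1..nsub P}"

lemma polyhedral_omega: "polyhedral_open \<Omega>"
  using setting by (simp add: setting_def)

lemmas omega_open = polyhedral_openD(1)[OF polyhedral_omega]
  and omega_bounded = polyhedral_openD(2)[OF polyhedral_omega]
  and omega_nonempty = polyhedral_openD(3)[OF polyhedral_omega]

lemma polyhedral_subdom: "j \<in> J \<Longrightarrow> polyhedral_open (D j)"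
  using setting by (simp add: setting_def decomposition_def)

lemma subdom_open: "j \<in> J \<Longrightarrow> open (D j)"
  and subdom_bounded: "j \<in> J \<Longrightarrow> bounded (D j)"
  using polyhedral_subdom polyhedral_openD by blast+

lemma subdom_lebesgue: "j \<in> J \<Longrightarrow> D j \<in> sets lebesgue"
  using subdom_open by auto

lemma omega_lebesgue: "\<Omega> \<in> sets lebesgue"
  using omega_open by auto

lemma closure_omega: "closure \<Omega> = (\<Union>j\<in>J. closure (D j))"
  using setting by (simp add: setting_def decomposition_def)

lemma closure_subdom_subset: "j \<in> J \<Longrightarrow> closure (D j) \<subseteq> closure \<Omega>"
  unfolding closure_omega by blast

text \<open>An open subset of the closure of \<open>\<Omega>\<close> lies in \<open>\<Omega>\<close>, because \<open>\<Omega>\<close> has no slits.\<close>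

lemma subdom_subset: assumes j: "j \<in> J" shows "D j \<subseteq> \<Omega>"
proof -
  have "D j \<subseteq> closure \<Omega>" using closure_subset closure_subdom_subset[OF j] by blast
  then have "D j \<subseteq> interior (closure \<Omega>)" using subdom_open[OF j] by (rule interior_maximal)
  then show ?thesis using polyhedral_openD(4)[OF polyhedral_omega] by simp
qed

lemma subdom_disjoint: "i \<in> J \<Longrightarrow> j \<in> J \<Longrightarrow> i \<noteq> j \<Longrightarrow> D i \<inter> D j = {}"
  using setting by (simp add: setting_def decomposition_def disjoint_family_on_def)

lemma subdom_disjoint_closure:
  assumes ij: "i \<in> J" "j \<in> J" "i \<noteq> j" shows "D i \<inter> closure (D j) = {}"
  using subdom_disjoint[OF ij] subdom_open[OF ij(1)] open_Int_closure_eq_empty by blast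

lemma triangulation_cells: "triangulation (cells P)"
  using setting by (simp add: setting_def mesh_def)

lemma finite_cells: "finite (cells P)"
  using triangulation_cells by (simp add: triangulation_def)

lemma cell_simplex: "K \<in> cells P \<Longrightarrow> int CARD('n) simplex K"
  using setting by (simp add: setting_def mesh_def)

lemma cell_polytope: "K \<in> cells P \<Longrightarrow> polytope K"
  using cell_simplex simplex_imp_polytope by blast

lemma cell_closed_convex: "K \<in> cells P \<Longrightarrow> closed K \<and> convex K"
  using cell_polytope polytope_imp_closed polytope_imp_convex by blast

lemma cell_bounded: "K \<in> cells P \<Longrightarrow> bounded K"
  using cell_polytope polytope_imp_bounded by blast

lemma cell_interior: assumes "K \<in> cells P" shows "interior K \<noteq> {}"
proof -
  have ad: "aff_dim K = int DIM(real ^ 'n)"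
    using aff_dim_simplex[OF cell_simplex[OF assms]] by simp
  then have "K \<noteq> {}" by (auto simp: aff_dim_empty)
  then show ?thesis
    using interior_rel_interior_gen[of K] ad cell_closed_convex[OF assms] rel_interior_eq_empty by auto
qed

lemma Union_cells: "\<Union>(cells P) = closure \<Omega>"
  using setting by (simp add: setting_def mesh_def)

text \<open>The cells of the subdomains cover the mesh, and an interior point of a cell lies in no
  other cell, so no cell is left over.\<close>

lemma cell_in_subdomain:
  assumes K: "K \<in> cells P" shows "\<exists>j\<in>J. K \<subseteq> closure (D j)"
proof -
  obtain x where x: "x \<in> interior K" using cell_interior[OF K] by blast
  then have "x \<in> closure \<Omega>" using K interior_subset Union_cells by blast
  then obtain j where j: "j \<in> J" "x \<in> closure (D j)" using closure_omega by blast
  obtain \<K> where \<K>: "\<K> \<subseteq> cells P" "closure (D j) = \<Union>\<K>"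
    using setting j(1) unfolding setting_def decomposition_def by blast
  obtain K' where K': "K' \<in> \<K>" "x \<in> K'" using j(2) \<K>(2) by blast
  have KK: "K' \<in> cells P" using K' \<K> by blast
  have f1: "(K \<inter> K') face_of K" using triangulation_cells K KK by (simp add: triangulation_def)
  have "(K' \<inter> K) face_of K'" using triangulation_cells K KK by (simp add: triangulation_def)
  then have f2: "(K \<inter> K') face_of K'" by (simp only: Int_commute)
  have "K \<inter> K' = K"
    using face_of_disjoint_interior[OF f1] x K'(2) interior_subset by blast
  moreover have "K \<inter> K' = K'"
  proof (rule ccontr)
    assume "K \<inter> K' \<noteq> K'"
    then have "aff_dim (K \<inter> K') < aff_dim K'"
      using face_of_aff_dim_lt[OF _ f2] cell_closed_convex[OF KK] by blast
    with \<open>K \<inter> K' = K\<close> show False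
      using aff_dim_simplex[OF cell_simplex[OF K]] aff_dim_simplex[OF cell_simplex[OF KK]] by simp
  qed
  ultimately show ?thesis using K'(1) \<K>(2) j(1) by blast
qed

lemma Vh_cont: "u \<in> Vh P \<Longrightarrow> continuous_on (closure \<Omega>) u"
  and Vh_outside: "u \<in> Vh P \<Longrightarrow> x \<notin> closure \<Omega> \<Longrightarrow> u x = 0"
  and Vh_cell: "u \<in> Vh P \<Longrightarrow> K \<in> cells P \<Longrightarrow> \<exists>p\<in>polys (deg P). \<forall>x\<in>K. u x = p x"
  by (auto simp: Vh_def)

lemma Vh_lincomb:
  assumes u: "u \<in> Vh P" and v: "v \<in> Vh P" shows "(\<lambda>x. c * u x + v x) \<in> Vh P"
proof -
  have "\<exists>p\<in>polys (deg P). \<forall>x\<in>K. c * u x + v x = p x" if K: "K \<in> cells P" for K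
  proof -
    obtain p q where "p \<in> polys (deg P)" "q \<in> polys (deg P)" "\<forall>x\<in>K. u x = p x" "\<forall>x\<in>K. v x = q x"
      using Vh_cell[OF u K] Vh_cell[OF v K] by blast
    then show ?thesis by (intro bexI[of _ "\<lambda>x. c * p x + q x"] polys_lincomb) auto
  qed
  moreover have "continuous_on (closure \<Omega>) (\<lambda>x. c * u x + v x)"
    using Vh_cont[OF u] Vh_cont[OF v] by (intro continuous_intros)
  ultimately show ?thesis using Vh_outside[OF u] Vh_outside[OF v] by (auto simp: Vh_def)
qed

lemma Vh_0: "0 \<in> Vh P"
proof -
  have "(\<lambda>_. 0) \<in> polys (deg P)" unfolding polys_def by (auto intro!: exI[of _ "\<lambda>_. 0"])
  then show ?thesis by (auto simp: Vh_def zero_fun_def intro!: bexI[of _ "\<lambda>_. 0"])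
qed

lemma Vh_bounded: "u \<in> Vh P \<Longrightarrow> bounded (u ` closure \<Omega>)"
  using omega_bounded by (intro compact_imp_bounded compact_continuous_image Vh_cont) auto

text \<open>There are finitely many cells, so one Lipschitz constant serves all of them.\<close>

lemma Vh_H1:
  assumes u: "u \<in> Vh P" and op: "open \<omega>" and sub: "\<omega> \<subseteq> \<Omega>"
  shows "u \<in> H1 \<omega>"
proof -
  have "\<exists>L\<ge>0. \<forall>K\<in>cells P. L-lipschitz_on K u"
  proof -
    have "\<exists>L. L-lipschitz_on K u" if K: "K \<in> cells P" for K
    proof -
      obtain p where p: "p \<in> polys (deg P)" "\<forall>x\<in>K. u x = p x" using Vh_cell[OF u K] by blast
      obtain L where "L-lipschitz_on K p"
        using diff_lip_polys[OF p(1)] cell_bounded[OF K] unfolding diff_lip_def by blast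
      then have "L-lipschitz_on K u" by (rule lipschitz_on_transform) (use p(2) in auto)
      then show ?thesis ..
    qed
    then obtain L where L: "\<And>K. K \<in> cells P \<Longrightarrow> (L K)-lipschitz_on K u" by metis
    define M where "M = (\<Sum>K\<in>cells P. L K)"
    have L0: "0 \<le> L K" if "K \<in> cells P" for K using L[OF that] by (rule lipschitz_on_nonneg)
    have "M-lipschitz_on K u" if "K \<in> cells P" for K
    proof (rule lipschitz_on_mono[OF L[OF that]])
      show "L K \<le> M" unfolding M_def using that finite_cells L0 by (intro member_le_sum) auto
    qed simp
    moreover have "0 \<le> M" unfolding M_def using L0 by (rule sum_nonneg)
    ultimately show ?thesis by blast
  qed
  then obtain L where L: "0 \<le> L" "\<And>K. K \<in> cells P \<Longrightarrow> L-lipschitz_on K u" by blast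
  have sub': "\<omega> \<subseteq> closure \<Omega>" using sub closure_subset by blast
  show ?thesis
  proof (rule piecewise_lipschitz_H1[where \<K> = "cells P" and L = L])
    show "bounded \<omega>" using omega_bounded sub by (rule bounded_subset)
    show "\<omega> \<subseteq> \<Union>(cells P)" using sub' Union_cells by simp
    show "continuous_on \<omega> u" using Vh_cont[OF u] sub' by (rule continuous_on_subset)
    show "bounded (u ` \<omega>)" using Vh_bounded[OF u] image_mono[OF sub'] by (rule bounded_subset)
    show "L-lipschitz_on (K \<inter> \<omega>) u" if "K \<in> cells P" for K
      using L(2)[OF that] by (rule lipschitz_on_subset) simp
    show "u differentiable (at x)" if K: "K \<in> cells P" and x: "x \<in> interior K" for K x
    proof -
      obtain p where p: "p \<in> polys (deg P)" "\<forall>x\<in>K. u x = p x" using Vh_cell[OF u K] by blast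
      then obtain p' where "(p has_derivative p') (at x)"
        using diff_lip_polys[OF p(1)] unfolding diff_lip_def differentiable_def by blast
      then have "(u has_derivative p') (at x)"
        by (rule has_derivative_transform_within_open[OF _ open_interior x])
           (use p(2) interior_subset[of K] in auto)
      then show ?thesis by (auto simp: differentiable_def)
    qed
  qed (use L op finite_cells cell_closed_convex in auto)
qed

text \<open>For finite element functions the trace from inside a subdomain is the value of the continuous
  representative of that subdomain.\<close>

lemma trace_Vh:
  assumes u: "u \<in> Vh P" and j: "j \<in> J" and w: "\<And>x. x \<in> D j \<Longrightarrow> w x = u x"
    and x: "x \<in> closure (D j)"
  shows "bdry_trace (D j) w x = u x"
proof -
  have "bdry_trace (D j) w x = bdry_trace (D j) u x" by (simp add: bdry_trace_cong[OF w])
  also have "\<dots> = u x"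
    using Vh_cont[OF u] closure_subdom_subset[OF j]
    by (intro bdry_trace_continuous subdom_open[OF j] subdom_bounded[OF j] x) (rule continuous_on_subset)
  finally show ?thesis .
qed

lemma broken_VhE:
  assumes "w \<in> broken_Vh P"
  obtains U where "\<And>j. j \<in> J \<Longrightarrow> U j \<in> Vh P" "\<And>j x. j \<in> J \<Longrightarrow> x \<in> D j \<Longrightarrow> w x = U j x"
    "\<And>x. x \<notin> (\<Union>j\<in>J. D j) \<Longrightarrow> w x = 0"
proof -
  have "\<exists>U. U \<in> Vh P \<and> restr (D j) w = restr (D j) U" if "j \<in> J" for j
    using assms that by (auto simp: broken_Vh_def Vh_sub_def)
  then obtain U where U: "\<And>j. j \<in> J \<Longrightarrow> U j \<in> Vh P" "\<And>j. j \<in> J \<Longrightarrow> restr (D j) w = restr (D j) (U j)"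
    by metis
  have "w x = U j x" if "j \<in> J" "x \<in> D j" for j x
    using fun_cong[OF U(2)[OF that(1)], of x] that(2) by (simp add: restr_def)
  moreover have "w x = 0" if "x \<notin> (\<Union>j\<in>J. D j)" for x
    using assms that by (simp add: broken_Vh_def)
  ultimately show ?thesis using that U(1) by blast
qed

lemma broken_VhI:
  assumes U: "\<And>j. j \<in> J \<Longrightarrow> U j \<in> Vh P" and w: "\<And>j x. j \<in> J \<Longrightarrow> x \<in> D j \<Longrightarrow> w x = U j x"
    and out: "\<And>x. x \<notin> (\<Union>j\<in>J. D j) \<Longrightarrow> w x = 0"
  shows "w \<in> broken_Vh P"
proof -
  have w_eq: "w = (\<lambda>x. \<Sum>j\<in>J. indicat_real (D j) x *\<^sub>R U j x)"
  proof
    fix x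
    show "w x = (\<Sum>j\<in>J. indicat_real (D j) x *\<^sub>R U j x)"
    proof (cases "\<exists>j\<in>J. x \<in> D j")
      case True
      then obtain j where j: "j \<in> J" "x \<in> D j" by blast
      have "x \<notin> D i" if "i \<in> J" "i \<noteq> j" for i using subdom_disjoint[of i j] j that by blast
      then have "(\<Sum>i\<in>J. indicat_real (D i) x *\<^sub>R U i x) = indicat_real (D j) x *\<^sub>R U j x"
        using j(1) by (intro sum_eq_single_term) simp_all
      then show ?thesis using j(2) w[OF j] by simp
    next
      case False
      then have "(\<Sum>j\<in>J. indicat_real (D j) x *\<^sub>R U j x) = 0" by (intro sum.neutral) auto
      then show ?thesis using False out[of x] by simp
    qed
  qed
  have "w \<in> borel_measurable borel"
    unfolding w_eq
  proof (intro borel_measurable_sum borel_measurable_continuous_on_indicator)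
    fix j assume j: "j \<in> J"
    show "D j \<in> sets borel" using subdom_open[OF j] by simp
    show "continuous_on (D j) (U j)"
      using Vh_cont[OF U[OF j]] subdom_subset[OF j] closure_subset by (blast intro: continuous_on_subset)
  qed
  then have meas: "w \<in> borel_measurable (lebesgue_on \<Omega>)" by (rule borel_imp_lebesgue_on_measurable)
  have "\<exists>B. \<forall>x\<in>closure \<Omega>. norm (U j x) \<le> B" if "j \<in> J" for j
    using Vh_bounded[OF U[OF that]] by (auto simp: bounded_iff)
  then obtain B where B: "\<And>j x. j \<in> J \<Longrightarrow> x \<in> closure \<Omega> \<Longrightarrow> norm (U j x) \<le> B j" by metis
  have Uclose: "norm (w x) \<le> (\<Sum>j\<in>J. \<bar>B j\<bar>)" for x
  proof (cases "\<exists>j\<in>J. x \<in> D j")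
    case True
    then obtain j where j: "j \<in> J" "x \<in> D j" by blast
    have "x \<in> closure \<Omega>" using j subdom_subset closure_subset by blast
    then have "norm (w x) \<le> \<bar>B j\<bar>" using B[OF j(1), of x] w[OF j] by simp
    also have "\<dots> \<le> (\<Sum>j\<in>J. \<bar>B j\<bar>)" using j(1) by (intro member_le_sum) auto
    finally show ?thesis .
  next
    case False
    then have "w x = 0" using out by blast
    then show ?thesis by (simp add: sum_nonneg)
  qed
  have "w \<in> L2 \<Omega>"
    by (rule bounded_measurable_L2[OF meas _ omega_bounded omega_lebesgue]) (rule AE_I2, rule Uclose)
  moreover have "restr (D j) w \<in> Vh_sub P j" if j: "j \<in> J" for j
  proof -
    have "restr (D j) w = restr (D j) (U j)" using w[OF j] by (auto simp: restr_def)
    then show ?thesis using U[OF j] by (simp add: Vh_sub_def)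
  qed
  ultimately show ?thesis using out by (simp add: broken_Vh_def)
qed

lemma broken_Vh_lincomb:
  assumes u: "u \<in> broken_Vh P" and v: "v \<in> broken_Vh P"
  shows "(\<lambda>x. c * u x + v x) \<in> broken_Vh P"
proof -
  obtain U where U: "\<And>j. j \<in> J \<Longrightarrow> U j \<in> Vh P" "\<And>j x. j \<in> J \<Longrightarrow> x \<in> D j \<Longrightarrow> u x = U j x"
      "\<And>x. x \<notin> (\<Union>j\<in>J. D j) \<Longrightarrow> u x = 0" using broken_VhE[OF u] by metis
  obtain V where V: "\<And>j. j \<in> J \<Longrightarrow> V j \<in> Vh P" "\<And>j x. j \<in> J \<Longrightarrow> x \<in> D j \<Longrightarrow> v x = V j x"
      "\<And>x. x \<notin> (\<Union>j\<in>J. D j) \<Longrightarrow> v x = 0" using broken_VhE[OF v] by metis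
  show ?thesis
    by (rule broken_VhI[where U = "\<lambda>j x. c * U j x + V j x"])
       (use U V in \<open>auto intro: Vh_lincomb\<close>)
qed

lemma broken_Vh_0: "0 \<in> broken_Vh P"
  by (rule broken_VhI[where U = "\<lambda>_. 0"]) (auto simp: Vh_0)

text \<open>The broken function that agrees with a given one inside the subdomains.  Conforming functions live
  on the closed domain, whereas broken ones vanish on the skeleton.\<close>

definition broken :: "(real ^ 'n \<Rightarrow> complex) \<Rightarrow> real ^ 'n \<Rightarrow> complex" where
  "broken z = restr (\<Union>j\<in>J. D j) z"

lemma broken_eq: "j \<in> J \<Longrightarrow> x \<in> D j \<Longrightarrow> broken z x = z x"
  by (auto simp: broken_def restr_def)

lemma broken_in: "z \<in> Vh P \<Longrightarrow> broken z \<in> broken_Vh P"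
  by (rule broken_VhI[where U = "\<lambda>_. z"]) (auto simp: broken_def restr_def)

lemma broken_Vh_H1: assumes w: "w \<in> broken_Vh P" and j: "j \<in> J" shows "w \<in> H1 (D j)"
proof -
  obtain U where U: "\<And>j. j \<in> J \<Longrightarrow> U j \<in> Vh P" "\<And>j x. j \<in> J \<Longrightarrow> x \<in> D j \<Longrightarrow> w x = U j x"
    using broken_VhE[OF w] by metis
  show ?thesis
    using Vh_H1[OF U(1)[OF j] subdom_open[OF j] subdom_subset[OF j]] H1_cong[of "D j" w "U j"] U(2)[OF j]
    by blast
qed

lemma broken_Vh_broken_H1: "w \<in> broken_Vh P \<Longrightarrow> w \<in> broken_H1 P"
  using broken_Vh_H1 by (auto simp: broken_H1_def broken_Vh_def)

lemma skel_eq: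
  assumes "j \<in> J" "U \<in> Vh P" "\<And>x. x \<in> D j \<Longrightarrow> w x = U x"
  shows "skel P w j = restr (frontier (D j)) U"
  using trace_Vh[OF assms(2,1,3)] assms(1)
  by (auto simp: skel_def restr_def fun_eq_iff frontier_def)

lemma skel_cong:
  assumes "\<And>j x. j \<in> J \<Longrightarrow> x \<in> D j \<Longrightarrow> u x = v x" shows "skel P u = skel P v"
proof
  fix j show "skel P u j = skel P v j"
    using bdry_trace_cong[of "D j" u v] assms[of j] by (cases "j \<in> J") (auto simp: skel_def)
qed

lemma skel_broken: "skel P (broken z) = skel P z"
  by (rule skel_cong) (rule broken_eq)

lemma skel_in_multi: assumes w: "w \<in> broken_Vh P" shows "skel P w \<in> Vh_multi P"
proof -
  obtain U where U: "\<And>j. j \<in> J \<Longrightarrow> U j \<in> Vh P" "\<And>j x. j \<in> J \<Longrightarrow> x \<in> D j \<Longrightarrow> w x = U j x"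
    using broken_VhE[OF w] by metis
  have "skel P w j \<in> Vh_bdry P j" if "j \<in> J" for j
    using skel_eq[OF that U(1)[OF that] U(2)[OF that]] U(1)[OF that] by (simp add: Vh_bdry_def)
  then show ?thesis by (auto simp: Vh_multi_def skel_def)
qed

lemma Vh_single_subset: "Vh_single P \<subseteq> Vh_multi P"
proof
  fix q assume "q \<in> Vh_single P"
  then obtain z where "z \<in> Vh P" "q = skel P z" by (auto simp: Vh_single_def)
  then show "q \<in> Vh_multi P" using skel_in_multi[OF broken_in] skel_broken by metis
qed

lemma skel_lincomb:
  assumes u: "u \<in> broken_Vh P" and v: "v \<in> broken_Vh P"
  shows "skel P (\<lambda>x. c * u x + v x) = tuple_scale c (skel P u) + skel P v"
proof
  fix j
  obtain U where U: "\<And>j. j \<in> J \<Longrightarrow> U j \<in> Vh P" "\<And>j x. j \<in> J \<Longrightarrow> x \<in> D j \<Longrightarrow> u x = U j x"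
    using broken_VhE[OF u] by metis
  obtain V where V: "\<And>j. j \<in> J \<Longrightarrow> V j \<in> Vh P" "\<And>j x. j \<in> J \<Longrightarrow> x \<in> D j \<Longrightarrow> v x = V j x"
    using broken_VhE[OF v] by metis
  show "skel P (\<lambda>x. c * u x + v x) j = (tuple_scale c (skel P u) + skel P v) j"
  proof (cases "j \<in> J")
    case True
    have "skel P (\<lambda>x. c * u x + v x) j = restr (frontier (D j)) (\<lambda>x. c * U j x + V j x)"
      using U(2)[OF True] V(2)[OF True] by (intro skel_eq True Vh_lincomb U V) auto
    then show ?thesis
      using skel_eq[OF True U(1)[OF True] U(2)[OF True]] skel_eq[OF True V(1)[OF True] V(2)[OF True]]
      by (auto simp: tuple_scale_def restr_def fun_eq_iff)
  next
    case False
    then show ?thesis by (auto simp: skel_def tuple_scale_def fun_eq_iff)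
  qed
qed

lemma broken_patch:
  assumes U: "\<And>j. j \<in> J \<Longrightarrow> U j \<in> Vh P"
  shows "\<exists>w\<in>broken_Vh P. \<forall>j\<in>J. \<forall>x\<in>D j. w x = U j x"
proof -
  define w where "w x = (if \<exists>j\<in>J. x \<in> D j then U (THE j. j \<in> J \<and> x \<in> D j) x else 0)" for x
  have wU: "w x = U j x" if "j \<in> J" "x \<in> D j" for j x
  proof -
    have "(THE j. j \<in> J \<and> x \<in> D j) = j"
    proof (rule the_equality)
      show "i = j" if i: "i \<in> J \<and> x \<in> D i" for i
        using subdom_disjoint[of i j] i \<open>j \<in> J\<close> \<open>x \<in> D j\<close> by blast
    qed (use that in blast)
    then show ?thesis using that by (auto simp: w_def)
  qed
  have "w \<in> broken_Vh P" by (rule broken_VhI[OF U wU]) (auto simp: w_def)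
  then show ?thesis using wU by blast
qed

lemma skel_surj:
  assumes q: "q \<in> Vh_multi P" shows "\<exists>w\<in>broken_Vh P. skel P w = q"
proof -
  have "\<exists>U. U \<in> Vh P \<and> q j = restr (frontier (D j)) U" if "j \<in> J" for j
    using q that by (auto simp: Vh_multi_def Vh_bdry_def)
  then obtain U where U: "\<And>j. j \<in> J \<Longrightarrow> U j \<in> Vh P" "\<And>j. j \<in> J \<Longrightarrow> q j = restr (frontier (D j)) (U j)"
    by metis
  obtain w where w: "w \<in> broken_Vh P" "\<And>j x. j \<in> J \<Longrightarrow> x \<in> D j \<Longrightarrow> w x = U j x"
    using broken_patch[of U] U(1) by blast
  have "skel P w = q"
  proof
    fix j show "skel P w j = q j"
      using skel_eq[OF _ U(1) w(2), of j] U(2)[of j] q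
      by (cases "j \<in> J") (auto simp: skel_def Vh_multi_def)
  qed
  then show ?thesis using w(1) by blast
qed

text \<open>A broken function whose traces are single-valued glues to a conforming one: the closed
  subdomains overlap only in their boundaries, where the pieces agree.\<close>

lemma broken_glue:
  assumes w: "w \<in> broken_Vh P" and s: "skel P w \<in> Vh_single P"
  shows "\<exists>z\<in>Vh P. \<forall>j\<in>J. \<forall>x\<in>D j. w x = z x"
proof -
  obtain U where U: "\<And>j. j \<in> J \<Longrightarrow> U j \<in> Vh P" "\<And>j x. j \<in> J \<Longrightarrow> x \<in> D j \<Longrightarrow> w x = U j x"
    using broken_VhE[OF w] by metis
  obtain z where z: "z \<in> Vh P" "skel P w = skel P z" using s by (auto simp: Vh_single_def)
  have Uz: "U j x = z x" if j: "j \<in> J" and x: "x \<in> frontier (D j)" for j x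
  proof -
    have "restr (frontier (D j)) (U j) = restr (frontier (D j)) z"
      using skel_eq[OF j U(1)[OF j] U(2)[OF j]] skel_eq[OF j z(1) refl] z(2) by simp
    from fun_cong[OF this, of x] show ?thesis using x by (simp add: restr_def)
  qed
  have agree: "U i x = U j x" if ij: "i \<in> J" "j \<in> J" and x: "x \<in> closure (D i)" "x \<in> closure (D j)" for i j x
  proof (cases "i = j")
    case False
    have "x \<in> frontier (D i)"
      using x subdom_disjoint_closure[OF ij False] subdom_open[OF ij(1)]
      by (auto simp: frontier_def interior_open)
    moreover have "x \<in> frontier (D j)"
      using x subdom_disjoint_closure[OF ij(2,1)] False subdom_open[OF ij(2)]
      by (auto simp: frontier_def interior_open)
    ultimately show ?thesis using Uz ij by simp
  qed simp
  define y where "y x = (if \<exists>j\<in>J. x \<in> closure (D j) then U (SOME j. j \<in> J \<and> x \<in> closure (D j)) x else 0)" for x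
  have yU: "y x = U j x" if j: "j \<in> J" "x \<in> closure (D j)" for j x
  proof -
    have "\<exists>j. j \<in> J \<and> x \<in> closure (D j)" using j by blast
    from someI_ex[OF this] have "U (SOME j. j \<in> J \<and> x \<in> closure (D j)) x = U j x"
      using j by (intro agree) auto
    then show ?thesis using j by (auto simp: y_def)
  qed
  have "continuous_on (\<Union>j\<in>J. closure (D j)) y"
  proof (rule continuous_on_closed_Union)
    fix j assume j: "j \<in> J"
    have "continuous_on (closure (D j)) (U j)"
      using Vh_cont[OF U(1)[OF j]] closure_subdom_subset[OF j] by (rule continuous_on_subset)
    then show "continuous_on (closure (D j)) y"
      by (rule continuous_on_eq) (simp add: yU[OF j])
  qed auto
  then have "continuous_on (closure \<Omega>) y" by (simp add: closure_omega)
  moreover have "\<exists>p\<in>polys (deg P). \<forall>x\<in>K. y x = p x" if K: "K \<in> cells P" for K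
  proof -
    obtain j where j: "j \<in> J" "K \<subseteq> closure (D j)" using cell_in_subdomain[OF K] by blast
    obtain p where "p \<in> polys (deg P)" "\<forall>x\<in>K. U j x = p x" using Vh_cell[OF U(1)[OF j(1)] K] by blast
    then show ?thesis using yU[OF j(1)] j(2) by (intro bexI[of _ p]) auto
  qed
  moreover have "y x = 0" if "x \<notin> closure \<Omega>" for x using that by (auto simp: y_def closure_omega)
  ultimately have "y \<in> Vh P" by (simp add: Vh_def)
  moreover have "w x = y x" if "j \<in> J" "x \<in> D j" for j x
    using U(2)[OF that] yU[OF that(1), of x] closure_subset[of "D j"] that(2) by auto
  ultimately show ?thesis by blast
qed

text \<open>The broken space contains one representative of each class modulo null sets, since its elements
  are continuous inside the subdomains and vanish on the skeleton.\<close>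

lemma broken_Vh_AE_zero:
  assumes w: "w \<in> broken_Vh P" and z: "\<And>j. j \<in> J \<Longrightarrow> AE x in lebesgue_on (D j). w x = 0"
  shows "w = 0"
proof
  fix x
  obtain U where U: "\<And>j. j \<in> J \<Longrightarrow> U j \<in> Vh P" "\<And>j x. j \<in> J \<Longrightarrow> x \<in> D j \<Longrightarrow> w x = U j x"
      "\<And>x. x \<notin> (\<Union>j\<in>J. D j) \<Longrightarrow> w x = 0"
    using broken_VhE[OF w] by metis
  show "w x = 0 x"
  proof (cases "x \<in> (\<Union>j\<in>J. D j)")
    case True
    then obtain j where j: "j \<in> J" "x \<in> D j" by blast
    have "continuous_on (D j) (U j)"
      using Vh_cont[OF U(1)[OF j(1)]] subdom_subset[OF j(1)] closure_subset by (blast intro: continuous_on_subset)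
    then have "continuous_on (D j) w"
      by (rule continuous_on_eq) (simp add: U(2)[OF j(1)])
    then show ?thesis
      using continuous_AE_zero_imp_zero[OF subdom_open[OF j(1)] _ z[OF j(1)] j(2)] by simp
  qed (simp add: U(3))
qed

text \<open>Assigning to every point one cell that contains it splits a finite element function into
  finitely many monomials, each cut off to the points of one cell.\<close>

lemma broken_Vh_finite_span:
  "\<exists>B. finite B \<and> (\<forall>w\<in>broken_Vh P. \<exists>c. w = (\<lambda>x. \<Sum>b\<in>B. c b * b x))"
proof -
  define cell where "cell x = (SOME K. K \<in> cells P \<and> x \<in> K)" for x
  define A where "A = {\<alpha> :: 'n \<Rightarrow> nat. sum \<alpha> UNIV \<le> deg P}"
  define I where "I = J \<times> cells P \<times> A"
  define e where "e = (\<lambda>(j, K, \<alpha>) x. if x \<in> D j \<and> cell x = K then complex_of_real (\<Prod>i\<in>UNIV. (x $ i) ^ \<alpha> i) else 0)"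
  have finI: "finite I"
    unfolding I_def A_def using finite_cells finite_multi_indices by (intro finite_cartesian_product) auto
  have span: "\<exists>c. w = (\<lambda>x. \<Sum>t\<in>I. c t * e t x)" if w: "w \<in> broken_Vh P" for w
  proof -
    obtain U where U: "\<And>j. j \<in> J \<Longrightarrow> U j \<in> Vh P" "\<And>j x. j \<in> J \<Longrightarrow> x \<in> D j \<Longrightarrow> w x = U j x"
        "\<And>x. x \<notin> (\<Union>j\<in>J. D j) \<Longrightarrow> w x = 0"
      using broken_VhE[OF w] by metis
    define Q where "Q j K d \<longleftrightarrow> (\<forall>x\<in>K. U j x = (\<Sum>\<alpha>\<in>A. d \<alpha> * of_real (\<Prod>i\<in>UNIV. (x $ i) ^ \<alpha> i)))"
      for j K and d :: "('n \<Rightarrow> nat) \<Rightarrow> complex"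
    define c where "c j K = (SOME d. Q j K d)" for j K
    have c: "U j x = (\<Sum>\<alpha>\<in>A. c j K \<alpha> * of_real (\<Prod>i\<in>UNIV. (x $ i) ^ \<alpha> i))"
      if "j \<in> J" "K \<in> cells P" "x \<in> K" for j K x
    proof -
      have "\<exists>d. Q j K d"
        using Vh_cell[OF U(1)[OF that(1)] that(2)] unfolding polys_def A_def Q_def by auto
      then have "Q j K (c j K)" unfolding c_def by (rule someI_ex)
      then show ?thesis using that(3) by (simp add: Q_def)
    qed
    have "w x = (\<Sum>t\<in>I. (case t of (j, K, \<alpha>) \<Rightarrow> c j K \<alpha>) * e t x)" for x
    proof -
      have "(\<Sum>t\<in>I. (case t of (j, K, \<alpha>) \<Rightarrow> c j K \<alpha>) * e t x)
          = (\<Sum>j\<in>J. \<Sum>K\<in>cells P. \<Sum>\<alpha>\<in>A. c j K \<alpha> * e (j, K, \<alpha>) x)"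
        unfolding I_def by (simp add: sum.cartesian_product split_beta)
      also have "\<dots> = (\<Sum>j\<in>J. if x \<in> D j then U j x else 0)"
      proof (rule sum.cong[OF refl])
        fix j assume j: "j \<in> J"
        show "(\<Sum>K\<in>cells P. \<Sum>\<alpha>\<in>A. c j K \<alpha> * e (j, K, \<alpha>) x) = (if x \<in> D j then U j x else 0)"
        proof (cases "x \<in> D j")
          case True
          then have "x \<in> closure \<Omega>" using subdom_subset[OF j] closure_subset by blast
          then have "\<exists>K. K \<in> cells P \<and> x \<in> K" using Union_cells by blast
          then have K: "cell x \<in> cells P" "x \<in> cell x" unfolding cell_def by (metis (mono_tags, lifting) someI_ex)+
          have "(\<Sum>K\<in>cells P. \<Sum>\<alpha>\<in>A. c j K \<alpha> * e (j, K, \<alpha>) x)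
              = (\<Sum>K\<in>cells P. if K = cell x then (\<Sum>\<alpha>\<in>A. c j K \<alpha> * of_real (\<Prod>i\<in>UNIV. (x $ i) ^ \<alpha> i)) else 0)"
            using True by (intro sum.cong) (auto simp: e_def)
          also have "\<dots> = U j x" using K finite_cells c[OF j K] by simp
          finally show ?thesis using True by simp
        next
          case False
          then show ?thesis by (simp add: e_def)
        qed
      qed
      also have "\<dots> = w x"
      proof (cases "\<exists>j\<in>J. x \<in> D j")
        case True
        then obtain j where j: "j \<in> J" "x \<in> D j" by blast
        have "x \<notin> D i" if "i \<in> J" "i \<noteq> j" for i using subdom_disjoint[of i j] j that by blast
        then have "(\<Sum>i\<in>J. if x \<in> D i then U i x else 0) = (if x \<in> D j then U j x else 0)"
          using j(1) by (intro sum_eq_single_term) simp_all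
        then show ?thesis using j(2) U(2)[OF j] by simp
      next
        case False
        then have "(\<Sum>j\<in>J. if x \<in> D j then U j x else 0) = 0" by (intro sum.neutral) auto
        then show ?thesis using False U(3)[of x] by simp
      qed
      finally show ?thesis by simp
    qed
    then show ?thesis by blast
  qed
  have "\<exists>c. w = (\<lambda>x. \<Sum>b\<in>e ` I. c b * b x)" if w: "w \<in> broken_Vh P" for w
  proof -
    obtain c where c: "w = (\<lambda>x. \<Sum>t\<in>I. c t * e t x)" using span[OF w] by blast
    have "w x = (\<Sum>b\<in>e ` I. (\<Sum>t\<in>{t\<in>I. e t = b}. c t) * b x)" for x
    proof -
      have "w x = (\<Sum>b\<in>e ` I. \<Sum>t\<in>{t\<in>I. e t = b}. c t * e t x)"
        unfolding c using sum.image_gen[OF finI, of "\<lambda>t. c t * e t x" e] by simp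
      also have "\<dots> = (\<Sum>b\<in>e ` I. (\<Sum>t\<in>{t\<in>I. e t = b}. c t) * b x)"
        by (intro sum.cong refl) (simp add: sum_distrib_right)
      finally show ?thesis .
    qed
    then show ?thesis by (intro exI[of _ "\<lambda>b. \<Sum>t\<in>{t\<in>I. e t = b}. c t"]) auto
  qed
  then show ?thesis using finI by (intro exI[of _ "e ` I"]) auto
qed

end

section \<open>The sesquilinear form on broken finite element functions\<close>

lemma esssup_finite_AE_bound:
  assumes "esssup M (\<lambda>x. ereal (f x)) < \<infinity>" shows "\<exists>C\<ge>0. AE x in M. f x \<le> C"
proof -
  obtain r where r: "esssup M (\<lambda>x. ereal (f x)) \<le> ereal r"
    using assms by (metis ereal_infty_less(1) less_PInf_Ex_of_nat less_imp_le ereal_less_eq(1))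
  have "AE x in M. ereal (f x) \<le> esssup M (\<lambda>x. ereal (f x))" by (rule esssup_AE)
  then have "AE x in M. f x \<le> max 0 r"
  proof eventually_elim
    case (elim x)
    then have "ereal (f x) \<le> ereal r" using r by (rule order_trans)
    then show ?case by simp
  qed
  then show ?thesis by (intro exI[of _ "max 0 r"]) simp
qed

lemma AE_lebesgue_on_subset:
  assumes "AE x in lebesgue_on T. Q x" "S \<subseteq> T" "S \<in> sets lebesgue" "T \<in> sets lebesgue"
  shows "AE x in lebesgue_on S. Q x"
  using assms by (auto simp: AE_restrict_space_iff elim!: eventually_mono)

lemma bounded_mult_integrable:
  fixes f g :: "'a \<Rightarrow> complex"
  assumes g: "integrable M g" and f: "f \<in> borel_measurable M" and b: "AE x in M. cmod (f x) \<le> C"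
  shows "integrable M (\<lambda>x. f x * g x)"
proof (rule Bochner_Integration.integrable_bound)
  show "integrable M (\<lambda>x. C * cmod (g x))" using g by simp
  show "(\<lambda>x. f x * g x) \<in> borel_measurable M" using f g by simp
  show "AE x in M. norm (f x * g x) \<le> norm (C * cmod (g x))"
    using b
  proof eventually_elim
    case (elim x)
    have "cmod (f x) * cmod (g x) \<le> \<bar>C\<bar> * cmod (g x)" using elim by (intro mult_right_mono) auto
    then show ?case by (simp add: norm_mult abs_mult)
  qed
qed

lemma surface_borel_sets: "A \<in> sets borel \<Longrightarrow> A \<in> sets surface_measure"
  using borel_subset_hausdorff_measure unfolding surface_measure_def by blast

lemma surface_borel_measurable:
  fixes f :: "real ^ 'a \<Rightarrow> complex"
  shows "f \<in> borel_measurable borel \<Longrightarrow> f \<in> borel_measurable surface_measure"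
proof -
  have "sets borel \<subseteq> sets (surface_measure :: (real ^ 'a) measure)" using surface_borel_sets by blast
  then show "f \<in> borel_measurable borel \<Longrightarrow> f \<in> borel_measurable surface_measure"
    by (rule borel_measurable_subalgebra) (simp_all add: surface_measure_def)
qed

lemma H1_norm_nonneg [simp]: "0 \<le> H1_norm P \<omega> v"
  by (simp add: H1_norm_def)

lemma H1_norm_power2:
  "(H1_norm P \<omega> v)\<^sup>2 = (LINT x|lebesgue_on \<omega>. (norm (grad \<omega> v x))\<^sup>2)
     + (kappa_inf P)\<^sup>2 * (LINT x|lebesgue_on \<omega>. (cmod (v x))\<^sup>2)"
  unfolding H1_norm_def by (rule real_sqrt_pow2) (intro add_nonneg_nonneg mult_nonneg_nonneg, auto)

lemma kappa_inf_ge_1: "1 \<le> kappa_inf P"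
  by (simp add: kappa_inf_def)

lemma broken_norm_nonneg [simp]: "0 \<le> broken_norm P u"
  by (simp add: broken_norm_def sum_nonneg)

lemma broken_norm_power2: "(broken_norm P u)\<^sup>2 = (\<Sum>j = 1..nsub P. (H1_norm P (subdom P j) u)\<^sup>2)"
  unfolding broken_norm_def by (rule real_sqrt_pow2) (simp add: sum_nonneg)

lemma broken_norm_cong:
  assumes "\<And>j x. j \<in> {1..nsub P} \<Longrightarrow> x \<in> subdom P j \<Longrightarrow> u x = v x"
  shows "broken_norm P u = broken_norm P v"
proof -
  have "H1_norm P (subdom P j) u = H1_norm P (subdom P j) v" if "j \<in> {1..nsub P}" for j
    using assms[OF that] by (rule H1_norm_cong)
  then show ?thesis by (simp add: broken_norm_def)
qed

definition volume_integrand ::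
    "('n::finite) ddm \<Rightarrow> nat \<Rightarrow> (real ^ 'n \<Rightarrow> complex) \<Rightarrow> (real ^ 'n \<Rightarrow> complex) \<Rightarrow> real ^ 'n \<Rightarrow> complex" where
  "volume_integrand P j u v x =
     of_real (mu P x) * (\<Sum>i\<in>UNIV. grad (subdom P j) u x $ i * cnj (grad (subdom P j) v x $ i))
     - (kappa P x)\<^sup>2 * u x * cnj (v x)"

definition boundary_integrand ::
    "('n::finite) ddm \<Rightarrow> nat \<Rightarrow> (real ^ 'n \<Rightarrow> complex) \<Rightarrow> (real ^ 'n \<Rightarrow> complex) \<Rightarrow> real ^ 'n \<Rightarrow> complex" where
  "boundary_integrand P j u v x =
     indicat_real (frontier (subdom P j) \<inter> frontier (omega P)) x *\<^sub>R
       (kappa P x * bdry_trace (subdom P j) u x * cnj (bdry_trace (subdom P j) v x))"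

lemma form_alt:
  "form P u v = (\<Sum>j = 1..nsub P. (LINT x|lebesgue_on (subdom P j). volume_integrand P j u v x)
     - \<i> * (LINT x|surface_measure. boundary_integrand P j u v x))"
  by (simp add: form_def volume_integrand_def boundary_integrand_def set_lebesgue_integral_def)

lemma form_cong:
  assumes u: "\<And>j x. j \<in> {1..nsub P} \<Longrightarrow> x \<in> subdom P j \<Longrightarrow> u x = u' x"
    and v: "\<And>j x. j \<in> {1..nsub P} \<Longrightarrow> x \<in> subdom P j \<Longrightarrow> v x = v' x"
  shows "form P u v = form P u' v'"
  unfolding form_alt
proof (rule sum.cong[OF refl])
  fix j assume j: "j \<in> {1..nsub P}"
  have "(LINT x|lebesgue_on (subdom P j). volume_integrand P j u v x)
      = (LINT x|lebesgue_on (subdom P j). volume_integrand P j u' v' x)"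
    using u[OF j] v[OF j] grad_cong[of "subdom P j" u u', OF u[OF j]] grad_cong[of "subdom P j" v v', OF v[OF j]]
    by (intro Bochner_Integration.integral_cong) (auto simp: volume_integrand_def)
  moreover have "boundary_integrand P j u v = boundary_integrand P j u' v'"
    using bdry_trace_cong[of "subdom P j" u u', OF u[OF j]] bdry_trace_cong[of "subdom P j" v v', OF v[OF j]]
    by (intro ext) (simp add: boundary_integrand_def)
  ultimately show "(LINT x|lebesgue_on (subdom P j). volume_integrand P j u v x)
     - \<i> * (LINT x|surface_measure. boundary_integrand P j u v x)
     = (LINT x|lebesgue_on (subdom P j). volume_integrand P j u' v' x)
     - \<i> * (LINT x|surface_measure. boundary_integrand P j u' v' x)" by simp
qed

text \<open>A test function of the smaller set is one of the larger set.\<close>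

lemma weak_gradient_subset:
  assumes w: "weak_gradient T u g" and S: "S \<subseteq> T" "S \<in> sets lebesgue" "T \<in> sets lebesgue"
  shows "weak_gradient S u g"
  unfolding weak_gradient_iff
proof (intro allI impI)
  fix \<phi> G i assume t: "test_function S \<phi> G"
  have tT: "test_function T \<phi> G" using t S(1) by (auto simp: test_function_def)
  have sub: "closure {x. \<phi> x \<noteq> 0} \<subseteq> S" using t by (simp add: test_function_def)
  have eq: "(LINT x|lebesgue_on S. f x) = (LINT x|lebesgue_on T. f x)" if f: "\<And>x. x \<notin> S \<Longrightarrow> f x = 0"
    for f :: "real ^ 'a \<Rightarrow> complex"
  proof -
    have "f = (\<lambda>x. if x \<in> S then f x else 0)" using f by auto
    then have "(LINT x|lebesgue_on T. f x) = (LINT x|lebesgue_on T. (if x \<in> S then f x else 0))" by simp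
    also have "\<dots> = (LINT x|lebesgue_on S. f x)" using S by (rule integral_restrict)
    finally show ?thesis ..
  qed
  have out: "\<phi> x = 0" "G x = 0" if "x \<notin> S" for x
  proof -
    have nx: "x \<notin> closure {x. \<phi> x \<noteq> 0}" using that sub by blast
    then show "G x = 0" by (rule test_function_gradient_zero_outside[OF t])
    from nx have "x \<notin> {x. \<phi> x \<noteq> 0}" by (rule contra_subsetD[OF closure_subset])
    then show "\<phi> x = 0" by simp
  qed
  have "(LINT x|lebesgue_on S. u x * of_real (G x $ i)) = (LINT x|lebesgue_on T. u x * of_real (G x $ i))"
    by (rule eq) (simp add: out)
  also have "\<dots> = - (LINT x|lebesgue_on T. g x $ i * of_real (\<phi> x))"
    using w tT by (simp add: weak_gradient_iff)
  also have "(LINT x|lebesgue_on T. g x $ i * of_real (\<phi> x)) = (LINT x|lebesgue_on S. g x $ i * of_real (\<phi> x))"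
    by (rule eq[symmetric]) (simp add: out)
  finally show "(LINT x|lebesgue_on S. u x * of_real (G x $ i)) = - (LINT x|lebesgue_on S. g x $ i * of_real (\<phi> x))" .
qed

lemma L2_subset:
  assumes "f \<in> L2 T" "S \<subseteq> T" "S \<in> sets lebesgue" "T \<in> sets lebesgue"
  shows "f \<in> L2 S"
proof -
  have m: "f \<in> borel_measurable (lebesgue_on S)"
    using assms measurable_restrict_mono unfolding L2_def by blast
  moreover have "integrable (lebesgue_on S) (\<lambda>x. (norm (f x))\<^sup>2)"
  proof -
    have "integrable lebesgue (\<lambda>x. indicat_real T x *\<^sub>R (norm (f x))\<^sup>2)"
      using assms(1,4) by (simp add: L2_def integrable_restrict_space)
    then have "integrable lebesgue (\<lambda>x. indicat_real S x *\<^sub>R (indicat_real T x *\<^sub>R (norm (f x))\<^sup>2))"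
      by (rule integrable_mult_indicator[OF assms(3)])
    moreover have "(\<lambda>x. indicat_real S x *\<^sub>R (indicat_real T x *\<^sub>R (norm (f x))\<^sup>2))
        = (\<lambda>x. indicat_real S x *\<^sub>R (norm (f x))\<^sup>2)"
    proof
      fix x show "indicat_real S x *\<^sub>R (indicat_real T x *\<^sub>R (norm (f x))\<^sup>2) = indicat_real S x *\<^sub>R (norm (f x))\<^sup>2"
        using subsetD[OF assms(2), of x] by (cases "x \<in> S") simp_all
    qed
    ultimately show ?thesis using assms(3) by (simp add: integrable_restrict_space)
  qed
  ultimately show ?thesis by (simp add: L2_def)
qed

context decomposed_domain
begin

lemma coefficients: "coefficients P"
  using setting by (simp add: setting_def)

lemma kappa_sign: "x \<in> \<Omega> \<Longrightarrow> 0 \<le> Re (kappa P x) \<and> 0 \<le> Im (kappa P x)"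
  and kappa_frontier: "x \<in> frontier \<Omega> \<Longrightarrow> 0 \<le> Re (kappa P x) \<and> 0 \<le> Im (kappa P x) \<and> cmod (kappa P x) \<le> kappa_inf P"
  using coefficients by (auto simp: coefficients_def)

lemma kappa_subdom:
  assumes j: "j \<in> J"
  shows "kappa P \<in> borel_measurable (lebesgue_on (D j))" "\<exists>C\<ge>0. AE x in lebesgue_on (D j). cmod (kappa P x) \<le> C"
proof -
  show "kappa P \<in> borel_measurable (lebesgue_on (D j))"
    using coefficients measurable_restrict_mono[OF _ subdom_subset[OF j]] by (auto simp: coefficients_def)
  have "esssup (lebesgue_on \<Omega>) (\<lambda>x. ereal (cmod (kappa P x))) < \<infinity>"
    using coefficients by (simp add: coefficients_def)
  from esssup_finite_AE_bound[OF this] show "\<exists>C\<ge>0. AE x in lebesgue_on (D j). cmod (kappa P x) \<le> C"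
    using AE_lebesgue_on_subset[OF _ subdom_subset[OF j] subdom_lebesgue[OF j] omega_lebesgue] by blast
qed

lemma mu_subdom:
  assumes j: "j \<in> J"
  shows "mu P \<in> borel_measurable (lebesgue_on (D j))"
    "\<exists>C\<ge>0. AE x in lebesgue_on (D j). cmod (complex_of_real (mu P x)) \<le> C"
proof -
  show "mu P \<in> borel_measurable (lebesgue_on (D j))"
    using coefficients measurable_restrict_mono[OF _ subdom_subset[OF j]] by (auto simp: coefficients_def)
  have "esssup (lebesgue_on \<Omega>) (\<lambda>x. ereal (mu P x)) < \<infinity>"
    using coefficients by (simp add: coefficients_def)
  then obtain C where C: "0 \<le> C" "AE x in lebesgue_on \<Omega>. mu P x \<le> C"
    using esssup_finite_AE_bound by blast
  have "AE x in lebesgue_on (D j). mu P x \<le> C"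
    by (rule AE_lebesgue_on_subset[OF C(2) subdom_subset[OF j] subdom_lebesgue[OF j] omega_lebesgue])
  moreover have "AE x in lebesgue_on (D j). 0 < mu P x"
    using coefficients subdom_subset[OF j] by (intro AE_I2) (auto simp: coefficients_def)
  ultimately have "AE x in lebesgue_on (D j). cmod (complex_of_real (mu P x)) \<le> C"
    by eventually_elim simp
  then show "\<exists>C\<ge>0. AE x in lebesgue_on (D j). cmod (complex_of_real (mu P x)) \<le> C" using C(1) by blast
qed

lemma volume_integrable:
  assumes j: "j \<in> J" and u: "u \<in> H1 (D j)" and v: "v \<in> H1 (D j)"
  shows "integrable (lebesgue_on (D j)) (volume_integrand P j u v)"
proof -
  let ?M = "lebesgue_on (D j)"
  obtain C where C: "AE x in ?M. cmod (complex_of_real (mu P x)) \<le> C" using mu_subdom(2)[OF j] by blast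
  obtain B where B: "0 \<le> B" "AE x in ?M. cmod (kappa P x) \<le> B" using kappa_subdom(2)[OF j] by blast
  have "integrable ?M (\<lambda>x. \<Sum>i\<in>UNIV. grad (D j) u x $ i * cnj (grad (D j) v x $ i))"
    by (intro Bochner_Integration.integrable_sum L2_mult_integrable L2_cnj L2_component grad_props u v)
  then have 1: "integrable ?M (\<lambda>x. of_real (mu P x) * (\<Sum>i\<in>UNIV. grad (D j) u x $ i * cnj (grad (D j) v x $ i)))"
    by (rule bounded_mult_integrable[OF _ of_real_measurable[OF mu_subdom(1)[OF j]] C])
  have "integrable ?M (\<lambda>x. u x * cnj (v x))"
    using u v by (intro L2_mult_integrable L2_cnj) (auto simp: H1_def)
  moreover have "AE x in ?M. cmod ((kappa P x)\<^sup>2) \<le> B\<^sup>2"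
    using B(2) by eventually_elim (simp add: norm_power power_mono)
  ultimately have "integrable ?M (\<lambda>x. (kappa P x)\<^sup>2 * (u x * cnj (v x)))"
    using kappa_subdom(1)[OF j] by (intro bounded_mult_integrable[where f = "\<lambda>x. (kappa P x)\<^sup>2" and C = "B\<^sup>2"]) auto
  with 1 show ?thesis
    unfolding volume_integrand_def[abs_def] by (intro Bochner_Integration.integrable_diff) (auto simp: mult.assoc)
qed

lemma volume_linear_left:
  assumes j: "j \<in> J" and u: "u \<in> H1 (D j)" "u' \<in> H1 (D j)" and v: "v \<in> H1 (D j)"
  shows "(LINT x|lebesgue_on (D j). volume_integrand P j (\<lambda>x. c * u x + u' x) v x)
    = c * (LINT x|lebesgue_on (D j). volume_integrand P j u v x) + (LINT x|lebesgue_on (D j). volume_integrand P j u' v x)"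
proof -
  let ?M = "lebesgue_on (D j)"
  note H = H1_lincomb[OF u subdom_open[OF j] subdom_bounded[OF j], of c]
  note int = volume_integrable[OF j H(1) v] volume_integrable[OF j u(1) v] volume_integrable[OF j u(2) v]
  have "AE x in ?M. volume_integrand P j (\<lambda>x. c * u x + u' x) v x
      = c * volume_integrand P j u v x + volume_integrand P j u' v x"
    using H(2)
    by eventually_elim
       (simp add: volume_integrand_def distrib_right sum.distrib sum_distrib_left algebra_simps)
  then have "(LINT x|?M. volume_integrand P j (\<lambda>x. c * u x + u' x) v x)
      = (LINT x|?M. c * volume_integrand P j u v x + volume_integrand P j u' v x)"
    using int by (intro integral_cong_AE) auto
  then show ?thesis using int by simp
qed

lemma volume_linear_right:
  assumes j: "j \<in> J" and u: "u \<in> H1 (D j)" "u' \<in> H1 (D j)" and v: "v \<in> H1 (D j)"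
  shows "(LINT x|lebesgue_on (D j). volume_integrand P j v (\<lambda>x. c * u x + u' x) x)
    = cnj c * (LINT x|lebesgue_on (D j). volume_integrand P j v u x) + (LINT x|lebesgue_on (D j). volume_integrand P j v u' x)"
proof -
  let ?M = "lebesgue_on (D j)"
  note H = H1_lincomb[OF u subdom_open[OF j] subdom_bounded[OF j], of c]
  note int = volume_integrable[OF j v H(1)] volume_integrable[OF j v u(1)] volume_integrable[OF j v u(2)]
  have "AE x in ?M. volume_integrand P j v (\<lambda>x. c * u x + u' x) x
      = cnj c * volume_integrand P j v u x + volume_integrand P j v u' x"
    using H(2)
    by eventually_elim
       (simp add: volume_integrand_def distrib_left sum.distrib sum_distrib_left algebra_simps)
  then have "(LINT x|?M. volume_integrand P j v (\<lambda>x. c * u x + u' x) x)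
      = (LINT x|?M. cnj c * volume_integrand P j v u x + volume_integrand P j v u' x)"
    using int by (intro integral_cong_AE) auto
  then show ?thesis using int by simp
qed

lemma trace_lincomb:
  assumes j: "j \<in> J" and u: "u \<in> broken_Vh P" and v: "v \<in> broken_Vh P" and x: "x \<in> frontier (D j)"
  shows "bdry_trace (D j) (\<lambda>x. c * u x + v x) x = c * bdry_trace (D j) u x + bdry_trace (D j) v x"
  using fun_cong[OF fun_cong[OF skel_lincomb[OF u v, of c], of j], of x] j x
  by (simp add: skel_def restr_def tuple_scale_def)

text \<open>The traces are continuous on the boundary of the subdomain, which has finite surface measure.\<close>

lemma boundary_integrable:
  assumes j: "j \<in> J" and u: "u \<in> broken_Vh P" and v: "v \<in> broken_Vh P"
  shows "integrable surface_measure (boundary_integrand P j u v)"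
proof -
  obtain U where U: "U \<in> Vh P" "\<And>x. x \<in> D j \<Longrightarrow> u x = U x" using broken_VhE[OF u] j by metis
  obtain V where V: "V \<in> Vh P" "\<And>x. x \<in> D j \<Longrightarrow> v x = V x" using broken_VhE[OF v] j by metis
  let ?F = "frontier (D j)" and ?B = "frontier \<Omega>"
  have tr: "bdry_trace (D j) u x = U x" "bdry_trace (D j) v x = V x" if "x \<in> ?F" for x
    using that trace_Vh[OF U(1) j U(2)] trace_Vh[OF V(1) j V(2)] by (auto simp: frontier_def)
  have Fsub: "?F \<subseteq> closure \<Omega>" using closure_subdom_subset[OF j] by (auto simp: frontier_def)
  obtain BU where BU: "\<And>x. x \<in> closure \<Omega> \<Longrightarrow> cmod (U x) \<le> BU"
    using Vh_bounded[OF U(1)] by (auto simp: bounded_iff)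
  obtain BV where BV: "\<And>x. x \<in> closure \<Omega> \<Longrightarrow> cmod (V x) \<le> BV"
    using Vh_bounded[OF V(1)] by (auto simp: bounded_iff)
  have eq: "boundary_integrand P j u v
      = (\<lambda>x. (indicat_real ?B x *\<^sub>R kappa P x) * (indicat_real ?F x *\<^sub>R (U x * cnj (V x))))"
    using tr by (intro ext) (auto simp: boundary_integrand_def indicator_def)
  have "(\<lambda>x. indicat_real ?F x *\<^sub>R (U x * cnj (V x))) \<in> borel_measurable borel"
    using Vh_cont[OF U(1)] Vh_cont[OF V(1)] Fsub
    by (intro borel_measurable_continuous_on_indicator continuous_intros) (auto intro: continuous_on_subset)
  then have m1: "(\<lambda>x. indicat_real ?F x *\<^sub>R (U x * cnj (V x))) \<in> borel_measurable surface_measure"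
    by (rule surface_borel_measurable)
  have "kappa P \<in> borel_measurable (restrict_space surface_measure ?B)"
    using coefficients by (simp add: coefficients_def)
  moreover have "?B \<inter> space surface_measure \<in> sets surface_measure"
    using surface_borel_sets[of ?B] by (simp add: surface_measure_def)
  ultimately have m2: "(\<lambda>x. indicat_real ?B x *\<^sub>R kappa P x) \<in> borel_measurable surface_measure"
    by (simp add: borel_measurable_restrict_space_iff)
  show ?thesis
  proof (rule Bochner_Integration.integrable_bound)
    show "integrable surface_measure (\<lambda>x. indicat_real ?F x *\<^sub>R (kappa_inf P * (BU * BV)))"
      using emeasure_surface_frontier_finite[OF polyhedral_subdom[OF j]]
      by (intro integrable_scaleR_left integrable_real_indicator surface_borel_sets) auto
    show "boundary_integrand P j u v \<in> borel_measurable surface_measure"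
      unfolding eq using m2 m1 by (rule borel_measurable_times)
    show "AE x in surface_measure. norm (boundary_integrand P j u v x)
        \<le> norm (indicat_real ?F x *\<^sub>R (kappa_inf P * (BU * BV)))"
    proof (rule AE_I2)
      fix x
      show "norm (boundary_integrand P j u v x) \<le> norm (indicat_real ?F x *\<^sub>R (kappa_inf P * (BU * BV)))"
      proof (cases "x \<in> ?F \<and> x \<in> ?B")
        case True
        then have xc: "x \<in> closure \<Omega>" using Fsub by blast
        have "cmod (kappa P x) * (cmod (U x) * cmod (V x)) \<le> kappa_inf P * (BU * BV)"
          using kappa_frontier[of x] True BU[OF xc] BV[OF xc] kappa_inf_ge_1[of P]
            norm_ge_zero[of "U x"] norm_ge_zero[of "V x"]
          by (intro mult_mono mult_nonneg_nonneg) linarith+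
        then show ?thesis using True by (simp add: eq norm_mult)
      next
        case False
        then have "boundary_integrand P j u v x = 0" by (simp add: boundary_integrand_def indicator_def)
        then show ?thesis by simp
      qed
    qed
  qed
qed

lemma form_linear_left:
  assumes u: "u \<in> broken_Vh P" and u': "u' \<in> broken_Vh P" and v: "v \<in> broken_Vh P"
  shows "form P (\<lambda>x. c * u x + u' x) v = c * form P u v + form P u' v"
proof -
  have "(LINT x|surface_measure. boundary_integrand P j (\<lambda>x. c * u x + u' x) v x)
      = c * (LINT x|surface_measure. boundary_integrand P j u v x) + (LINT x|surface_measure. boundary_integrand P j u' v x)"
    if j: "j \<in> J" for j
  proof -
    have "boundary_integrand P j (\<lambda>x. c * u x + u' x) v x
        = c * boundary_integrand P j u v x + boundary_integrand P j u' v x" for x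
      using trace_lincomb[OF j u u', of x c]
      by (cases "x \<in> frontier (D j)") (simp_all add: boundary_integrand_def algebra_simps)
    then show ?thesis using boundary_integrable[OF j u v] boundary_integrable[OF j u' v] by simp
  qed
  then show ?thesis
    using volume_linear_left broken_Vh_H1[OF u] broken_Vh_H1[OF u'] broken_Vh_H1[OF v]
    by (simp add: form_alt sum.distrib[symmetric] sum_distrib_left algebra_simps)
qed

lemma form_linear_right:
  assumes u: "u \<in> broken_Vh P" and u': "u' \<in> broken_Vh P" and v: "v \<in> broken_Vh P"
  shows "form P v (\<lambda>x. c * u x + u' x) = cnj c * form P v u + form P v u'"
proof -
  have "(LINT x|surface_measure. boundary_integrand P j v (\<lambda>x. c * u x + u' x) x)
      = cnj c * (LINT x|surface_measure. boundary_integrand P j v u x) + (LINT x|surface_measure. boundary_integrand P j v u' x)"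
    if j: "j \<in> J" for j
  proof -
    have "boundary_integrand P j v (\<lambda>x. c * u x + u' x) x
        = cnj c * boundary_integrand P j v u x + boundary_integrand P j v u' x" for x
      using trace_lincomb[OF j u u', of x c]
      by (cases "x \<in> frontier (D j)") (simp_all add: boundary_integrand_def algebra_simps)
    then show ?thesis using boundary_integrable[OF j v u] boundary_integrable[OF j v u'] by simp
  qed
  then show ?thesis
    using volume_linear_right broken_Vh_H1[OF u] broken_Vh_H1[OF u'] broken_Vh_H1[OF v]
    by (simp add: form_alt sum.distrib[symmetric] sum_distrib_left algebra_simps)
qed

lemma form_0_left: "v \<in> broken_Vh P \<Longrightarrow> form P 0 v = 0"
  using form_linear_left[OF broken_Vh_0 broken_Vh_0, of v 1] by (simp add: zero_fun_def)

lemma form_0_right: "v \<in> broken_Vh P \<Longrightarrow> form P v 0 = 0"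
  using form_linear_right[OF broken_Vh_0 broken_Vh_0, of v 1] by (simp add: zero_fun_def)

text \<open>Absorption in the medium and through the boundary both remove energy.\<close>

lemma form_Im_nonpos:
  assumes u: "u \<in> broken_Vh P" shows "Im (form P u u) \<le> 0"
proof -
  have "Im ((LINT x|lebesgue_on (D j). volume_integrand P j u u x)
     - \<i> * (LINT x|surface_measure. boundary_integrand P j u u x)) \<le> 0" if j: "j \<in> J" for j
  proof -
    note uH = broken_Vh_H1[OF u j]
    have "0 \<le> (LINT x|lebesgue_on (D j). - Im (volume_integrand P j u u x))"
    proof (rule Bochner_Integration.integral_nonneg)
      fix x assume "x \<in> space (lebesgue_on (D j))"
      then have k: "0 \<le> Re (kappa P x)" "0 \<le> Im (kappa P x)" using kappa_sign subdom_subset[OF j] by auto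
      have "Im (volume_integrand P j u u x) = - (2 * Re (kappa P x) * Im (kappa P x) * (cmod (u x))\<^sup>2)"
      proof -
        have "volume_integrand P j u u x
            = of_real (mu P x * (\<Sum>i\<in>UNIV. (cmod (grad (D j) u x $ i))\<^sup>2)) - (kappa P x)\<^sup>2 * of_real ((cmod (u x))\<^sup>2)"
          unfolding volume_integrand_def
          by (simp only: mult.assoc complex_norm_square of_real_mult of_real_sum)
        then show ?thesis by (simp only: minus_complex.sel Im_complex_of_real times_complex.sel
              Re_complex_of_real power2_eq_square[of "kappa P x"]) simp
      qed
      then show "0 \<le> - Im (volume_integrand P j u u x)" using k by simp
    qed
    then have "Im (LINT x|lebesgue_on (D j). volume_integrand P j u u x) \<le> 0"
      using integral_Im[OF volume_integrable[OF j uH uH]] by simp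
    moreover have "0 \<le> (LINT x|surface_measure. Re (boundary_integrand P j u u x))"
    proof (rule Bochner_Integration.integral_nonneg)
      fix x
      have "boundary_integrand P j u u x = indicat_real (frontier (D j) \<inter> frontier \<Omega>) x *\<^sub>R
          (kappa P x * of_real ((cmod (bdry_trace (D j) u x))\<^sup>2))"
        unfolding boundary_integrand_def by (simp only: mult.assoc complex_norm_square)
      then show "0 \<le> Re (boundary_integrand P j u u x)"
        using kappa_frontier[of x] by (cases "x \<in> frontier \<Omega>") (simp_all add: indicator_def)
    qed
    then have "0 \<le> Re (LINT x|surface_measure. boundary_integrand P j u u x)"
      using integral_Re[OF boundary_integrable[OF j u u]] by simp
    ultimately show ?thesis by simp
  qed
  then show ?thesis unfolding form_alt Im_sum by (rule sum_nonpos)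
qed

lemma broken_norm_eq_0:
  assumes u: "u \<in> broken_Vh P" and z: "broken_norm P u = 0" shows "u = 0"
proof (rule broken_Vh_AE_zero[OF u])
  fix j assume j: "j \<in> J"
  have "(\<Sum>j\<in>J. (H1_norm P (D j) u)\<^sup>2) = 0" using z broken_norm_power2[of P u] by simp
  then have "(H1_norm P (D j) u)\<^sup>2 = 0" using j by (subst (asm) sum_nonneg_eq_0_iff) auto
  moreover have "0 \<le> (LINT x|lebesgue_on (D j). (norm (grad (D j) u x))\<^sup>2)" by simp
  moreover have "0 \<le> (LINT x|lebesgue_on (D j). (cmod (u x))\<^sup>2)" by simp
  moreover have "1 \<le> (kappa_inf P)\<^sup>2" using kappa_inf_ge_1[of P] by simp
  ultimately have "(LINT x|lebesgue_on (D j). (cmod (u x))\<^sup>2) = 0"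
    unfolding H1_norm_power2 by (smt (verit) mult_le_cancel_right1 mult_eq_0_iff mult_nonneg_nonneg)
  moreover have "integrable (lebesgue_on (D j)) (\<lambda>x. (cmod (u x))\<^sup>2)"
    using broken_Vh_H1[OF u j] by (simp add: H1_def L2_def)
  ultimately have "AE x in lebesgue_on (D j). (cmod (u x))\<^sup>2 = 0"
    by (subst (asm) integral_nonneg_eq_0_iff_AE) auto
  then show "AE x in lebesgue_on (D j). u x = 0" by eventually_elim simp
qed

lemma broken_Vh_not_AE_zero:
  assumes u: "u \<in> broken_Vh P" "u \<noteq> 0" shows "\<not> (AE x in lebesgue_on \<Omega>. u x = 0)"
proof
  assume AE: "AE x in lebesgue_on \<Omega>. u x = 0"
  have "u = 0"
    by (rule broken_Vh_AE_zero[OF u(1)])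
       (rule AE_lebesgue_on_subset[OF AE subdom_subset subdom_lebesgue omega_lebesgue])
  with u(2) show False ..
qed

text \<open>The supremum defining the norm of the form omits null functions, on which the form vanishes.  A
  nonzero broken finite element function is not null and has positive norm.\<close>

lemma form_bound:
  assumes A: "form_norm P = ennreal A" "0 \<le> A" and u: "u \<in> broken_Vh P" and v: "v \<in> broken_Vh P"
  shows "cmod (form P u v) \<le> A * (broken_norm P u * broken_norm P v)"
proof (cases "u = 0 \<or> v = 0")
  case True
  then show ?thesis using form_0_left[OF v] form_0_right[OF u] A(2) by auto
next
  case False
  then have "ennreal (cmod (form P u v) / (broken_norm P u * broken_norm P v)) \<le> form_norm P"
    unfolding form_norm_def using broken_Vh_broken_H1 broken_Vh_not_AE_zero u v
    by (intro SUP_upper2[of "(u, v)"]) auto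
  then have "cmod (form P u v) / (broken_norm P u * broken_norm P v) \<le> A" using A by simp
  moreover have "0 < broken_norm P u * broken_norm P v"
    using False broken_norm_eq_0 u v by (metis broken_norm_nonneg less_eq_real_def mult_pos_pos)
  ultimately show ?thesis by (simp add: pos_divide_le_eq)
qed

text \<open>On a subdomain the local weak gradient is the restriction of the global one, and the subdomains are
  disjoint subsets of \<open>\<Omega>\<close>.\<close>

lemma broken_norm_le_H1_norm:
  assumes z: "z \<in> Vh P" shows "broken_norm P z \<le> H1_norm P \<Omega> z"
proof -
  have zH: "z \<in> H1 \<Omega>" by (rule Vh_H1[OF z omega_open order_refl])
  have split: "(\<Sum>j\<in>J. LINT x|lebesgue_on (D j). f x) \<le> (LINT x|lebesgue_on \<Omega>. f x)"
    if f: "integrable (lebesgue_on \<Omega>) f" "\<And>x. 0 \<le> f x" for f :: "real ^ 'n \<Rightarrow> real"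
  proof -
    have int: "integrable (lebesgue_on \<Omega>) (\<lambda>x. indicat_real (D j) x *\<^sub>R f x)" if "j \<in> J" for j
      using f(1) set_lebesgue_on_subset[OF omega_lebesgue subdom_lebesgue[OF that]] subdom_subset[OF that]
      by (intro integrable_mult_indicator) (auto simp: Int_absorb2)
    have "(LINT x|lebesgue_on (D j). f x) = (LINT x|lebesgue_on \<Omega>. indicat_real (D j) x *\<^sub>R f x)" if j: "j \<in> J" for j
    proof -
      have "(LINT x|lebesgue_on (D j). f x) = (LINT x|lebesgue_on \<Omega>. (if x \<in> D j then f x else 0))"
        by (rule integral_restrict[OF subdom_subset[OF j] subdom_lebesgue[OF j] omega_lebesgue, symmetric])
      also have "\<dots> = (LINT x|lebesgue_on \<Omega>. indicat_real (D j) x *\<^sub>R f x)"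
        by (intro Bochner_Integration.integral_cong) (auto simp: indicator_def)
      finally show ?thesis .
    qed
    then have "(\<Sum>j\<in>J. LINT x|lebesgue_on (D j). f x) = (\<Sum>j\<in>J. LINT x|lebesgue_on \<Omega>. indicat_real (D j) x *\<^sub>R f x)"
      by (rule sum.cong[OF refl])
    also have "\<dots> = (LINT x|lebesgue_on \<Omega>. (\<Sum>j\<in>J. indicat_real (D j) x *\<^sub>R f x))"
      by (rule Bochner_Integration.integral_sum[symmetric]) (rule int)
    also have "\<dots> \<le> (LINT x|lebesgue_on \<Omega>. f x)"
    proof (rule integral_mono)
      show "integrable (lebesgue_on \<Omega>) (\<lambda>x. \<Sum>j\<in>J. indicat_real (D j) x *\<^sub>R f x)"
        by (intro Bochner_Integration.integrable_sum int)
      fix x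
      show "(\<Sum>j\<in>J. indicat_real (D j) x *\<^sub>R f x) \<le> f x"
      proof (cases "\<exists>j\<in>J. x \<in> D j")
        case True
        then obtain j where j: "j \<in> J" "x \<in> D j" by blast
        have "x \<notin> D i" if "i \<in> J" "i \<noteq> j" for i using subdom_disjoint[of i j] j that by blast
        then have eq: "(\<Sum>i\<in>J. indicat_real (D i) x *\<^sub>R f x) = indicat_real (D j) x *\<^sub>R f x"
          using j(1) by (intro sum_eq_single_term) simp_all
        show ?thesis unfolding eq using j(2) by simp
      next
        case False
        then have eq: "(\<Sum>j\<in>J. indicat_real (D j) x *\<^sub>R f x) = 0" by (intro sum.neutral) auto
        show ?thesis unfolding eq using f(2) by simp
      qed
    qed (rule f(1))
    finally show ?thesis .
  qed
  have gradeq: "(LINT x|lebesgue_on (D j). (norm (grad (D j) z x))\<^sup>2) = (LINT x|lebesgue_on (D j). (norm (grad \<Omega> z x))\<^sup>2)"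
    if j: "j \<in> J" for j
  proof -
    note sub = subdom_subset[OF j] subdom_lebesgue[OF j] omega_lebesgue
    have zj: "z \<in> H1 (D j)" by (rule Vh_H1[OF z subdom_open[OF j] subdom_subset[OF j]])
    note gL = L2_subset[OF grad_props(1)[OF zH] sub]
    have "AE x in lebesgue_on (D j). grad (D j) z x = grad \<Omega> z x"
      by (rule grad_AE_eq[OF zj weak_gradient_subset[OF grad_props(2)[OF zH] sub] gL subdom_open[OF j] subdom_bounded[OF j]])
    then have "AE x in lebesgue_on (D j). (norm (grad (D j) z x))\<^sup>2 = (norm (grad \<Omega> z x))\<^sup>2"
      by eventually_elim simp
    then show ?thesis
      using L2_measurable[OF gL] L2_measurable[OF grad_props(1)[OF zj]] by (intro integral_cong_AE) auto
  qed
  have "(broken_norm P z)\<^sup>2 = (\<Sum>j\<in>J. LINT x|lebesgue_on (D j). (norm (grad \<Omega> z x))\<^sup>2)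
      + (kappa_inf P)\<^sup>2 * (\<Sum>j\<in>J. LINT x|lebesgue_on (D j). (cmod (z x))\<^sup>2)"
    using gradeq by (simp add: broken_norm_power2 H1_norm_power2 sum.distrib sum_distrib_left)
  also have "\<dots> \<le> (H1_norm P \<Omega> z)\<^sup>2"
    unfolding H1_norm_power2 using zH grad_props(1)[OF zH]
    by (intro add_mono mult_left_mono split) (auto simp: H1_def L2_def)
  finally show ?thesis by (rule power2_le_imp_le) simp
qed

end

section \<open>Finite-dimensional variational problems\<close>

lemma sum_fun_apply: "(\<Sum>i\<in>A. f i) x = (\<Sum>i\<in>A. f i x :: complex)"
  by (induction A rule: infinite_finite_induct) auto

text \<open>The images of the unit vectors under an injective matrix are independent and as many as the
  unit vectors, so they span.\<close>

lemma injective_matrix_surjective: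
  fixes M :: "'i \<Rightarrow> 'i \<Rightarrow> complex"
  assumes E: "finite E"
    and inj: "\<And>x. (\<And>f. f \<in> E \<Longrightarrow> (\<Sum>e\<in>E. x e * M e f) = 0) \<Longrightarrow> \<forall>e\<in>E. x e = 0"
  shows "\<exists>x. \<forall>f\<in>E. (\<Sum>e\<in>E. x e * M e f) = y f"
proof -
  let ?s = "\<lambda>(c::complex) (f::'i \<Rightarrow> complex) i. c * f i"
  interpret V: vector_space ?s
    by unfold_locales (auto simp: fun_eq_iff algebra_simps)
  define L where "L x = (\<lambda>f. if f \<in> E then (\<Sum>e\<in>E. x e * M e f) else x f)" for x
  interpret L: Vector_Spaces.linear ?s ?s L
    by unfold_locales
       (auto simp: L_def fun_eq_iff sum.distrib distrib_right sum_distrib_left mult.assoc)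
  have injL: "inj L"
  proof (subst L.inj_iff_eq_0, intro allI impI)
    fix x assume "L x = 0"
    then have z: "L x f = 0" for f by simp
    have "(\<Sum>e\<in>E. x e * M e f) = 0" if "f \<in> E" for f using z[of f] that by (simp add: L_def)
    then have "\<forall>e\<in>E. x e = 0" by (rule inj)
    moreover have "x f = 0" if "f \<notin> E" for f using z[of f] that by (simp add: L_def)
    ultimately show "x = 0" by (auto simp: fun_eq_iff)
  qed
  define \<delta> where "\<delta> e = (\<lambda>i. if i = e then 1 else 0 :: complex)" for e :: 'i
  let ?S = "\<delta> ` E"
  have inj\<delta>: "inj \<delta>" by (auto simp: inj_def \<delta>_def fun_eq_iff split: if_splits)
  have expand: "(\<lambda>f. if f \<in> E then x f else 0) = (\<Sum>e\<in>E. ?s (x e) (\<delta> e))" for x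
  proof
    fix f
    have "(\<Sum>e\<in>E. ?s (x e) (\<delta> e)) f = (\<Sum>e\<in>E. if f = e then x e else 0)"
      by (simp add: sum_fun_apply \<delta>_def if_distrib cong: if_cong)
    then show "(if f \<in> E then x f else 0) = (\<Sum>e\<in>E. ?s (x e) (\<delta> e)) f"
      using E by simp
  qed
  have in_span: "(\<lambda>f. if f \<in> E then x f else 0) \<in> V.span ?S" for x
    unfolding expand by (intro V.span_sum V.span_scale V.span_base) auto
  have indep: "V.independent ?S"
  proof (subst V.dependent_finite)
    show "finite ?S" using E by simp
    show "\<not> (\<exists>u. (\<exists>v\<in>?S. u v \<noteq> 0) \<and> (\<Sum>v\<in>?S. ?s (u v) v) = 0)"
    proof safe
      fix u e assume e: "e \<in> E" "u (\<delta> e) \<noteq> 0" and z: "(\<Sum>v\<in>?S. ?s (u v) v) = 0"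
      have "(\<Sum>v\<in>?S. ?s (u v) v) = (\<Sum>e\<in>E. ?s (u (\<delta> e)) (\<delta> e))"
        using inj_on_subset[OF inj\<delta>] by (subst sum.reindex) auto
      also have "\<dots> = (\<lambda>f. if f \<in> E then u (\<delta> f) else 0)"
        using expand[of "\<lambda>e. u (\<delta> e)"] by simp
      finally have "u (\<delta> e) = 0" using z e(1) by (metis zero_fun_apply)
      with e(2) show False ..
    qed
  qed
  have indepL: "V.independent (L ` ?S)"
    using indep injL by (intro L.independent_injective_image) (auto intro: inj_on_subset)
  have cardL: "card (L ` ?S) = card ?S"
    using injL by (intro card_image) (auto intro: inj_on_subset)
  have sub: "L ` ?S \<subseteq> V.span ?S"
  proof
    fix g assume "g \<in> L ` ?S"
    then obtain e where e: "e \<in> E" "g = L (\<delta> e)" by auto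
    have "g = (\<lambda>f. if f \<in> E then g f else 0)"
      using e by (auto simp: L_def \<delta>_def fun_eq_iff)
    then show "g \<in> V.span ?S" using in_span[of g] by simp
  qed
  have "(\<lambda>f. if f \<in> E then y f else 0) \<in> V.span (L ` ?S)" (is "?y \<in> _")
  proof (rule ccontr)
    assume n: "?y \<notin> V.span (L ` ?S)"
    then have "V.independent (insert ?y (L ` ?S))" using indepL by (simp add: V.independent_insert)
    moreover have "insert ?y (L ` ?S) \<subseteq> V.span ?S" using in_span[of y] sub by blast
    ultimately have "card (insert ?y (L ` ?S)) \<le> card ?S"
      using V.independent_span_bound[of ?S] E by blast
    moreover have "?y \<notin> L ` ?S" using n V.span_superset[of "L ` ?S"] by blast
    ultimately show False using cardL E by simp
  qed
  then obtain x where x: "?y = L x" by (auto simp: L.span_image)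
  have "(\<Sum>e\<in>E. x e * M e f) = y f" if "f \<in> E" for f
    using fun_cong[OF x, of f] that by (simp add: L_def)
  then show ?thesis by blast
qed

text \<open>In coordinates with respect to a basis of \<open>W\<close> the problem is a square linear system with an
  injective matrix.\<close>

lemma variational_problem_solvable:
  fixes b :: "('a \<Rightarrow> complex) \<Rightarrow> ('a \<Rightarrow> complex) \<Rightarrow> complex"
  assumes W0: "0 \<in> W" and Wl: "\<And>c u v. u \<in> W \<Longrightarrow> v \<in> W \<Longrightarrow> (\<lambda>x. c * u x + v x) \<in> W"
    and fin: "finite B" "\<And>w. w \<in> W \<Longrightarrow> \<exists>c. w = (\<lambda>x. \<Sum>f\<in>B. c f * f x)"
    and bl: "\<And>c u u' v. u \<in> W \<Longrightarrow> u' \<in> W \<Longrightarrow> v \<in> W \<Longrightarrow> b (\<lambda>x. c * u x + u' x) v = c * b u v + b u' v"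
    and br: "\<And>c u u' v. u \<in> W \<Longrightarrow> u' \<in> W \<Longrightarrow> v \<in> W \<Longrightarrow> b v (\<lambda>x. c * u x + u' x) = cnj c * b v u + b v u'"
    and F: "\<And>c u u'. u \<in> W \<Longrightarrow> u' \<in> W \<Longrightarrow> F (\<lambda>x. c * u x + u' x) = cnj c * F u + F u'"
    and inj: "\<And>w. w \<in> W \<Longrightarrow> (\<And>v. v \<in> W \<Longrightarrow> b w v = 0) \<Longrightarrow> w = 0"
  shows "\<exists>!w. w \<in> W \<and> (\<forall>v\<in>W. b w v = F v)"
proof -
  let ?s = "\<lambda>(c::complex) (f::'a \<Rightarrow> complex) i. c * f i"
  interpret V: vector_space ?s
    by unfold_locales (auto simp: fun_eq_iff algebra_simps)
  obtain E where E: "E \<subseteq> W" "V.independent E" "W \<subseteq> V.span E"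
    using V.maximal_independent_subset[of W] by blast
  have "E \<subseteq> V.span B"
  proof
    fix w assume "w \<in> E"
    then obtain c where "w = (\<lambda>x. \<Sum>f\<in>B. c f * f x)" using E(1) fin(2) by blast
    then have "w = (\<Sum>f\<in>B. ?s (c f) f)" by (auto simp: fun_eq_iff sum_fun_apply)
    then show "w \<in> V.span B" by (simp only:) (intro V.span_sum V.span_scale V.span_base)
  qed
  then have finE: "finite E" using V.independent_span_bound[OF fin(1) E(2)] by blast
  define comb where "comb S x = (\<lambda>i. \<Sum>e\<in>S. x e * e i)" for S and x :: "('a \<Rightarrow> complex) \<Rightarrow> complex"
  have comb_insert: "comb (insert e S) x = (\<lambda>i. x e * e i + comb S x i)" if "finite S" "e \<notin> S" for e S x
    using that by (simp add: comb_def)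
  have comb_W: "comb S x \<in> W" if "finite S" "S \<subseteq> E" for S x
    using that
  proof (induction S)
    case empty then show ?case using W0 by (simp add: comb_def zero_fun_def)
  next
    case (insert e S)
    then show ?case using E(1) by (subst comb_insert) (auto intro!: Wl)
  qed
  have b0: "b (\<lambda>_. 0) v = 0" "b v (\<lambda>_. 0) = 0" if "v \<in> W" for v
    using bl[OF W0 W0 that, of 1] br[OF W0 W0 that, of 1] by (simp_all add: zero_fun_def)
  have F0: "F (\<lambda>_. 0) = 0" using F[OF W0 W0, of 1] by (simp add: zero_fun_def)
  have comb_empty: "comb {} x = (\<lambda>_. 0)" for x by (simp add: comb_def)
  have b_left: "b (comb S x) v = (\<Sum>e\<in>S. x e * b e v)" if "finite S" "S \<subseteq> E" "v \<in> W" for S x v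
    using that
  proof (induction S)
    case empty then show ?case by (simp add: b0 comb_empty)
  next
    case (insert e S)
    then have "e \<in> W" using E(1) by blast
    moreover have "comb S x \<in> W" using insert by (intro comb_W) simp_all
    moreover have "S \<subseteq> E" using insert by simp
    ultimately show ?case using insert by (simp add: comb_insert bl)
  qed
  have b_right: "b v (comb S x) = (\<Sum>e\<in>S. cnj (x e) * b v e)" if "finite S" "S \<subseteq> E" "v \<in> W" for S x v
    using that
  proof (induction S)
    case empty then show ?case by (simp add: b0 comb_empty)
  next
    case (insert e S)
    then have "e \<in> W" using E(1) by blast
    moreover have "comb S x \<in> W" using insert by (intro comb_W) simp_all
    moreover have "S \<subseteq> E" using insert by simp
    ultimately show ?case using insert by (simp add: comb_insert br)
  qed
  have F_sum: "F (comb S x) = (\<Sum>e\<in>S. cnj (x e) * F e)" if "finite S" "S \<subseteq> E" for S x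
    using that
  proof (induction S)
    case empty then show ?case by (simp add: F0 comb_empty)
  next
    case (insert e S)
    then have "e \<in> W" using E(1) by blast
    moreover have "comb S x \<in> W" using insert by (intro comb_W) simp_all
    moreover have "S \<subseteq> E" using insert by simp
    ultimately show ?case using insert by (simp add: comb_insert F)
  qed
  have span: "\<exists>x. v = comb E x" if "v \<in> W" for v
  proof -
    have "v \<in> V.span E" using that E(3) by blast
    then obtain x where "v = (\<Sum>e\<in>E. ?s (x e) e)" using V.span_finite[OF finE] by auto
    then have "v = comb E x" by (auto simp: comb_def fun_eq_iff sum_fun_apply)
    then show ?thesis by (intro exI[of _ x])
  qed
  have test: "(\<forall>v\<in>W. b w v = k v) \<longleftrightarrow> (\<forall>f\<in>E. b w f = k f)"
    if w: "w \<in> W" and k: "\<And>x. k (comb E x) = (\<Sum>e\<in>E. cnj (x e) * k e)" for w k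
  proof
    assume f: "\<forall>f\<in>E. b w f = k f"
    show "\<forall>v\<in>W. b w v = k v"
    proof
      fix v assume "v \<in> W"
      then obtain x where v: "v = comb E x" using span by blast
      show "b w v = k v" unfolding v k b_right[OF finE order_refl w] using f by simp
    qed
  qed (use E(1) in blast)
  have "\<exists>x. \<forall>f\<in>E. (\<Sum>e\<in>E. x e * b e f) = F f"
  proof (rule injective_matrix_surjective[OF finE])
    fix x assume z: "\<And>f. f \<in> E \<Longrightarrow> (\<Sum>e\<in>E. x e * b e f) = 0"
    have "\<forall>f\<in>E. b (comb E x) f = 0"
      using z b_left[OF finE order_refl] E(1) by auto
    then have "\<forall>v\<in>W. b (comb E x) v = 0"
      using test[OF comb_W[OF finE order_refl], of "\<lambda>_. 0" x] by simp
    then have "comb E x = 0" using inj[OF comb_W[OF finE order_refl]] by blast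
    then have "(\<Sum>e\<in>E. ?s (x e) e) = 0" by (auto simp: comb_def fun_eq_iff sum_fun_apply)
    then show "\<forall>e\<in>E. x e = 0" using E(2) V.dependent_finite[OF finE] by blast
  qed
  then obtain x where x: "\<forall>f\<in>E. (\<Sum>e\<in>E. x e * b e f) = F f" by blast
  have "\<forall>f\<in>E. b (comb E x) f = F f"
    using x b_left[OF finE order_refl] E(1) by auto
  then have sol: "comb E x \<in> W" "\<forall>v\<in>W. b (comb E x) v = F v"
    using comb_W[OF finE order_refl] test[OF comb_W[OF finE order_refl] F_sum[OF finE order_refl], of x]
    by blast+
  show ?thesis
  proof (rule ex1I[of _ "comb E x"])
    fix w assume w: "w \<in> W \<and> (\<forall>v\<in>W. b w v = F v)"
    have d: "(\<lambda>i. - 1 * comb E x i + w i) \<in> W" using sol(1) w by (intro Wl) auto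
    have "b (\<lambda>i. - 1 * comb E x i + w i) v = 0" if v: "v \<in> W" for v
      using bl[OF sol(1) _ v, of w "- 1"] w sol(2) v by simp
    from inj[OF d this] show "w = comb E x" by (auto simp: fun_eq_iff)
  qed (use sol in blast)
qed

section \<open>Lifting norm and inf-sup condition\<close>

lemma tuple_scale_1: "tuple_scale 1 p = p"
  by (simp add: tuple_scale_def)

lemma tuple_diff: "p - q = tuple_scale (- 1) q + p"
  by (auto simp: tuple_scale_def fun_eq_iff)

text \<open>Division by zero yields zero, so vanishing norms need no separate treatment.\<close>

lemma quotient_le: "0 \<le> a \<Longrightarrow> 0 \<le> b \<Longrightarrow> 0 \<le> C \<Longrightarrow> x \<le> C * b \<Longrightarrow> x / (a * b) \<le> C / (a::real)"
  by (cases "a = 0"; cases "b = 0") (auto simp: field_simps)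

lemma bdd_below_H1_norm_power2: "bdd_below ((\<lambda>v. (H1_norm P \<omega> v)\<^sup>2) ` S)"
  by (rule bdd_belowI[of _ 0]) auto

context decomposed_domain
begin

lemma Vh_multi_lincomb:
  assumes "p \<in> Vh_multi P" "q \<in> Vh_multi P" shows "tuple_scale c p + q \<in> Vh_multi P"
proof -
  obtain u v where "u \<in> broken_Vh P" "skel P u = p" "v \<in> broken_Vh P" "skel P v = q"
    using skel_surj assms by metis
  then show ?thesis using skel_in_multi[OF broken_Vh_lincomb] skel_lincomb by metis
qed

lemma skel_0: "skel P 0 = 0"
proof -
  have "skel P 0 = skel P 0 + skel P 0"
    using skel_lincomb[OF broken_Vh_0 broken_Vh_0, of 1] by (simp add: tuple_scale_def zero_fun_def)
  then show ?thesis by simp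
qed

lemma Vh_multi_0: "0 \<in> Vh_multi P"
  using skel_in_multi[OF broken_Vh_0] skel_0 by simp

lemma Vh_multi_scale: "p \<in> Vh_multi P \<Longrightarrow> tuple_scale c p \<in> Vh_multi P"
  using Vh_multi_lincomb[OF _ Vh_multi_0, of p c] by simp

lemma Vh_multi_add: "p \<in> Vh_multi P \<Longrightarrow> q \<in> Vh_multi P \<Longrightarrow> p + q \<in> Vh_multi P"
  using Vh_multi_lincomb[of p q 1] by (simp add: tuple_scale_1)

lemma Vh_multi_diff: "p \<in> Vh_multi P \<Longrightarrow> q \<in> Vh_multi P \<Longrightarrow> p - q \<in> Vh_multi P"
  unfolding tuple_diff by (rule Vh_multi_lincomb)

lemma Vh_single_lincomb:
  assumes "p \<in> Vh_single P" "q \<in> Vh_single P" shows "tuple_scale c p + q \<in> Vh_single P"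
proof -
  obtain y z where yz: "y \<in> Vh P" "p = skel P y" "z \<in> Vh P" "q = skel P z"
    using assms by (auto simp: Vh_single_def)
  have "tuple_scale c p + q = skel P (\<lambda>x. c * broken y x + broken z x)"
    using yz skel_lincomb[OF broken_in broken_in] by (simp add: skel_broken)
  also have "\<dots> = skel P (\<lambda>x. c * y x + z x)"
    by (rule skel_cong) (simp add: broken_eq)
  finally show ?thesis using Vh_lincomb[OF yz(1,3)] by (auto simp: Vh_single_def)
qed

lemma Vh_single_0: "0 \<in> Vh_single P"
  using Vh_0 skel_0 by (force simp: Vh_single_def)

lemma rho_norm_skel_le:
  assumes w: "w \<in> broken_Vh P" shows "rho_norm P (skel P w) \<le> broken_norm P w"
proof -
  have "(INF v \<in> {v \<in> Vh_sub P j. restr (frontier (D j)) (bdry_trace (D j) v) = skel P w j}. (H1_norm P (D j) v)\<^sup>2)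
      \<le> (H1_norm P (D j) w)\<^sup>2" if j: "j \<in> J" for j
  proof -
    let ?v = "restr (D j) w"
    have eq: "\<And>x. x \<in> D j \<Longrightarrow> ?v x = w x" by (simp add: restr_def)
    have "?v \<in> Vh_sub P j" using w j by (simp add: broken_Vh_def)
    moreover have "restr (frontier (D j)) (bdry_trace (D j) ?v) = skel P w j"
      using bdry_trace_cong[of "D j" ?v w, OF eq] j by (simp add: skel_def)
    moreover have "H1_norm P (D j) ?v = H1_norm P (D j) w" by (rule H1_norm_cong[OF eq])
    ultimately show ?thesis
      by (intro cINF_lower2[OF bdd_below_H1_norm_power2, of ?v]) auto
  qed
  then show ?thesis
    unfolding rho_norm_def broken_norm_def by (intro real_sqrt_le_mono sum_mono) blast
qed

text \<open>The subdomains are lifted separately, each sharing the slack in \<open>C\<close>, and the pieces put together.\<close>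

lemma near_optimal_lifting:
  assumes q: "q \<in> Vh_multi P" and C: "rho_norm P q < C"
  shows "\<exists>w\<in>broken_Vh P. skel P w = q \<and> broken_norm P w \<le> C"
proof -
  define N where "N j = (INF v \<in> {v \<in> Vh_sub P j. restr (frontier (D j)) (bdry_trace (D j) v) = q j}. (H1_norm P (D j) v)\<^sup>2)" for j
  have "\<exists>U. U \<in> Vh P \<and> q j = restr (frontier (D j)) U" if "j \<in> J" for j
    using q that by (auto simp: Vh_multi_def Vh_bdry_def)
  then obtain U where U: "\<And>j. j \<in> J \<Longrightarrow> U j \<in> Vh P" "\<And>j. j \<in> J \<Longrightarrow> q j = restr (frontier (D j)) (U j)"
    by metis
  have ne: "restr (D j) (U j) \<in> {v \<in> Vh_sub P j. restr (frontier (D j)) (bdry_trace (D j) v) = q j}" if j: "j \<in> J" for j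
  proof -
    have "restr (frontier (D j)) (bdry_trace (D j) (restr (D j) (U j))) = skel P (restr (D j) (U j)) j"
      using j by (simp add: skel_def)
    also have "\<dots> = q j" unfolding U(2)[OF j] by (rule skel_eq[OF j U(1)[OF j]]) (simp add: restr_def)
    finally show ?thesis using U(1)[OF j] by (simp add: Vh_sub_def)
  qed
  have N0: "0 \<le> N j" if j: "j \<in> J" for j
    unfolding N_def using ne[OF j] by (intro cINF_greatest) auto
  have rho: "rho_norm P q = sqrt (\<Sum>j\<in>J. N j)" by (simp add: rho_norm_def N_def)
  have S0: "0 \<le> (\<Sum>j\<in>J. N j)" using N0 by (rule sum_nonneg)
  have C0: "0 \<le> C" using C rho S0 by (smt (verit) real_sqrt_ge_zero)
  have "(\<Sum>j\<in>J. N j) < C\<^sup>2"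
  proof (rule ccontr)
    assume "\<not> ?thesis"
    then have "sqrt (C\<^sup>2) \<le> sqrt (\<Sum>j\<in>J. N j)" by (intro real_sqrt_le_mono) simp
    then show False using C C0 rho by simp
  qed
  define d where "d = (C\<^sup>2 - (\<Sum>j\<in>J. N j)) / (real (nsub P) + 1)"
  have d: "0 < d" using \<open>(\<Sum>j\<in>J. N j) < C\<^sup>2\<close> by (simp add: d_def)
  have nd: "real (nsub P) * d \<le> C\<^sup>2 - (\<Sum>j\<in>J. N j)"
  proof -
    have "real (nsub P) * d \<le> (real (nsub P) + 1) * d" using d by (intro mult_right_mono) auto
    also have "\<dots> = C\<^sup>2 - (\<Sum>j\<in>J. N j)" by (simp add: d_def)
    finally show ?thesis .
  qed
  have "\<exists>V. V \<in> Vh P \<and> skel P V j = q j \<and> (H1_norm P (D j) V)\<^sup>2 < N j + d" if j: "j \<in> J" for j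
  proof -
    have "N j < N j + d" using d by simp
    then obtain v where v: "v \<in> Vh_sub P j" "restr (frontier (D j)) (bdry_trace (D j) v) = q j"
        "(H1_norm P (D j) v)\<^sup>2 < N j + d"
      unfolding N_def using ne[OF j] by (subst (asm) cINF_less_iff[OF _ bdd_below_H1_norm_power2]) auto
    obtain V where V: "V \<in> Vh P" "v = restr (D j) V" using v(1) by (auto simp: Vh_sub_def)
    have eq: "\<And>x. x \<in> D j \<Longrightarrow> v x = V x" by (simp add: V(2) restr_def)
    show ?thesis
      using v V(1) bdry_trace_cong[of "D j" v V, OF eq] H1_norm_cong[of "D j" v V P, OF eq] j
      by (intro exI[of _ V]) (simp add: skel_def)
  qed
  then obtain V where V: "\<And>j. j \<in> J \<Longrightarrow> V j \<in> Vh P" "\<And>j. j \<in> J \<Longrightarrow> skel P (V j) j = q j"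
      "\<And>j. j \<in> J \<Longrightarrow> (H1_norm P (D j) (V j))\<^sup>2 < N j + d" by metis
  obtain w where w: "w \<in> broken_Vh P" "\<And>j x. j \<in> J \<Longrightarrow> x \<in> D j \<Longrightarrow> w x = V j x"
    using broken_patch[of V] V(1) by blast
  have "skel P w = q"
  proof
    fix j show "skel P w j = q j"
    proof (cases "j \<in> J")
      case True
      then show ?thesis
        using skel_eq[OF True V(1)[OF True] w(2)[OF True]] skel_eq[OF True V(1)[OF True] refl] V(2)[OF True] by simp
    next
      case False
      then show ?thesis using q by (auto simp: skel_def Vh_multi_def)
    qed
  qed
  moreover have "broken_norm P w \<le> C"
  proof (rule power2_le_imp_le[OF _ C0])
    have "(broken_norm P w)\<^sup>2 = (\<Sum>j\<in>J. (H1_norm P (D j) (V j))\<^sup>2)"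
      unfolding broken_norm_power2
    proof (rule sum.cong[OF refl])
      fix j assume "j \<in> J"
      then show "(H1_norm P (D j) w)\<^sup>2 = (H1_norm P (D j) (V j))\<^sup>2"
        using H1_norm_cong[of "D j" w "V j" P] w(2) by simp
    qed
    also have "\<dots> \<le> (\<Sum>j\<in>J. N j + d)" using V(3) by (intro sum_mono less_imp_le)
    also have "\<dots> = (\<Sum>j\<in>J. N j) + real (nsub P) * d" by (simp add: sum.distrib)
    also have "\<dots> \<le> C\<^sup>2" using nd by simp
    finally show "(broken_norm P w)\<^sup>2 \<le> C\<^sup>2" .
  qed
  ultimately show ?thesis using w(1) by blast
qed

lemma rho_norm_nonneg: assumes q: "q \<in> Vh_multi P" shows "0 \<le> rho_norm P q"
proof -
  have "0 \<le> (INF v \<in> {v \<in> Vh_sub P j. restr (frontier (D j)) (bdry_trace (D j) v) = q j}. (H1_norm P (D j) v)\<^sup>2)"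
    if j: "j \<in> J" for j
  proof (rule cINF_greatest)
    obtain w where w: "w \<in> broken_Vh P" "skel P w = q" using skel_surj[OF q] by blast
    have eq: "\<And>x. x \<in> D j \<Longrightarrow> restr (D j) w x = w x" by (simp add: restr_def)
    have "restr (D j) w \<in> Vh_sub P j" using w(1) j by (simp add: broken_Vh_def)
    moreover have "restr (frontier (D j)) (bdry_trace (D j) (restr (D j) w)) = q j"
      using bdry_trace_cong[of "D j" "restr (D j) w" w, OF eq] j w(2) by (auto simp: skel_def)
    ultimately show "{v \<in> Vh_sub P j. restr (frontier (D j)) (bdry_trace (D j) v) = q j} \<noteq> {}" by blast
  qed simp
  then show ?thesis unfolding rho_norm_def by (intro real_sqrt_ge_zero sum_nonneg)
qed

lemma broken_norm_0: "broken_norm P 0 = 0"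
proof -
  have "H1_norm P (D j) 0 = 0" if j: "j \<in> J" for j
  proof -
    note H0 = broken_Vh_H1[OF broken_Vh_0 j]
    from H1_lincomb(2)[OF H0 H0 subdom_open[OF j] subdom_bounded[OF j], of 1]
    have "AE x in lebesgue_on (D j). grad (D j) 0 x = 0"
      by (simp add: zero_fun_def)
    then have "(LINT x|lebesgue_on (D j). (norm (grad (D j) 0 x))\<^sup>2) = 0"
      by (intro integral_eq_zero_AE) (auto elim!: eventually_mono)
    then show ?thesis by (simp add: H1_norm_def)
  qed
  then show ?thesis by (simp add: broken_norm_def)
qed

lemma Vh_nontrivial: "\<exists>z\<in>Vh P. z \<noteq> 0"
proof -
  let ?z = "restr (closure \<Omega>) (\<lambda>_. 1)"
  define c where "c \<alpha> = (if \<alpha> = (\<lambda>_. 0) then 1 else 0 :: complex)" for \<alpha> :: "'n \<Rightarrow> nat"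
  have "(\<Sum>\<alpha> | sum \<alpha> UNIV \<le> deg P. c \<alpha> * of_real (\<Prod>i\<in>UNIV. (x $ i) ^ \<alpha> i)) = 1" for x :: "real ^ 'n"
  proof -
    have "(\<Sum>\<alpha> | sum \<alpha> UNIV \<le> deg P. c \<alpha> * of_real (\<Prod>i\<in>UNIV. (x $ i) ^ \<alpha> i))
        = c (\<lambda>_. 0) * of_real (\<Prod>i\<in>UNIV. (x $ i) ^ (\<lambda>_. 0) i)"
      by (rule sum_eq_single_term[where f = "\<lambda>\<alpha>. c \<alpha> * of_real (\<Prod>i\<in>UNIV. (x $ i) ^ \<alpha> i)", OF finite_multi_indices])
         (auto simp: c_def)
    then show ?thesis by (simp add: c_def)
  qed
  then have "(\<lambda>_::real ^ 'n. 1) \<in> polys (deg P)"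
    unfolding polys_def mem_Collect_eq by (intro exI[of _ c]) simp
  moreover have "K \<subseteq> closure \<Omega>" if "K \<in> cells P" for K using that Union_cells by blast
  ultimately have "?z \<in> Vh P"
    unfolding Vh_def
    by (auto simp: restr_def continuous_on_const cong: continuous_on_cong intro!: bexI[of _ "\<lambda>_. 1"])
  moreover have "?z \<noteq> 0"
  proof -
    obtain x where "x \<in> closure \<Omega>" using omega_nonempty closure_subset by blast
    then have "?z x \<noteq> 0" by (simp add: restr_def)
    then show ?thesis by (metis zero_fun_apply)
  qed
  ultimately show ?thesis by blast
qed

lemma form_broken: "form P (broken u) (broken v) = form P u v"
  by (rule form_cong) (auto simp: broken_eq)

lemma broken_norm_broken: "broken_norm P (broken z) = broken_norm P z"
  by (rule broken_norm_cong) (rule broken_eq)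

lemma form_bound_Vh:
  assumes A: "form_norm P = ennreal A" "0 \<le> A" and u: "u \<in> Vh P" and v: "v \<in> Vh P"
  shows "cmod (form P u v) \<le> A * (H1_norm P \<Omega> u * H1_norm P \<Omega> v)"
proof -
  have "cmod (form P u v) \<le> A * (broken_norm P u * broken_norm P v)"
    using form_bound[OF A broken_in[OF u] broken_in[OF v]]
    by (simp add: form_broken broken_norm_broken)
  also have "\<dots> \<le> A * (H1_norm P \<Omega> u * H1_norm P \<Omega> v)"
    using A(2) broken_norm_le_H1_norm[OF u] broken_norm_le_H1_norm[OF v]
    by (intro mult_left_mono mult_mono) auto
  finally show ?thesis .
qed

text \<open>Conforming functions break into functions of smaller norm with the same form values.\<close>

lemma alpha_h_le_form_norm: "alpha_h P \<le> form_norm P"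
proof (cases "form_norm P")
  case (real A)
  obtain z where z: "z \<in> Vh P" "z \<noteq> 0" using Vh_nontrivial by blast
  have "alpha_h P \<le> (SUP v \<in> Vh P - {0}. ennreal (cmod (form P z v) / (H1_norm P \<Omega> z * H1_norm P \<Omega> v)))"
    unfolding alpha_h_def using z by (intro INF_lower) simp
  also have "\<dots> \<le> ennreal A"
  proof (rule SUP_least, rule ennreal_leI)
    fix v assume "v \<in> Vh P - {0}"
    then have "cmod (form P z v) \<le> (A * H1_norm P \<Omega> z) * H1_norm P \<Omega> v"
      using form_bound_Vh[OF real(2,1) z(1), of v] by (simp add: mult.assoc)
    then have "cmod (form P z v) / (H1_norm P \<Omega> z * H1_norm P \<Omega> v) \<le> (A * H1_norm P \<Omega> z) / H1_norm P \<Omega> z"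
      using real(1) by (intro quotient_le) auto
    also have "\<dots> \<le> A" using real(1) by (cases "H1_norm P \<Omega> z = 0") auto
    finally show "cmod (form P z v) / (H1_norm P \<Omega> z * H1_norm P \<Omega> v) \<le> A" .
  qed
  finally show ?thesis using real(2) by simp
qed simp

text \<open>The inf-sup condition in the form in which it is applied: a bound for the functional \<open>a(z, \<cdot>)\<close> on
  conforming functions bounds \<open>z\<close>.\<close>

lemma inf_sup_bound:
  assumes a: "alpha_h P = ennreal a" "0 \<le> a" and z: "z \<in> Vh P" and C: "0 \<le> C"
    and b: "\<And>v. v \<in> Vh P \<Longrightarrow> cmod (form P z v) \<le> C * broken_norm P v"
  shows "a * broken_norm P z \<le> C"
proof (cases "z = 0")
  case True
  then show ?thesis using C by (simp add: broken_norm_0)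
next
  case False
  have "ennreal a \<le> (SUP v \<in> Vh P - {0}. ennreal (cmod (form P z v) / (H1_norm P \<Omega> z * H1_norm P \<Omega> v)))"
    unfolding a(1)[symmetric] alpha_h_def using z False by (intro INF_lower) simp
  also have "\<dots> \<le> ennreal (C / H1_norm P \<Omega> z)"
  proof (rule SUP_least, rule ennreal_leI)
    fix v assume v: "v \<in> Vh P - {0}"
    have "cmod (form P z v) \<le> C * H1_norm P \<Omega> v"
      using b[of v] v broken_norm_le_H1_norm[of v] C by (meson DiffD1 mult_left_mono order_trans)
    then show "cmod (form P z v) / (H1_norm P \<Omega> z * H1_norm P \<Omega> v) \<le> C / H1_norm P \<Omega> z"
      using C by (intro quotient_le) auto
  qed
  finally have "a \<le> C / H1_norm P \<Omega> z" using C by simp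
  then have "a * H1_norm P \<Omega> z \<le> C"
    using C a(2) H1_norm_nonneg[of P \<Omega> z] by (cases "H1_norm P \<Omega> z = 0") (auto simp: field_simps)
  moreover have "a * broken_norm P z \<le> a * H1_norm P \<Omega> z"
    using broken_norm_le_H1_norm[OF z] a(2) by (rule mult_left_mono)
  ultimately show ?thesis by simp
qed

lemma Vh_form_zero_imp_zero:
  assumes al: "0 < alpha_h P" and z: "z \<in> Vh P" and 0: "\<And>v. v \<in> Vh P \<Longrightarrow> form P z v = 0"
  shows "z = 0"
proof (rule ccontr)
  assume "z \<noteq> 0"
  then have "alpha_h P \<le> (SUP v \<in> Vh P - {0}. ennreal (cmod (form P z v) / (H1_norm P \<Omega> z * H1_norm P \<Omega> v)))"
    unfolding alpha_h_def using z by (intro INF_lower) simp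
  also have "\<dots> \<le> 0" using 0 by (intro SUP_least) simp
  finally show False using al by simp
qed

end

section \<open>Scattering and the residual estimate\<close>

locale skeleton_product = decomposed_domain P for P :: "'n::finite ddm" +
  fixes t :: "'n tuple \<Rightarrow> 'n tuple \<Rightarrow> complex"
  assumes scalar_product: "is_scalar_product (Vh_multi P) t"
begin

abbreviation "V \<equiv> Vh_multi P"

lemmas scalar_product_laws = scalar_product[unfolded is_scalar_product_def]
lemmas t_add_left = scalar_product_laws[THEN conjunct1, rule_format]
  and t_scale_left = scalar_product_laws[THEN conjunct2, THEN conjunct1, rule_format]
  and t_sym = scalar_product_laws[THEN conjunct2, THEN conjunct2, THEN conjunct1, rule_format]
  and t_pos = scalar_product_laws[THEN conjunct2, THEN conjunct2, THEN conjunct2, rule_format]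

lemma t_lincomb_left:
  "p \<in> V \<Longrightarrow> q \<in> V \<Longrightarrow> r \<in> V \<Longrightarrow> t (tuple_scale c p + q) r = c * t p r + t q r"
  by (simp add: t_add_left[OF Vh_multi_scale] t_scale_left)

lemma t_lincomb_right:
  assumes "p \<in> V" "q \<in> V" "r \<in> V" shows "t r (tuple_scale c p + q) = cnj c * t r p + t r q"
proof -
  have "t r (tuple_scale c p + q) = cnj (c * t p r + t q r)"
    unfolding t_sym[OF Vh_multi_lincomb[OF assms(1,2)] assms(3)] t_lincomb_left[OF assms] ..
  also have "\<dots> = cnj c * t r p + t r q"
    unfolding t_sym[OF assms(1,3)] t_sym[OF assms(2,3)] by simp
  finally show ?thesis .
qed

lemma t_diff_left: "p \<in> V \<Longrightarrow> q \<in> V \<Longrightarrow> r \<in> V \<Longrightarrow> t (p - q) r = t p r - t q r"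
  unfolding tuple_diff using t_lincomb_left[of q p r "- 1"] by simp

lemma t_add_right: "p \<in> V \<Longrightarrow> q \<in> V \<Longrightarrow> r \<in> V \<Longrightarrow> t r (p + q) = t r p + t r q"
  using t_lincomb_right[of p q r 1] by (simp add: tuple_scale_1)

lemma t_scale_right: "p \<in> V \<Longrightarrow> r \<in> V \<Longrightarrow> t r (tuple_scale c p) = cnj c * t r p"
proof -
  assume p: "p \<in> V" and r: "r \<in> V"
  have "t r (tuple_scale c p) = cnj (c * t p r)"
    unfolding t_sym[OF Vh_multi_scale[OF p] r] t_scale_left[OF p r] ..
  then show "t r (tuple_scale c p) = cnj c * t r p" unfolding t_sym[OF p r] by simp
qed

lemma t_0: "r \<in> V \<Longrightarrow> t 0 r = 0"
  using t_add_left[OF Vh_multi_0 Vh_multi_0, of r] by simp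

lemma t_self: assumes p: "p \<in> V" shows "t p p = of_real ((t_norm t p)\<^sup>2)" "p \<noteq> 0 \<Longrightarrow> 0 < t_norm t p"
proof -
  have "Im (t p p) = Im (cnj (t p p))" by (rule arg_cong[OF t_sym[OF p p]])
  then have im: "Im (t p p) = 0" by simp
  note pos = t_pos[OF p]
  have "0 \<le> Re (t p p)" using pos t_0[OF Vh_multi_0] by (cases "p = 0") auto
  then have "(t_norm t p)\<^sup>2 = Re (t p p)" by (simp add: t_norm_def)
  then show "t p p = of_real ((t_norm t p)\<^sup>2)" using im by (simp add: complex_eq_iff)
  show "p \<noteq> 0 \<Longrightarrow> 0 < t_norm t p" using pos by (simp add: t_norm_def)
qed

lemma t_norm_nonneg: "p \<in> V \<Longrightarrow> 0 \<le> t_norm t p"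
  using t_self(2)[of p] t_0[OF Vh_multi_0] by (cases "p = 0") (auto simp: t_norm_def)

lemma t_norm_0: "t_norm t 0 = 0"
  using t_0[OF Vh_multi_0] by (simp add: t_norm_def)

lemma t_norm_eq_0: "p \<in> V \<Longrightarrow> t_norm t p = 0 \<Longrightarrow> p = 0"
  using t_self(2) by fastforce

lemma t_norm_scale: assumes "p \<in> V" shows "t_norm t (tuple_scale c p) = cmod c * t_norm t p"
proof -
  have "t (tuple_scale c p) (tuple_scale c p) = c * cnj c * t p p"
    using assms by (simp add: t_scale_left t_scale_right Vh_multi_scale)
  also have "\<dots> = of_real ((cmod c)\<^sup>2 * (t_norm t p)\<^sup>2)"
    unfolding t_self(1)[OF assms] by (simp only: complex_norm_square of_real_mult)
  finally show ?thesis
    using t_norm_nonneg[OF assms] by (simp add: t_norm_def[of t "tuple_scale c p"] real_sqrt_mult)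
qed

lemma t_Cauchy_Schwarz:
  assumes p: "p \<in> V" and q: "q \<in> V" shows "cmod (t p q) \<le> t_norm t p * t_norm t q"
proof (cases "q = 0")
  case True
  then have "t p q = 0" using t_sym[OF q p] t_0[OF p] by simp
  then show ?thesis using t_norm_nonneg[OF p] t_norm_nonneg[OF q] by simp
next
  case False
  define c where "c = t p q / t q q"
  have nq: "0 < t_norm t q" by (rule t_self(2)[OF q False])
  have qq: "t q q = of_real ((t_norm t q)\<^sup>2)" by (rule t_self(1)[OF q])
  have r: "tuple_scale (- c) q + p \<in> V" (is "?r \<in> V") by (rule Vh_multi_lincomb[OF q p])
  have orth: "t ?r q = 0" using nq unfolding t_lincomb_left[OF q p q] by (simp add: c_def qq)
  have "t ?r ?r = t ?r p" unfolding t_lincomb_right[OF q p r] using orth by simp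
  also have "\<dots> = t p p - c * t q p" unfolding t_lincomb_left[OF q p p] by simp
  also have "\<dots> = of_real ((t_norm t p)\<^sup>2 - (cmod (t p q))\<^sup>2 / (t_norm t q)\<^sup>2)"
  proof -
    have "c * t q p = t p q * cnj (t p q) / t q q" by (simp add: c_def t_sym[OF p q])
    also have "\<dots> = of_real ((cmod (t p q))\<^sup>2 / (t_norm t q)\<^sup>2)"
      unfolding qq of_real_divide complex_norm_square ..
    finally show ?thesis unfolding t_self(1)[OF p] by simp
  qed
  finally have "(t_norm t ?r)\<^sup>2 = (t_norm t p)\<^sup>2 - (cmod (t p q))\<^sup>2 / (t_norm t q)\<^sup>2"
    unfolding t_self(1)[OF r] of_real_eq_iff .
  then have "(cmod (t p q))\<^sup>2 / (t_norm t q)\<^sup>2 \<le> (t_norm t p)\<^sup>2"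
    using zero_le_power2[of "t_norm t ?r"] by linarith
  then have "(cmod (t p q))\<^sup>2 \<le> (t_norm t p * t_norm t q)\<^sup>2"
    using nq by (simp add: power_mult_distrib pos_divide_le_eq)
  then show ?thesis
    by (rule power2_le_imp_le) (rule mult_nonneg_nonneg[OF t_norm_nonneg[OF p] less_imp_le[OF nq]])
qed

lemma t_norm_add_power2:
  assumes p: "p \<in> V" and q: "q \<in> V"
  shows "(t_norm t (p + q))\<^sup>2 = (t_norm t p)\<^sup>2 + (t_norm t q)\<^sup>2 + 2 * Re (t p q)"
proof -
  note pq = Vh_multi_add[OF p q]
  have "t (p + q) (p + q) = t p p + t q q + (t p q + cnj (t p q))"
    by (simp add: t_add_left[OF p q pq] t_add_right[OF p q p] t_add_right[OF p q q] t_sym[OF p q])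
  then have "Re (t (p + q) (p + q)) = Re (t p p) + Re (t q q) + 2 * Re (t p q)" by simp
  then show ?thesis unfolding t_self(1)[OF pq] t_self(1)[OF p] t_self(1)[OF q] by simp
qed

lemma t_norm_triangle:
  assumes p: "p \<in> V" and q: "q \<in> V" shows "t_norm t (p + q) \<le> t_norm t p + t_norm t q"
proof (rule power2_le_imp_le)
  have "Re (t p q) \<le> t_norm t p * t_norm t q"
    using t_Cauchy_Schwarz[OF p q] complex_Re_le_cmod order_trans by blast
  then show "(t_norm t (p + q))\<^sup>2 \<le> (t_norm t p + t_norm t q)\<^sup>2"
    unfolding t_norm_add_power2[OF p q] by (simp add: power2_sum)
qed (use t_norm_nonneg p q in simp)

text \<open>Testing with the solution itself gives \<open>Im a(w, w) = t(w|\<^sub>\<Sigma>, w|\<^sub>\<Sigma>)\<close>, and the left side is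
  nonpositive.  So the traces vanish, \<open>w\<close> is conforming, and the inf-sup condition applies.\<close>

lemma local_problem_injective:
  assumes al: "0 < alpha_h P" and w: "w \<in> broken_Vh P"
    and hom: "\<And>v. v \<in> broken_Vh P \<Longrightarrow> form P w v - \<i> * t (skel P w) (skel P v) = 0"
  shows "w = 0"
proof -
  note sw = skel_in_multi[OF w]
  have "form P w w = \<i> * t (skel P w) (skel P w)" using hom[OF w] by simp
  then have "Im (form P w w) = (t_norm t (skel P w))\<^sup>2" by (simp add: t_self(1)[OF sw])
  then have "(t_norm t (skel P w))\<^sup>2 \<le> 0" using form_Im_nonpos[OF w] by simp
  then have s0: "skel P w = 0" using t_norm_eq_0[OF sw] by simp
  then obtain z where z: "z \<in> Vh P" "\<And>j x. j \<in> J \<Longrightarrow> x \<in> D j \<Longrightarrow> w x = z x"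
    using broken_glue[OF w] Vh_single_0 by auto
  have "form P z v = 0" if v: "v \<in> Vh P" for v
  proof -
    have "form P z v = form P w (broken v)"
      by (rule form_cong) (simp_all add: z(2) broken_eq)
    also have "\<dots> = 0"
      using hom[OF broken_in[OF v]] s0 t_0[OF skel_in_multi[OF broken_in[OF v]]] by simp
    finally show ?thesis .
  qed
  then have "z = 0" by (rule Vh_form_zero_imp_zero[OF al z(1)])
  show ?thesis
  proof (rule broken_Vh_AE_zero[OF w])
    fix j assume "j \<in> J"
    then show "AE x in lebesgue_on (D j). w x = 0" using z(2) \<open>z = 0\<close> by (intro AE_I2) simp
  qed
qed

lemma scattering_solution:
  assumes al: "0 < alpha_h P" and p: "p \<in> V"
  shows "\<exists>w\<in>broken_Vh P. scattering P t p = p + tuple_scale (2 * \<i>) (skel P w) \<and>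
    (\<forall>v\<in>broken_Vh P. form P w v - \<i> * t (skel P w) (skel P v) = t p (skel P v))"
proof -
  let ?b = "\<lambda>w v. form P w v - \<i> * t (skel P w) (skel P v)"
  obtain B where B: "finite B" "\<And>w. w \<in> broken_Vh P \<Longrightarrow> \<exists>c. w = (\<lambda>x. \<Sum>b\<in>B. c b * b x)"
    using broken_Vh_finite_span by blast
  have ex: "\<exists>!w. w \<in> broken_Vh P \<and> (\<forall>v\<in>broken_Vh P. ?b w v = t p (skel P v))"
  proof (rule variational_problem_solvable[where b = ?b and F = "\<lambda>v. t p (skel P v)", OF broken_Vh_0 broken_Vh_lincomb B])
    fix c u u' v assume h: "u \<in> broken_Vh P" "u' \<in> broken_Vh P" "v \<in> broken_Vh P"
    note s = h[THEN skel_in_multi]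
    show "?b (\<lambda>x. c * u x + u' x) v = c * ?b u v + ?b u' v"
      using form_linear_left[OF h] skel_lincomb[OF h(1,2)] t_lincomb_left[OF s]
      by (simp add: algebra_simps)
    show "?b v (\<lambda>x. c * u x + u' x) = cnj c * ?b v u + ?b v u'"
      using form_linear_right[OF h] skel_lincomb[OF h(1,2)] t_lincomb_right[OF s]
      by (simp add: algebra_simps)
  next
    fix c u u' assume h: "u \<in> broken_Vh P" "u' \<in> broken_Vh P"
    show "t p (skel P (\<lambda>x. c * u x + u' x)) = cnj c * t p (skel P u) + t p (skel P u')"
      using skel_lincomb[OF h] t_lincomb_right[OF skel_in_multi[OF h(1)] skel_in_multi[OF h(2)] p] by simp
  next
    fix w assume "w \<in> broken_Vh P" "\<And>v. v \<in> broken_Vh P \<Longrightarrow> ?b w v = 0"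
    then show "w = 0" by (rule local_problem_injective[OF al])
  qed
  from theI'[OF ex] show ?thesis by (auto simp: scattering_def)
qed

text \<open>The estimate behind the theorem.  With \<open>q = p + \<i> w|\<^sub>\<Sigma>\<close> the local problem reads
  \<open>a(w, v) = t(q, v|\<^sub>\<Sigma>)\<close>, and half of the residual splits orthogonally.  Its component among the
  single traces acts on conforming test functions like \<open>q\<close>; the other one is, up to the factor \<open>\<i>\<close>,
  the part of \<open>w|\<^sub>\<Sigma>\<close> orthogonal to the single traces.\<close>

lemma residual_estimate:
  fixes l m A a :: real
  assumes al: "alpha_h P = ennreal a" "0 < a" and A: "form_norm P = ennreal A" "0 \<le> A"
    and l: "0 \<le> l" "\<And>q. q \<in> V \<Longrightarrow> t_norm t q \<le> l * rho_norm P q"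
    and m: "0 < m" "\<And>q. q \<in> V \<Longrightarrow> m * rho_norm P q \<le> t_norm t q"
    and proj: "orthogonal_projector V t (Vh_single P) (\<lambda>w. tuple_scale (1 / 2) (w + X w))"
    and p: "p \<in> V"
  shows "sqrt 2 * a * t_norm t p \<le> (l\<^sup>2 + (2 * A / m)\<^sup>2) * t_norm t (p + X (scattering P t p))"
proof -
  define Q where "Q q = tuple_scale (1 / 2) (q + X q)" for q
  have QW: "Q q \<in> Vh_single P" if "q \<in> V" for q
    using proj that by (simp add: orthogonal_projector_def Q_def)
  have Qorth: "t (q - Q q) s = 0" if "q \<in> V" "s \<in> Vh_single P" for q s
    using proj that by (simp add: orthogonal_projector_def Q_def)
  have WV: "s \<in> V" if "s \<in> Vh_single P" for s using that Vh_single_subset by blast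
  have al0: "0 < alpha_h P" using al by simp
  obtain w where w: "w \<in> broken_Vh P" and S: "scattering P t p = p + tuple_scale (2 * \<i>) (skel P w)"
    and eq: "\<And>v. v \<in> broken_Vh P \<Longrightarrow> form P w v - \<i> * t (skel P w) (skel P v) = t p (skel P v)"
    using scattering_solution[OF al0 p] by blast
  define \<sigma> where "\<sigma> = skel P w"
  define s where "s = scattering P t p"
  have \<sigma>V: "\<sigma> \<in> V" unfolding \<sigma>_def by (rule skel_in_multi[OF w])
  have s_eq: "s = tuple_scale (2 * \<i>) \<sigma> + p" by (simp add: s_def S \<sigma>_def add.commute)
  have sV: "s \<in> V" unfolding s_eq by (rule Vh_multi_lincomb[OF \<sigma>V p])
  define q where "q = tuple_scale \<i> \<sigma> + p"
  have qV: "q \<in> V" unfolding q_def by (rule Vh_multi_lincomb[OF \<sigma>V p])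
  have formq: "form P w v = t q (skel P v)" if v: "v \<in> broken_Vh P" for v
    using eq[OF v] t_lincomb_left[OF \<sigma>V p skel_in_multi[OF v], of \<i>]
    by (simp add: q_def \<sigma>_def algebra_simps)
  define g where "g = tuple_scale (- \<i>) \<sigma> + Q s"
  have gV: "g \<in> V" unfolding g_def by (rule Vh_multi_lincomb[OF \<sigma>V WV[OF QW[OF sV]]])
  have resid: "p + X s = tuple_scale 2 g"
    by (auto simp: g_def Q_def s_eq tuple_scale_def fun_eq_iff algebra_simps)
  define g0 g1 where "g0 = Q g" and "g1 = g - Q g"
  have g0: "g0 \<in> Vh_single P" "g0 \<in> V" using QW[OF gV] WV by (auto simp: g0_def)
  have g1V: "g1 \<in> V" unfolding g1_def using Vh_multi_diff[OF gV] g0 by (simp add: g0_def)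
  have pyth: "(t_norm t g)\<^sup>2 = (t_norm t g0)\<^sup>2 + (t_norm t g1)\<^sup>2"
  proof -
    have "t g1 g0 = 0" unfolding g1_def by (rule Qorth[OF gV g0(1)])
    moreover have "g = g1 + g0" by (simp add: g1_def g0_def)
    ultimately show ?thesis using t_norm_add_power2[OF g1V g0(2)] by simp
  qed
  have tq: "t q r = t g0 r" if r: "r \<in> Vh_single P" for r
  proof -
    have rV: "r \<in> V" by (rule WV[OF r])
    have "t (Q s) r = t s r" using Qorth[OF sV r] t_diff_left[OF sV WV[OF QW[OF sV]] rV] by simp
    then have "t g r = - \<i> * t \<sigma> r + (2 * \<i> * t \<sigma> r + t p r)"
      unfolding g_def t_lincomb_left[OF \<sigma>V WV[OF QW[OF sV]] rV] by (simp add: s_eq t_lincomb_left[OF \<sigma>V p rV])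
    also have "\<dots> = t q r" unfolding q_def t_lincomb_left[OF \<sigma>V p rV] by (simp add: algebra_simps)
    finally have "t g r = t q r" .
    moreover have "t g0 r = t g r"
      using Qorth[OF gV r] t_diff_left[OF gV g0(2)[unfolded g0_def] rV] by (simp add: g0_def)
    ultimately show ?thesis by simp
  qed
  \<comment> \<open>The lifting norm is an infimum; lifting up to a factor \<open>11 / 10\<close> suffices, since the estimate
    with exact liftings holds with a larger constant than \<open>sqrt 2\<close>.\<close>
  define k where "k = (11 / 10 :: real)"
  have lift: "\<exists>v\<in>broken_Vh P. skel P v = r \<and> broken_norm P v \<le> k / m * t_norm t r" if r: "r \<in> V" for r
  proof (cases "r = 0")
    case True
    then show ?thesis using broken_Vh_0 skel_0 broken_norm_0 t_norm_0 by (intro bexI[of _ 0]) auto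
  next
    case False
    have "rho_norm P r < k / m * t_norm t r"
    proof -
      have "m * rho_norm P r < k * t_norm t r"
        using m(2)[OF r] t_self(2)[OF r False] by (simp add: k_def)
      then show ?thesis using m(1) by (simp add: field_simps)
    qed
    from near_optimal_lifting[OF r this] show ?thesis .
  qed
  have skel_le: "t_norm t (skel P v) \<le> l * broken_norm P v" if v: "v \<in> broken_Vh P" for v
    using l(2)[OF skel_in_multi[OF v]] mult_left_mono[OF rho_norm_skel_le[OF v] l(1)] by simp
  have ig1V: "tuple_scale \<i> g1 \<in> V" by (rule Vh_multi_scale[OF g1V])
  have nig1: "t_norm t (tuple_scale \<i> g1) = t_norm t g1" by (simp add: t_norm_scale[OF g1V])
  obtain u1 where u1: "u1 \<in> broken_Vh P" "skel P u1 = tuple_scale \<i> g1" "broken_norm P u1 \<le> k / m * t_norm t g1"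
    using lift[OF ig1V] nig1 by auto
  define u0 where "u0 = (\<lambda>x. - 1 * u1 x + w x)"
  have u0: "u0 \<in> broken_Vh P" unfolding u0_def by (rule broken_Vh_lincomb[OF u1(1) w])
  have w_split: "w = (\<lambda>x. 1 * u0 x + u1 x)" by (simp add: u0_def)
  have "skel P u0 = tuple_scale (- 1) (tuple_scale \<i> g1) + \<sigma>"
    unfolding u0_def skel_lincomb[OF u1(1) w] u1(2) \<sigma>_def ..
  also have "\<dots> = tuple_scale \<i> (tuple_scale (- 1) (Q s) + Q g)"
    by (auto simp: g1_def g_def tuple_scale_def fun_eq_iff algebra_simps)
  also have "\<dots> \<in> Vh_single P"
    using Vh_single_lincomb[OF Vh_single_lincomb[OF QW[OF sV] QW[OF gV], of "- 1"] Vh_single_0, of \<i>] by simp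
  finally obtain z where z: "z \<in> Vh P" "\<And>j x. j \<in> J \<Longrightarrow> x \<in> D j \<Longrightarrow> u0 x = z x"
    using broken_glue[OF u0] by blast
  have nz: "broken_norm P z = broken_norm P u0"
    by (rule broken_norm_cong[symmetric]) (rule z(2))
  define G0 G1 N0 N1 where "G0 = t_norm t g0" and "G1 = t_norm t g1"
    and "N0 = broken_norm P u0" and "N1 = broken_norm P u1"
  have nonneg: "0 \<le> G0" "0 \<le> G1" "0 \<le> N0" "0 \<le> N1"
    using t_norm_nonneg g0(2) g1V by (simp_all add: G0_def G1_def N0_def N1_def)
  \<comment> \<open>The inf-sup condition for the conforming part.\<close>
  have e1: "a * N0 \<le> l * G0 + A * N1"
  proof -
    have "a * broken_norm P z \<le> G0 * l + A * N1"
    proof (rule inf_sup_bound[OF al(1) _ z(1)])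
      fix v assume v: "v \<in> Vh P"
      note bv = broken_in[OF v]
      have single: "skel P (broken v) \<in> Vh_single P" using v by (auto simp: skel_broken Vh_single_def)
      have "form P z v = form P u0 (broken v)"
        by (rule form_cong) (simp_all add: z(2) broken_eq)
      also have "\<dots> = form P w (broken v) - form P u1 (broken v)"
        unfolding u0_def form_linear_left[OF u1(1) w bv] by simp
      also have "form P w (broken v) = t g0 (skel P (broken v))"
        using formq[OF bv] tq[OF single] by simp
      finally have "cmod (form P z v) \<le> cmod (t g0 (skel P (broken v))) + cmod (form P u1 (broken v))"
        using norm_triangle_ineq4 by metis
      also have "cmod (t g0 (skel P (broken v))) \<le> G0 * (l * broken_norm P (broken v))"
      proof -
        have "cmod (t g0 (skel P (broken v))) \<le> G0 * t_norm t (skel P (broken v))"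
          unfolding G0_def by (rule t_Cauchy_Schwarz[OF g0(2) skel_in_multi[OF bv]])
        also have "\<dots> \<le> G0 * (l * broken_norm P (broken v))"
          using skel_le[OF bv] nonneg(1) by (rule mult_left_mono)
        finally show ?thesis .
      qed
      also have "cmod (form P u1 (broken v)) \<le> A * (N1 * broken_norm P (broken v))"
        unfolding N1_def by (rule form_bound[OF A u1(1) bv])
      finally show "cmod (form P z v) \<le> (G0 * l + A * N1) * broken_norm P v"
        by (simp add: broken_norm_broken algebra_simps)
    qed (use al(2) A(2) l(1) nonneg in simp_all)
    then show ?thesis by (simp add: nz N0_def mult.commute)
  qed
  have e2: "t_norm t \<sigma> \<le> l * (N0 + N1)"
  proof -
    have "\<sigma> = skel P u0 + skel P u1"
      unfolding \<sigma>_def using skel_lincomb[OF u0 u1(1), of 1] w_split by (simp add: tuple_scale_1)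
    then have "t_norm t \<sigma> \<le> t_norm t (skel P u0) + t_norm t (skel P u1)"
      using t_norm_triangle[OF skel_in_multi[OF u0] skel_in_multi[OF u1(1)]] by simp
    also have "\<dots> \<le> l * N0 + l * N1"
      unfolding N0_def N1_def by (intro add_mono skel_le u0 u1)
    finally show ?thesis by (simp add: distrib_left)
  qed
  \<comment> \<open>The equation, tested with a lifting of \<open>q\<close>.\<close>
  have e3: "t_norm t q \<le> k / m * A * (N0 + N1)"
  proof (cases "q = 0")
    case True
    then show ?thesis using m(1) A(2) nonneg by (simp add: t_norm_0 k_def)
  next
    case False
    have nq: "0 < t_norm t q" by (rule t_self(2)[OF qV False])
    obtain v where v: "v \<in> broken_Vh P" "skel P v = q" "broken_norm P v \<le> k / m * t_norm t q"
      using lift[OF qV] by blast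
    have "form P w v = form P u0 v + form P u1 v"
      using form_linear_left[OF u0 u1(1) v(1), of 1] w_split by simp
    then have "cmod (form P w v) \<le> A * (N0 * broken_norm P v) + A * (N1 * broken_norm P v)"
      using form_bound[OF A u0 v(1)] form_bound[OF A u1(1) v(1)] norm_triangle_ineq[of "form P u0 v" "form P u1 v"]
      by (simp add: N0_def N1_def)
    also have "\<dots> = A * (N0 + N1) * broken_norm P v" by (simp add: algebra_simps)
    also have "\<dots> \<le> A * (N0 + N1) * (k / m * t_norm t q)"
      using v(3) A(2) nonneg by (intro mult_left_mono) auto
    finally have "cmod (t q q) \<le> A * (N0 + N1) * (k / m * t_norm t q)"
      using formq[OF v(1)] v(2) by simp
    moreover have "cmod (t q q) = t_norm t q * t_norm t q"
      unfolding t_self(1)[OF qV] by (simp add: power2_eq_square norm_mult)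
    ultimately have "t_norm t q * t_norm t q \<le> (k / m * A * (N0 + N1)) * t_norm t q"
      by (simp add: algebra_simps)
    then show ?thesis using nq by (rule mult_right_le_imp_le)
  qed
  have e4: "t_norm t p \<le> t_norm t q + t_norm t \<sigma>"
  proof -
    have p_eq: "q + tuple_scale (- \<i>) \<sigma> = p" by (intro ext) (simp add: q_def tuple_scale_def)
    have "t_norm t p \<le> t_norm t q + t_norm t (tuple_scale (- \<i>) \<sigma>)"
      using t_norm_triangle[OF qV Vh_multi_scale[OF \<sigma>V], of "- \<i>"] unfolding p_eq .
    then show ?thesis by (simp add: t_norm_scale[OF \<sigma>V])
  qed
  have aA: "a \<le> A" using alpha_h_le_form_norm al A by simp
  define c where "c = 2 * A / m"
  have c0: "0 \<le> c" using A(2) m(1) by (simp add: c_def)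
  have AN1: "2 * (A * N1) \<le> k * c * G1"
  proof -
    have "2 * A * N1 \<le> 2 * A * (k / m * G1)" using u1(3) A(2) by (intro mult_left_mono) (auto simp: N1_def G1_def)
    then show ?thesis by (simp add: c_def algebra_simps)
  qed
  have sum_bound: "a * (N0 + N1) \<le> l * G0 + k * c * G1"
    using e1 AN1 mult_right_mono[OF aA nonneg(4)] by (simp add: algebra_simps)
  have Np: "t_norm t p \<le> (l + k * c / 2) * (N0 + N1)"
    using e4 e3 e2 by (simp add: c_def algebra_simps)
  have "a * t_norm t p \<le> (l + k * c / 2) * (a * (N0 + N1))"
    using mult_left_mono[OF Np, of a] al(2) by (simp add: mult.left_commute)
  also have "\<dots> \<le> (l + k * c / 2) * (l * G0 + k * c * G1)"
    using sum_bound l(1) c0 by (intro mult_left_mono) (auto simp: k_def)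
  also have "\<dots> \<le> (k * (l + c / 2)) * (k * (l * G0 + c * G1))"
    using l(1) c0 nonneg by (intro mult_mono) (auto simp: k_def algebra_simps)
  finally have main: "a * t_norm t p \<le> k\<^sup>2 * ((l + c / 2) * (l * G0 + c * G1))"
    by (simp add: power2_eq_square algebra_simps)
  define R where "R = l\<^sup>2 + c\<^sup>2"
  have sq1: "(l + c / 2)\<^sup>2 \<le> 5 / 4 * R"
  proof -
    have "5 / 4 * R - (l + c / 2)\<^sup>2 = (l / 2 - c)\<^sup>2" by (simp add: R_def power2_eq_square algebra_simps)
    then show ?thesis using zero_le_power2[of "l / 2 - c"] by linarith
  qed
  have sq2: "(l * G0 + c * G1)\<^sup>2 \<le> R * (t_norm t g)\<^sup>2"
  proof -
    have "R * (G0\<^sup>2 + G1\<^sup>2) - (l * G0 + c * G1)\<^sup>2 = (l * G1 - c * G0)\<^sup>2"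
      by (simp add: R_def power2_eq_square algebra_simps)
    then have "(l * G0 + c * G1)\<^sup>2 \<le> R * (G0\<^sup>2 + G1\<^sup>2)"
      using zero_le_power2[of "l * G1 - c * G0"] by linarith
    then show ?thesis unfolding pyth by (simp add: G0_def G1_def)
  qed
  have R0: "0 \<le> R" by (simp add: R_def)
  have f: "t_norm t (p + X s) = 2 * t_norm t g" unfolding resid by (simp add: t_norm_scale[OF gV])
  have ng: "0 \<le> t_norm t g" by (rule t_norm_nonneg[OF gV])
  have "sqrt 2 * (a * t_norm t p) \<le> R * (2 * t_norm t g)"
  proof (rule power2_le_imp_le)
    have "(a * t_norm t p)\<^sup>2 \<le> (k\<^sup>2 * ((l + c / 2) * (l * G0 + c * G1)))\<^sup>2"
      using main al(2) t_norm_nonneg[OF p] by (intro power_mono) auto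
    also have "\<dots> = (k\<^sup>2)\<^sup>2 * ((l + c / 2)\<^sup>2 * (l * G0 + c * G1)\<^sup>2)" by (simp only: power_mult_distrib)
    also have "\<dots> \<le> (k\<^sup>2)\<^sup>2 * ((5 / 4 * R) * (R * (t_norm t g)\<^sup>2))"
      using sq1 sq2 R0 by (intro mult_left_mono mult_mono) auto
    finally have "(a * t_norm t p)\<^sup>2 \<le> (k\<^sup>2)\<^sup>2 * ((5 / 4 * R) * (R * (t_norm t g)\<^sup>2))" .
    moreover have "(sqrt 2 * (a * t_norm t p))\<^sup>2 = 2 * (a * t_norm t p)\<^sup>2"
      unfolding power_mult_distrib[of "sqrt 2"] by simp
    ultimately have "(sqrt 2 * (a * t_norm t p))\<^sup>2 \<le> 2 * ((k\<^sup>2)\<^sup>2 * ((5 / 4 * R) * (R * (t_norm t g)\<^sup>2)))"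
      by linarith
    also have "\<dots> = (2 * (k\<^sup>2)\<^sup>2 * (5 / 4)) * (R * t_norm t g)\<^sup>2"
      by (simp add: power2_eq_square[of "R * _"] power2_eq_square[of "t_norm t g"])
    also have "\<dots> \<le> 4 * (R * t_norm t g)\<^sup>2"
      by (intro mult_right_mono) (simp_all add: k_def power2_eq_square)
    also have "\<dots> = (R * (2 * t_norm t g))\<^sup>2" by (simp add: power_mult_distrib)
    finally show "(sqrt 2 * (a * t_norm t p))\<^sup>2 \<le> (R * (2 * t_norm t g))\<^sup>2" .
  qed (use R0 ng in simp)
  then show ?thesis unfolding s_def[symmetric] f by (simp add: R_def c_def mult.assoc)
qed

end

theorem proposition10p4:
  fixes P :: "'n::finite ddm"
    and t :: "'n tuple \<Rightarrow> 'n tuple \<Rightarrow> complex"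
    and X :: "'n tuple \<Rightarrow> 'n tuple"
  assumes "setting P"
    and "alpha_h P > 0"
    and "is_scalar_product (Vh_multi P) t"
    and "\<forall>w \<in> Vh_multi P. X w \<in> Vh_multi P"
    and "orthogonal_projector (Vh_multi P) t (Vh_single P) (\<lambda>w. tuple_scale (1 / 2) (w + X w))"
  shows "gamma_h P t X \<ge>
    ennreal (sqrt 2) * alpha_h P / ((lambda_plus P t)\<^sup>2 + (2 * form_norm P / lambda_minus P t)\<^sup>2)"
proof -
  interpret skeleton_product P t
    using assms(1,3) by unfold_locales
  let ?den = "(lambda_plus P t)\<^sup>2 + (2 * form_norm P / lambda_minus P t)\<^sup>2"
  have F0: "form_norm P \<noteq> 0" using alpha_h_le_form_norm assms(2) by auto
  show ?thesis
    unfolding gamma_h_def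
  proof (rule INF_greatest)
    fix p assume "p \<in> Vh_multi P - {0}"
    then have p: "p \<in> Vh_multi P" "p \<noteq> 0" by auto
    have np: "0 < t_norm t p" by (rule t_self(2)[OF p])
    have mfin: "lambda_minus P t \<noteq> top"
    proof -
      have "lambda_minus P t \<le> ennreal (t_norm t p / rho_norm P p)"
        unfolding lambda_minus_def using p by (intro INF_lower) simp
      also have "\<dots> < top" by simp
      finally show ?thesis by simp
    qed
    show "ennreal (sqrt 2) * alpha_h P / ?den \<le> ennreal (t_norm t (p + X (scattering P t p)) / t_norm t p)"
    proof (cases "lambda_plus P t = top \<or> form_norm P = top \<or> lambda_minus P t = 0")
      case True
      \<comment> \<open>The lower bound degenerates to zero.\<close>
      have den: "?den = top"
        using True mfin F0
        by (auto simp: power2_eq_square ennreal_mult_top ennreal_top_mult ennreal_divide_zero ennreal_top_divide)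
      show ?thesis unfolding den by simp
    next
      case False
      obtain l where l: "lambda_plus P t = ennreal l" "0 \<le> l" using False by (cases "lambda_plus P t") auto
      obtain A where A: "form_norm P = ennreal A" "0 \<le> A" using False by (cases "form_norm P") auto
      obtain m where m: "lambda_minus P t = ennreal m" "0 < m"
        using False mfin by (cases "lambda_minus P t") (auto simp: less_le)
      have "alpha_h P \<noteq> top" using alpha_h_le_form_norm A by (auto simp: top_unique)
      then obtain a where a: "alpha_h P = ennreal a" "0 < a"
        using assms(2) by (cases "alpha_h P") (auto simp: less_le)
      have A0: "0 < A" using F0 A by (cases "A = 0") auto
      have quot: "m \<le> t_norm t q / rho_norm P q \<and> t_norm t q / rho_norm P q \<le> l"
        if q: "q \<in> Vh_multi P" "q \<noteq> 0" for q
      proof -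
        have "ennreal m \<le> ennreal (t_norm t q / rho_norm P q)"
          unfolding m(1)[symmetric] lambda_minus_def using q by (intro INF_lower) simp
        moreover have "ennreal (t_norm t q / rho_norm P q) \<le> ennreal l"
          unfolding l(1)[symmetric] lambda_plus_def using q by (intro SUP_upper) simp
        ultimately show ?thesis
          using l(2) t_norm_nonneg[OF q(1)] rho_norm_nonneg[OF q(1)] by simp
      qed
      \<comment> \<open>A vanishing lifting norm would make the quotient zero, below its positive infimum.\<close>
      have rho_pos: "0 < rho_norm P q" if q: "q \<in> Vh_multi P" "q \<noteq> 0" for q
        using quot[OF q] m(2) rho_norm_nonneg[OF q(1)] by (cases "rho_norm P q = 0") auto
      have rho0: "rho_norm P 0 = 0"
        using rho_norm_skel_le[OF broken_Vh_0] rho_norm_nonneg[OF Vh_multi_0] skel_0 broken_norm_0 by simp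
      have upper: "t_norm t q \<le> l * rho_norm P q" if q: "q \<in> Vh_multi P" for q
        using quot[OF q] rho_pos[OF q] by (cases "q = 0") (auto simp: t_norm_0 rho0 field_simps)
      have lower: "m * rho_norm P q \<le> t_norm t q" if q: "q \<in> Vh_multi P" for q
        using quot[OF q] rho_pos[OF q] by (cases "q = 0") (auto simp: t_norm_0 rho0 field_simps)
      have est: "sqrt 2 * a * t_norm t p \<le> (l\<^sup>2 + (2 * A / m)\<^sup>2) * t_norm t (p + X (scattering P t p))"
        by (rule residual_estimate[OF a A l(2) upper m(2) lower assms(5) p(1)])
      have den: "?den = ennreal (l\<^sup>2 + (2 * A / m)\<^sup>2)"
      proof -
        have "2 * form_norm P / lambda_minus P t = ennreal (2 * A / m)"
        proof -
          have "2 * form_norm P = ennreal (2 * A)" using A by (simp add: ennreal_mult)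
          then show ?thesis using A(2) m by (simp add: divide_ennreal)
        qed
        then show ?thesis using l A(2) m(2) by (simp add: ennreal_power ennreal_plus[symmetric] del: ennreal_plus)
      qed
      have dpos: "0 < l\<^sup>2 + (2 * A / m)\<^sup>2" using A0 m(2) by (intro add_nonneg_pos) auto
      have "ennreal (sqrt 2) * alpha_h P / ?den = ennreal (sqrt 2 * a / (l\<^sup>2 + (2 * A / m)\<^sup>2))"
      proof -
        have "ennreal (sqrt 2) * ennreal a = ennreal (sqrt 2 * a)" using a(2) by (simp add: ennreal_mult)
        moreover have "0 \<le> sqrt 2 * a" using a(2) by simp
        ultimately show ?thesis unfolding den a(1) using divide_ennreal[OF _ dpos] by metis
      qed
      also have "\<dots> \<le> ennreal (t_norm t (p + X (scattering P t p)) / t_norm t p)"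
        using est np dpos by (intro ennreal_leI) (simp add: field_simps)
      finally show ?thesis .
    qed
  qed
qed

end
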